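(* Let $X$ be a Kähler manifold and $I=\sum_{n\ge2}I_n\in\mathcal{A}_X^{0,1}(\mathcal{W}_{X,\mathbb{C}})$ the section obtained from Kapranov's $L_\infty$ structure. The connection $$D_F=\nabla-\delta+\frac1\hbar[I,-]_\star$$ on $\mathcal{W}_{X,\mathbb{C}}$ is flat.
   Context: **Kähler conventions.** Summation convention. $\omega=\omega_{\alpha\bar\beta}dz^\alpha\wedge d\bar z^\beta=\sqrt{-1}g_{\alpha\bar\beta}dz^\alpha\wedge d\bar z^\beta$ is the Kähler form, $\omega^{\bar\gamma\alpha}\omega_{\alpha\bar\beta}=\delta^{\bar\gamma}_{\bar\beta}$, $\omega^{\alpha\bar\beta}=-\omega^{\bar\beta\alpha}$. **Weyl bundle.** $\mathcal{W}_{X,\mathbb{C}}=\widehat{\mathrm{Sym}}(T^*X)[[\hbar]]\otimes\widehat{\mathrm{Sym}}(\overline{T^*X})[[\hbar]]$; local sections are formal power series in $\hbar$, $y^i$ (frame of the holomorphic cotangent bundle $T^*X$) and $\bar y^j$ (frame of $\overline{T^*X}$). $\delta=dz^i\wedge\partial_{y^i}+d\bar z^j\wedge\partial_{\bar y^j}$; $(\delta^{1,0})^{-1}a=\frac{1}{p_1+p_2}y^k\iota_{\partial_{z^k}}a$ if $a$ has form type $(p_1,q_1)$ and degree $p_2$ in the $y$'s (zero if $p_1+p_2=0$). $\nabla=\nabla^{1,0}+\nabla^{0,1}$ is the Levi-Civita connection on all tensor and Weyl bundles. Wick product: $a\star b=\sum_k\frac{\hbar^k}{k!}\omega^{i_1\bar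 j_1}\cdots\omega^{i_k\bar j_k}\partial_{y^{i_1}}\cdots\partial_{y^{i_k}}a\;\partial_{\bar y^{j_1}}\cdots\partial_{\bar y^{j_k}}b$, with form parts wedged; $[-,-]_\star$ is the graded commutator. **The section $I$.** Curvature: $\nabla^2(y^m)=R_{i\bar jk}^mdz^i\wedge d\bar z^j\otimes y^k$. Put $R_2^*=\frac12R_{i\bar jk}^md\bar z^j\otimes(y^iy^k\otimes\partial_{z^m})$ and $R_n^*=(\delta^{1,0})^{-1}\nabla^{1,0}R_{n-1}^*$ for $n\ge3$. Writing $R_n^*=R_{i_1\cdots i_n,\bar l}^jd\bar z^l\otimes(y^{i_1}\cdots y^{i_n}\otimes\partial_{z^j})$, put $I_n=R_{i_1\cdots i_n,\bar l}^j\,\omega_{j\bar k}\,d\bar z^l\otimes(y^{i_1}\cdots y^{i_n}\bar y^k)$. *)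

theory Defs
  imports
    "HOL-Analysis.Analysis"
    "HOL-Computational_Algebra.Formal_Power_Series"
    "HOL-Library.Function_Algebras"
begin

section \<open>Complex manifolds\<close>

text \<open>The derivatives below are derivatives over the reals; the predicates are meant for open \<open>S\<close>.\<close>

fun Ck_on :: "nat \<Rightarrow> (complex^'n) set \<Rightarrow> (complex^'n \<Rightarrow> complex) \<Rightarrow> bool" where
  "Ck_on 0 S f \<longleftrightarrow> continuous_on S f"
| "Ck_on (Suc k) S f \<longleftrightarrow>
     f differentiable_on S \<and> (\<forall>v. Ck_on k S (\<lambda>z. frechet_derivative f (at z) v))"

definition smooth_on :: "(complex^'n) set \<Rightarrow> (complex^'n \<Rightarrow> complex) \<Rightarrow> bool" where
  "smooth_on S f \<longleftrightarrow> (\<forall>k. Ck_on k S f)"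

definition holomorphic_map_on :: "(complex^'n) set \<Rightarrow> (complex^'n \<Rightarrow> complex^'n) \<Rightarrow> bool" where
  "holomorphic_map_on S f \<longleftrightarrow>
     (\<forall>z\<in>S. \<exists>D. (f has_derivative D) (at z) \<and> (\<forall>c v. D (c *s v) = c *s D v))"

type_synonym 'n cvec = "(complex, 'n) vec"
type_synonym 'n hmetric = "'n cvec \<Rightarrow> ((complex, 'n) vec, 'n) vec"
type_synonym ('a, 'n) chart = "'a set \<times> ('a \<Rightarrow> 'n cvec)"

definition chart_image :: "('a, 'n::finite) chart \<Rightarrow> 'a set \<Rightarrow> 'n cvec set" where
  "chart_image c V = snd c ` (fst c \<inter> V)"

definition transition ::
  "('a, 'n::finite) chart \<Rightarrow> ('a, 'n) chart \<Rightarrow> 'n cvec \<Rightarrow> 'n cvec" where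
  "transition c c' = (\<lambda>z. snd c' (inv_into (fst c) (snd c) z))"

locale complex_manifold =
  fixes atlas :: "('a::{t2_space, second_countable_topology}, 'n::{finite, linorder}) chart set"
  assumes chart_open: "c \<in> atlas \<Longrightarrow> open (fst c) \<and> open (snd c ` fst c)"
    and chart_homeomorphism: "c \<in> atlas \<Longrightarrow> \<exists>\<psi>. homeomorphism (fst c) (snd c ` fst c) (snd c) \<psi>"
    and charts_cover: "(\<Union>c\<in>atlas. fst c) = UNIV"
    and transition_holomorphic: "c \<in> atlas \<Longrightarrow> c' \<in> atlas \<Longrightarrow>
          holomorphic_map_on (chart_image c (fst c')) (transition c c')"


section \<open>Fibres of the bundle of Weyl-bundle-valued forms\<close>

text \<open>
  In a chart \<open>z\<close>, the index \<open>Inl i\<close> stands for the holomorphic direction \<open>z\<^sup>i\<close> and \<open>Inr i\<close> for the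
  antiholomorphic one. A fibre element \<open>x\<close> is the formal sum over \<open>S\<close>, \<open>m\<close> of
  \<open>x S m \<cdot> dx\<^sup>S \<otimes> y\<^sup>m\<close>, where \<open>x S m\<close> is a power series in \<open>\<hbar>\<close> (\<open>= fps_X\<close>), \<open>dx\<^sup>S\<close> is the wedge product
  of the \<open>dz\<^sup>i\<close> (\<open>Inl i \<in> S\<close>) and \<open>d\<bar>z\<^sup>i\<close> (\<open>Inr i \<in> S\<close>) in increasing order, and \<open>m\<close> is a
  multi-index: \<open>m (Inl i)\<close> is the exponent of \<open>y\<^sup>i\<close>, and \<open>m (Inr i)\<close> that of its antiholomorphic
  counterpart. Addition and finite sums of fibre elements are the pointwise ones of function types.
  The linear order on the type of indices only serves to order the factors of \<open>dx\<^sup>S\<close>.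
\<close>

type_synonym 'n idx = "'n + 'n"
type_synonym 'n weyl = "'n idx set \<Rightarrow> ('n idx \<Rightarrow> nat) \<Rightarrow> complex fps"
type_synonym 'n weyl_field = "'n cvec \<Rightarrow> 'n weyl"

fun idx_less :: "'n::linorder idx \<Rightarrow> 'n idx \<Rightarrow> bool" where
  "idx_less (Inl i) (Inl j) \<longleftrightarrow> i < j"
| "idx_less (Inl i) (Inr j) \<longleftrightarrow> True"
| "idx_less (Inr i) (Inl j) \<longleftrightarrow> False"
| "idx_less (Inr i) (Inr j) \<longleftrightarrow> i < j"

text \<open>For disjoint \<open>S\<close>, \<open>T\<close>: \<open>dx\<^sup>S \<and> dx\<^sup>T = wedge_sign S T dx\<^bsup>S \<union> T\<^esup>\<close>.\<close>

definition wedge_sign :: "'n::{finite, linorder} idx set \<Rightarrow> 'n idx set \<Rightarrow> complex" where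
  "wedge_sign S T = (- 1) ^ card {(s, t). s \<in> S \<and> t \<in> T \<and> idx_less t s}"

definition scl :: "complex \<Rightarrow> 'n weyl \<Rightarrow> 'n weyl"  (infixr "*\<^sub>w" 75) where
  "c *\<^sub>w x = (\<lambda>S m. fps_const c * x S m)"

definition wmul :: "'n::{finite, linorder} weyl \<Rightarrow> 'n weyl \<Rightarrow> 'n weyl"  (infixl "\<odot>" 70) where
  "a \<odot> b = (\<lambda>S m. \<Sum>T\<in>Pow S. \<Sum>p\<in>{p. \<forall>A. p A \<le> m A}.
      fps_const (wedge_sign T (S - T)) * a T p * b (S - T) (\<lambda>A. m A - p A))"

definition unit_exp :: "'n idx \<Rightarrow> 'n idx \<Rightarrow> nat" where
  "unit_exp A = (\<lambda>B. if B = A then 1 else 0)"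

definition dx :: "'n idx \<Rightarrow> 'n weyl" where
  "dx A = (\<lambda>S m. if S = {A} \<and> m = (\<lambda>_. 0) then 1 else 0)"

definition yv :: "'n idx \<Rightarrow> 'n weyl" where
  "yv A = (\<lambda>S m. if S = {} \<and> m = unit_exp A then 1 else 0)"

definition dy :: "'n idx \<Rightarrow> 'n weyl \<Rightarrow> 'n weyl" where
  "dy A a = (\<lambda>S m. of_nat (m A + 1) * a S (m(A := m A + 1)))"

definition iota :: "'n::{finite, linorder} idx \<Rightarrow> 'n weyl \<Rightarrow> 'n weyl" where
  "iota A a = (\<lambda>S m. if A \<in> S then 0 else fps_const (wedge_sign {A} S) * a (insert A S) m)"

definition delta :: "'n::{finite, linorder} weyl \<Rightarrow> 'n weyl" where
  "delta a = (\<Sum>A\<in>UNIV. dx A \<odot> dy A a)"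

definition form_deg10 :: "'n::finite idx set \<Rightarrow> nat" where
  "form_deg10 S = card {i. Inl i \<in> S}"

definition y_deg :: "('n::finite idx \<Rightarrow> nat) \<Rightarrow> nat" where
  "y_deg m = (\<Sum>i\<in>UNIV. m (Inl i))"

text \<open>\<open>(\<delta>\<^bsup>1,0\<^esup>)\<^bsup>-1\<^esup>\<close>; the convention \<open>1 / 0 = 0\<close> covers the case \<open>p\<^sub>1 + p\<^sub>2 = 0\<close>.\<close>

definition delta10_inv :: "'n::{finite, linorder} weyl \<Rightarrow> 'n weyl" where
  "delta10_inv a = (\<Sum>k\<in>UNIV. yv (Inl k) \<odot> iota (Inl k)
      (\<lambda>S m. fps_const (1 / of_nat (form_deg10 S + y_deg m)) * a S m))"

text \<open>
  The Wick product for the bivector \<open>W i j = \<omega>\<^bsup>i\<bar>j\<^esup>\<close>. The \<open>k\<close>-th term of the sum is a multiple of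
  \<open>\<hbar>\<^sup>k\<close>, so that the coefficient of \<open>\<hbar>\<^sup>N\<close> only involves \<open>k \<le> N\<close>.
\<close>

definition wick_term ::
  "('n \<Rightarrow> 'n \<Rightarrow> complex) \<Rightarrow> nat \<Rightarrow> 'n::{finite, linorder} weyl \<Rightarrow> 'n weyl \<Rightarrow> 'n weyl" where
  "wick_term W k a b = (\<Sum>I\<in>{I. length I = k}. \<Sum>J\<in>{J. length J = k}.
      (\<Prod>r<k. W (I ! r) (J ! r)) *\<^sub>w
        (foldr dy (map Inl I) a \<odot> foldr dy (map Inr J) b))"

definition wick ::
  "('n \<Rightarrow> 'n \<Rightarrow> complex) \<Rightarrow> 'n::{finite, linorder} weyl \<Rightarrow> 'n weyl \<Rightarrow> 'n weyl" where
  "wick W a b = (\<lambda>S m. Abs_fps (\<lambda>N. \<Sum>k\<le>N.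
      fps_nth (fps_X ^ k * fps_const (1 / fact k) * wick_term W k a b S m) N))"

definition form_part :: "nat \<Rightarrow> 'n weyl \<Rightarrow> 'n weyl" where
  "form_part p a = (\<lambda>S m. if card S = p then a S m else 0)"

definition wick_comm ::
  "('n \<Rightarrow> 'n \<Rightarrow> complex) \<Rightarrow> 'n::{finite, linorder} weyl \<Rightarrow> 'n weyl \<Rightarrow> 'n weyl" where
  "wick_comm W a b = (\<Sum>p\<le>2 * CARD('n). \<Sum>q\<le>2 * CARD('n).
      wick W (form_part p a) (form_part q b)
        - (- 1) ^ (p * q) *\<^sub>w wick W (form_part q b) (form_part p a))"

text \<open>Division by \<open>\<hbar>\<close>, for elements without \<open>\<hbar>\<^sup>0\<close>-term such as graded Wick commutators.\<close>

definition hbar_div :: "'n weyl \<Rightarrow> 'n weyl" where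
  "hbar_div a = (\<lambda>S m. fps_shift 1 (a S m))"


section \<open>Differential operators in a chart\<close>

definition wirt :: "'n::finite idx \<Rightarrow> ('n cvec \<Rightarrow> complex) \<Rightarrow> 'n cvec \<Rightarrow> complex" where
  "wirt A f z = (let D = frechet_derivative f (at z) in
     case A of Inl i \<Rightarrow> (D (axis i 1) - \<i> * D (axis i \<i>)) / 2
             | Inr i \<Rightarrow> (D (axis i 1) + \<i> * D (axis i \<i>)) / 2)"

definition pd :: "'n::finite idx \<Rightarrow> 'n weyl_field \<Rightarrow> 'n weyl_field" where
  "pd A a = (\<lambda>z S m. Abs_fps (\<lambda>k. wirt A (\<lambda>x. fps_nth (a x S m) k) z))"

definition ext_d :: "'n::{finite, linorder} weyl_field \<Rightarrow> 'n weyl_field" where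
  "ext_d a = (\<lambda>z. \<Sum>A\<in>UNIV. dx A \<odot> pd A a z)"


section \<open>Kaehler manifolds\<close>

text \<open>
  In a chart, a Hermitian metric is given by its matrix \<open>g z $ \<alpha> $ \<beta> = g\<^bsub>\<alpha>\<bar>\<beta>\<^esub>(z)\<close>.
\<close>

definition omega :: "'n::finite hmetric \<Rightarrow> 'n hmetric" where
  "omega g z = (\<chi> i j. \<i> * g z $ i $ j)"

text \<open>\<open>\<omega>\<^bsup>i\<bar>j\<^esup> = - \<omega>\<^bsup>\<bar>ji\<^esup>\<close>, where \<open>\<omega>\<^bsup>\<bar>ji\<^esup>\<close> is the inverse matrix of \<open>\<omega>\<^bsub>i\<bar>j\<^esub>\<close>.\<close>

definition omega_inv ::
    "'n hmetric \<Rightarrow> 'n cvec \<Rightarrow> 'n::finite \<Rightarrow> 'n \<Rightarrow> complex" where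
  "omega_inv g z i j = - (matrix_inv (omega g z) $ j $ i)"

definition kaehler_form ::
    "'n hmetric \<Rightarrow> 'n::{finite, linorder} weyl_field" where
  "kaehler_form g z = (\<Sum>i\<in>UNIV. \<Sum>j\<in>UNIV. omega g z $ i $ j *\<^sub>w (dx (Inl i) \<odot> dx (Inr j)))"

definition jacobian ::
  "('a, 'n::finite) chart \<Rightarrow> ('a, 'n) chart \<Rightarrow> 'n cvec \<Rightarrow> 'n \<Rightarrow> 'n \<Rightarrow> complex" where
  "jacobian c c' z i k = wirt (Inl k) (\<lambda>x. transition c c' x $ i) z"

locale kaehler_manifold = complex_manifold atlas
  for atlas :: "('a::{t2_space, second_countable_topology}, 'n::{finite, linorder}) chart set" +
  fixes g :: "('a, 'n) chart \<Rightarrow> 'n hmetric"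
  assumes metric_smooth: "c \<in> atlas \<Longrightarrow> smooth_on (chart_image c UNIV) (\<lambda>z. g c z $ \<alpha> $ \<beta>)"
    and metric_hermitian: "c \<in> atlas \<Longrightarrow> z \<in> chart_image c UNIV \<Longrightarrow>
          g c z $ \<beta> $ \<alpha> = cnj (g c z $ \<alpha> $ \<beta>)"
    and metric_positive: "c \<in> atlas \<Longrightarrow> z \<in> chart_image c UNIV \<Longrightarrow> v \<noteq> 0 \<Longrightarrow>
          0 < Re (\<Sum>\<alpha>\<in>UNIV. \<Sum>\<beta>\<in>UNIV. g c z $ \<alpha> $ \<beta> * v $ \<alpha> * cnj (v $ \<beta>))"
    and metric_transform: "c \<in> atlas \<Longrightarrow> c' \<in> atlas \<Longrightarrow> z \<in> chart_image c (fst c') \<Longrightarrow>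
          g c z $ \<alpha> $ \<beta> = (\<Sum>\<gamma>\<in>UNIV. \<Sum>\<epsilon>\<in>UNIV.
            jacobian c c' z \<gamma> \<alpha> * cnj (jacobian c c' z \<epsilon> \<beta>) * g c' (transition c c' z) $ \<gamma> $ \<epsilon>)"
    and kaehler_form_closed: "c \<in> atlas \<Longrightarrow> z \<in> chart_image c UNIV \<Longrightarrow>
          ext_d (kaehler_form (g c)) z = 0"


section \<open>The Levi-Civita connection\<close>

text \<open>The complex bilinear extension of the Riemannian metric to the complexified tangent space.\<close>

definition cmetric ::
    "'n hmetric \<Rightarrow> 'n cvec \<Rightarrow> ((complex, 'n idx) vec, 'n::finite idx) vec" where
  "cmetric g z = (\<chi> A B. case (A, B) of
      (Inl i, Inr j) \<Rightarrow> g z $ i $ j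
    | (Inr j, Inl i) \<Rightarrow> g z $ i $ j
    | _ \<Rightarrow> 0)"

text \<open>
  \<open>christoffel g z C A B = \<Gamma>\<^sup>C\<^bsub>AB\<^esub>\<close>, so that \<open>\<nabla>\<^sub>A \<partial>\<^sub>B = \<Gamma>\<^sup>C\<^bsub>AB\<^esub> \<partial>\<^sub>C\<close>: the Koszul formula in the
  (commuting) complex coordinate frame.
\<close>

definition christoffel ::
    "'n hmetric \<Rightarrow> 'n cvec \<Rightarrow> 'n idx \<Rightarrow> 'n idx \<Rightarrow> 'n::finite idx \<Rightarrow> complex" where
  "christoffel g z C A B = (\<Sum>D\<in>UNIV. matrix_inv (cmetric g z) $ C $ D *
      (wirt A (\<lambda>x. cmetric g x $ B $ D) z + wirt B (\<lambda>x. cmetric g x $ A $ D) z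
        - wirt D (\<lambda>x. cmetric g x $ A $ B) z)) / 2"

text \<open>
  The exterior covariant derivative on forms with values in the Weyl bundle, in the directions
  \<open>A \<in> P\<close>: \<open>\<nabla> = nabla UNIV\<close>, \<open>\<nabla>\<^bsup>1,0\<^esup> = nabla (range Inl)\<close>. On the frame of the cotangent bundle,
  \<open>\<nabla>\<^sub>A y\<^sup>C = - \<Gamma>\<^sup>C\<^bsub>AB\<^esub> y\<^sup>B\<close>.
\<close>

definition nabla ::
  "'n idx set \<Rightarrow> 'n hmetric \<Rightarrow> 'n::{finite, linorder} weyl_field \<Rightarrow> 'n weyl_field" where
  "nabla P g a = (\<lambda>z. \<Sum>A\<in>P. dx A \<odot> (pd A a z
      - (\<Sum>B\<in>UNIV. \<Sum>C\<in>UNIV. christoffel g z C A B *\<^sub>w (yv B \<odot> dy C (a z)))))"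

text \<open>
  The same with values in the tensor product of the Weyl bundle and the complexified tangent bundle;
  \<open>V\<close> stands for \<open>V C \<otimes> \<partial>\<^sub>C\<close> summed over \<open>C\<close>.
\<close>

definition nabla_T ::
  "'n idx set \<Rightarrow> 'n hmetric \<Rightarrow> ('n idx \<Rightarrow> 'n::{finite, linorder} weyl_field) \<Rightarrow>
    'n idx \<Rightarrow> 'n weyl_field" where
  "nabla_T P g V C = (\<lambda>z. nabla P g (V C) z
      + (\<Sum>A\<in>P. \<Sum>B\<in>UNIV. christoffel g z C A B *\<^sub>w (dx A \<odot> V B z)))"

text \<open>\<open>R\<^sup>m\<^bsub>i\<bar>jk\<^esub>\<close>: the coefficient of \<open>dz\<^sup>i \<and> d\<bar>z\<^sup>j \<otimes> y\<^sup>k\<close> in \<open>\<nabla>\<^sup>2(y\<^sup>m)\<close>.\<close>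

definition curv ::
  "'n hmetric \<Rightarrow> 'n cvec \<Rightarrow> 'n::{finite, linorder} \<Rightarrow> 'n \<Rightarrow> 'n \<Rightarrow> 'n \<Rightarrow> complex" where
  "curv g z i j k m =
     fps_nth (nabla UNIV g (nabla UNIV g (\<lambda>_. yv (Inl m))) z {Inl i, Inr j} (unit_exp (Inl k))) 0"


section \<open>The section \<open>I\<close> and the connection \<open>D\<^sub>F\<close>\<close>

text \<open>\<open>R_star g n C\<close> is the component of \<open>R\<^sub>n\<^sup>*\<close> along \<open>\<partial>\<^sub>C\<close>; the values for \<open>n < 2\<close> are not used.\<close>

fun R_star ::
  "'n hmetric \<Rightarrow> nat \<Rightarrow> 'n idx \<Rightarrow> 'n::{finite, linorder} weyl_field" where
  "R_star g 0 = (\<lambda>C z. 0)"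
| "R_star g (Suc 0) = (\<lambda>C z. 0)"
| "R_star g (Suc (Suc 0)) = (\<lambda>C z. case C of
      Inl m \<Rightarrow> (\<Sum>i\<in>UNIV. \<Sum>j\<in>UNIV. \<Sum>k\<in>UNIV.
        (curv g z i j k m / 2) *\<^sub>w (dx (Inr j) \<odot> yv (Inl i) \<odot> yv (Inl k)))
    | Inr m \<Rightarrow> 0)"
| "R_star g (Suc (Suc (Suc n))) =
     (\<lambda>C z. delta10_inv (nabla_T (range Inl) g (R_star g (Suc (Suc n))) C z))"

definition I_part ::
  "'n hmetric \<Rightarrow> nat \<Rightarrow> 'n::{finite, linorder} weyl_field" where
  "I_part g n z = (\<Sum>j\<in>UNIV. \<Sum>k\<in>UNIV.
     omega g z $ j $ k *\<^sub>w (R_star g n (Inl j) z \<odot> yv (Inr k)))"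

text \<open>\<open>I\<^sub>n\<close> is homogeneous of degree \<open>n\<close> in the holomorphic \<open>y\<close>'s, hence only \<open>n \<le> y_deg m\<close> matters.\<close>

definition I_sec :: "'n hmetric \<Rightarrow> 'n::{finite, linorder} weyl_field" where
  "I_sec g z = (\<lambda>S m. \<Sum>n = 2..y_deg m. I_part g n z S m)"

definition D_F_chart ::
  "'n hmetric \<Rightarrow> 'n::{finite, linorder} weyl_field \<Rightarrow> 'n weyl_field" where
  "D_F_chart g a = (\<lambda>z. nabla UNIV g a z - delta (a z)
      + hbar_div (wick_comm (omega_inv g z) (I_sec g z) (a z)))"

definition D_F ::
  "(('a, 'n) chart \<Rightarrow> 'n hmetric) \<Rightarrow>
    (('a, 'n) chart \<Rightarrow> 'n::{finite, linorder} weyl_field) \<Rightarrow> ('a, 'n) chart \<Rightarrow> 'n weyl_field" where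
  "D_F g a = (\<lambda>c. D_F_chart (g c) (a c))"


section \<open>Sections of the bundle of Weyl-bundle-valued forms\<close>

definition contract :: "'n idx cvec \<Rightarrow> 'n::{finite, linorder} weyl \<Rightarrow> 'n weyl" where
  "contract v x = (\<Sum>A\<in>UNIV. v $ A *\<^sub>w iota A x)"

text \<open>
  A fibre element is determined by the values of its form part on complexified tangent vectors \<open>vs\<close>
  and of its homogeneous parts, as polynomials in the \<open>y\<close>'s, on a complexified tangent vector \<open>w\<close>.
  This expresses the change of charts.
\<close>

definition weyl_eval ::
  "'n::{finite, linorder} weyl \<Rightarrow> 'n idx cvec list \<Rightarrow> 'n idx cvec \<Rightarrow> nat \<Rightarrow> complex fps" where
  "weyl_eval x vs w r = (\<Sum>m | (\<Sum>A\<in>UNIV. m A) = r.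
     fps_const (\<Prod>A\<in>UNIV. (w $ A) ^ m A) * foldr contract vs x {} m)"

definition push_forward ::
  "('a, 'n::finite) chart \<Rightarrow> ('a, 'n) chart \<Rightarrow> 'n cvec \<Rightarrow> 'n idx cvec \<Rightarrow> 'n idx cvec" where
  "push_forward c c' z v = (\<chi> A. case A of
      Inl i \<Rightarrow> (\<Sum>k\<in>UNIV. jacobian c c' z i k * v $ Inl k)
    | Inr i \<Rightarrow> (\<Sum>k\<in>UNIV. cnj (jacobian c c' z i k) * v $ Inr k))"

text \<open>\<open>weyl_forms atlas V\<close>: smooth Weyl-bundle-valued forms over the open set \<open>V\<close>.\<close>

definition weyl_forms ::
  "('a, 'n) chart set \<Rightarrow> 'a set \<Rightarrow> (('a, 'n) chart \<Rightarrow> 'n::{finite, linorder} weyl_field) set" where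
  "weyl_forms atlas V = {a.
     (\<forall>c\<in>atlas. \<forall>S m k. smooth_on (chart_image c V) (\<lambda>z. fps_nth (a c z S m) k)) \<and>
     (\<forall>c\<in>atlas. \<forall>c'\<in>atlas. \<forall>z\<in>chart_image c (fst c' \<inter> V). \<forall>vs w r.
        weyl_eval (a c z) vs w r =
        weyl_eval (a c' (transition c c' z))
          (map (push_forward c c' z) vs) (push_forward c c' z w) r)}"

text \<open>
  Flatness of a connection, given in charts and acting on Weyl-bundle-valued forms: its square
  vanishes on all sections over all open sets.
\<close>

definition flat_connection ::
  "('a::topological_space, 'n) chart set \<Rightarrow>
    ((('a, 'n) chart \<Rightarrow> 'n::{finite, linorder} weyl_field) \<Rightarrow> ('a, 'n) chart \<Rightarrow> 'n weyl_field) \<Rightarrow> bool" where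
  "flat_connection atlas D \<longleftrightarrow>
     (\<forall>V. open V \<longrightarrow> (\<forall>a\<in>weyl_forms atlas V.
        \<forall>c\<in>atlas. \<forall>z\<in>chart_image c V. D (D a) c z = 0))"

end

theory Submission
  imports Defs
begin

text \<open>
  Over the germs of smooth functions at a point, all identities take place in a ring with commuting
  derivations \<open>\<partial>\<^sub>A\<close>. Put \<open>p\<^sub>j = \<omega>\<^bsub>j\<bar>k\<^esub> \<bar>y\<^sup>k\<close>. Then \<open>I = d\<bar>z\<^sup>l p\<^sub>j f\<^sub>l\<^sup>j\<close> for power series \<open>f\<^sub>l\<^sup>j\<close> in the holomorphic \<open>y\<close>'s,
  and \<open>D\<^sub>F = dx\<^sup>A \<and> T\<^sub>A\<close> with \<open>T\<^sub>i = \<nabla>\<^sub>i - \<partial>/\<partial>y\<^sup>i\<close> and \<open>T\<^sub>\<bar>l = \<nabla>\<^sub>\<bar>l - \<partial>/\<partial>\<bar>y\<^sup>l + ad f\<^sub>l\<close>, where \<open>ad f\<close> is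
  \<open>\<hbar>\<^sup>-\<^sup>1\<close> times the Wick commutator with \<open>p\<^sub>j f\<^sup>j\<close>. Flatness says that the \<open>T\<^sub>A\<close> commute. Since \<open>ad\<close> is a
  homomorphism from the Lie algebra of formal vector fields, and \<open>[\<nabla>\<^sub>i, \<nabla>\<^sub>\<bar>l] = ad \<rho>\<^sub>i\<^sub>\<bar>l\<close> for the curvature \<open>\<rho>\<close>, this
  follows from
  \<^item> \<open>\<nabla>\<^sub>i f\<^sub>l + \<rho>\<^sub>i\<^sub>\<bar>l = \<partial>f\<^sub>l/\<partial>y\<^sup>i\<close>, which the recursion for \<open>R\<^sub>n\<^sup>*\<close> yields degree by degree in \<open>y\<close>;
  \<^item> \<open>\<omega>\<^bsub>j\<bar>l\<^esub> f\<^sub>k\<^sup>j = \<omega>\<^bsub>j\<bar>k\<^esub> f\<^sub>l\<^sup>j\<close> and the Maurer-Cartan equation \<open>\<nabla>\<^sub>\<bar>l f\<^sub>k - \<nabla>\<^sub>\<bar>k f\<^sub>l + [f\<^sub>l, f\<^sub>k] = 0\<close>: by the first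
    equation, the difference \<open>u\<close> of the two sides satisfies \<open>\<partial>u/\<partial>y\<^sup>i = \<nabla>\<^sub>i u\<close> and has no term of degree \<open>0\<close>
    in \<open>y\<close>, hence vanishes.
\<close>

section \<open>Multivariate formal power series\<close>

text \<open>The recursion differentiates the metric to every order, so the algebra is carried out
  once in an abstract ring with commuting derivations, where no smoothness has to be tracked. Germs
  at a point supply such a ring, and an identity of germs is then evaluated at that point. The
  obstacle is that \<open>ad\<close> has to be a Lie homomorphism although the Wick product contains
  contractions of every order. This works because the elements p_j f^j are linear in the barred
  variables: a contraction that hits p_j consumes it. Multiplication by such an element from the
  right has only terms of order 0 and 1 in \<hbar>, and the higher contractions in multiplication
  from the left recombine by a Leibniz rule for products with series in y alone. Associativity of
  the Wick product is bypassed in this way. The two conditions in antiholomorphic directions have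
  different origins: the Maurer-Cartan equation collects the commutators of the \<open>ad\<close>
  terms with each other and with \<nabla>, whereas the symmetry in the lowered index is needed
  because differentiation along a barred variable also hits the factors p_j.\<close>

typedef ('i, 'r) mps = "UNIV :: (('i \<Rightarrow> nat) \<Rightarrow> 'r) set"
  morphisms coeff Mps ..

setup_lifting type_definition_mps

lemma mps_eqI: "(\<And>m. coeff a m = coeff b m) \<Longrightarrow> a = b"
  by (metis coeff_inject ext)

lemma coeff_Mps [simp]: "coeff (Mps f) = f"
  by (simp add: Mps_inverse)

lemma finite_multi_indices_le [simp]: "finite {..m :: 'i::finite \<Rightarrow> nat}"
proof -
  have "finite (PiE UNIV (\<lambda>i. {..m i}))"
    by (intro finite_PiE) auto
  moreover have "{..m} = PiE UNIV (\<lambda>i. {..m i})"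
    by (auto simp: PiE_def Pi_def le_fun_def)
  ultimately show ?thesis by simp
qed

instantiation mps :: (type, comm_monoid_add) comm_monoid_add
begin
lift_definition zero_mps :: "('a, 'b) mps" is "\<lambda>_. 0" .
lift_definition plus_mps :: "('a, 'b) mps \<Rightarrow> ('a, 'b) mps \<Rightarrow> ('a, 'b) mps" is "\<lambda>a b m. a m + b m" .
instance by standard (transfer; simp add: fun_eq_iff ac_simps)+
end

instantiation mps :: (type, ab_group_add) ab_group_add
begin
lift_definition uminus_mps :: "('a, 'b) mps \<Rightarrow> ('a, 'b) mps" is "\<lambda>a m. - a m" .
lift_definition minus_mps :: "('a, 'b) mps \<Rightarrow> ('a, 'b) mps \<Rightarrow> ('a, 'b) mps" is "\<lambda>a b m. a m - b m" .
instance by standard (transfer; simp add: fun_eq_iff)+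
end

instantiation mps :: (type, real_vector) real_vector
begin
lift_definition scaleR_mps :: "real \<Rightarrow> ('a, 'b) mps \<Rightarrow> ('a, 'b) mps" is "\<lambda>c a m. c *\<^sub>R a m" .
instance by standard (transfer; simp add: fun_eq_iff scaleR_add_left scaleR_add_right)+
end

lemma multi_index_mult_assoc:
  fixes a b c :: "('i::finite \<Rightarrow> nat) \<Rightarrow> 'r::comm_ring_1"
  shows "(\<Sum>p\<in>{..m}. (\<Sum>q\<in>{..p}. a q * b (p - q)) * c (m - p)) =
    (\<Sum>q\<in>{..m}. a q * (\<Sum>r\<in>{..m - q}. b r * c (m - q - r)))"
proof -
  have "(\<Sum>p\<in>{..m}. (\<Sum>q\<in>{..p}. a q * b (p - q)) * c (m - p)) =
     (\<Sum>(p, q)\<in>Sigma {..m} (\<lambda>p. {..p}). a q * b (p - q) * c (m - p))"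
    by (simp add: sum_distrib_right sum.Sigma)
  also have "\<dots> = (\<Sum>(q, r)\<in>Sigma {..m} (\<lambda>q. {..m - q}). a q * (b r * c (m - q - r)))"
  proof (rule sum.reindex_bij_witness[where i = "\<lambda>(q, r). (q + r, q)" and j = "\<lambda>(p, q). (q, p - q)"],
      goal_cases)
    case (1 x)
    then show ?case by (auto simp: le_fun_def fun_eq_iff)
  next
    case (2 x)
    then show ?case
      by (auto simp: le_fun_def fun_eq_iff intro: order_trans) (meson diff_le_mono)
  next
    case (3 x)
    then show ?case by (auto simp: le_fun_def fun_eq_iff fun_diff_def)
  next
    case (4 x)
    then show ?case
      by (auto simp: le_fun_def fun_eq_iff fun_diff_def)
        (metis (mono_tags, lifting) Nat.le_diff_conv2 add.commute le_trans)
  next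
    case (5 x)
    then obtain p q where x: "x = (p, q)" and le: "q \<le> p" "p \<le> m" by auto
    have "m - q - (p - q) = m - p"
      using le by (auto simp: le_fun_def fun_eq_iff fun_diff_def)
    then show ?case by (simp add: x mult.assoc)
  qed
  also have "\<dots> = (\<Sum>q\<in>{..m}. a q * (\<Sum>r\<in>{..m - q}. b r * c (m - q - r)))"
    by (simp add: sum_distrib_left sum.Sigma)
  finally show ?thesis .
qed

lemma multi_index_mult_commute:
  fixes a b :: "('i::finite \<Rightarrow> nat) \<Rightarrow> 'r::comm_ring_1"
  shows "(\<Sum>p\<in>{..m}. a p * b (m - p)) = (\<Sum>p\<in>{..m}. b p * a (m - p))"
  by (rule sum.reindex_bij_witness[where i = "\<lambda>p. m - p" and j = "\<lambda>p. m - p"])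
     (auto simp: le_fun_def fun_eq_iff fun_diff_def mult.commute)

instantiation mps :: (finite, comm_ring_1) comm_ring_1
begin
lift_definition one_mps :: "('a, 'b) mps" is "\<lambda>m. if m = 0 then 1 else 0" .
lift_definition times_mps :: "('a, 'b) mps \<Rightarrow> ('a, 'b) mps \<Rightarrow> ('a, 'b) mps"
  is "\<lambda>a b m. \<Sum>p\<in>{..m}. a p * b (m - p)" .
instance
proof
  fix a b c :: "('a, 'b) mps"
  show "a * b * c = a * (b * c)"
    by transfer (simp add: fun_eq_iff multi_index_mult_assoc)
  show "a * b = b * a"
    by transfer (simp add: fun_eq_iff multi_index_mult_commute[of _ _ "_ :: 'a \<Rightarrow> nat"])
  show "1 * a = a"
  proof (transfer, rule ext)
    fix a :: "('a \<Rightarrow> nat) \<Rightarrow> 'b" and m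
    have "(\<Sum>p\<in>{..m}. (if p = 0 then 1 else 0) * a (m - p)) = (\<Sum>p\<in>{0}. a (m - p))"
      by (rule sum.mono_neutral_cong_right) (auto simp: le_fun_def)
    then show "(\<Sum>p\<in>{..m}. (if p = 0 then 1 else 0) * a (m - p)) = a m"
      by (simp add: fun_diff_def)
  qed
  show "(a + b) * c = a * c + b * c"
    by transfer (simp add: fun_eq_iff distrib_right sum.distrib)
  show "(0::('a, 'b) mps) \<noteq> 1"
    by transfer (metis zero_neq_one)
qed
end

instance mps :: (finite, "{comm_ring_1, real_algebra_1}") real_algebra_1
  by standard (transfer; simp add: fun_eq_iff scaleR_sum_right)+

lemma coeff_zero [simp]: "coeff 0 m = 0" by (simp add: zero_mps.rep_eq)
lemma coeff_add [simp]: "coeff (a + b) m = coeff a m + coeff b m" by (simp add: plus_mps.rep_eq)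
lemma coeff_uminus [simp]: "coeff (- a) m = - coeff a m" by (simp add: uminus_mps.rep_eq)
lemma coeff_diff [simp]: "coeff (a - b) m = coeff a m - coeff b m" by (simp add: minus_mps.rep_eq)
lemma coeff_scaleR [simp]: "coeff (c *\<^sub>R a) m = c *\<^sub>R coeff a m" by (simp add: scaleR_mps.rep_eq)
lemma coeff_one: "coeff 1 m = (if m = 0 then 1 else 0)" by (simp add: one_mps.rep_eq)
lemma coeff_mult: "coeff (a * b) m = (\<Sum>p\<in>{..m}. coeff a p * coeff b (m - p))"
  by (simp add: times_mps.rep_eq)

lemma coeff_sum [simp]: "coeff (sum f A) m = (\<Sum>x\<in>A. coeff (f x) m)"
  by (induction A rule: infinite_finite_induct) auto

definition cst :: "'r::zero \<Rightarrow> ('i, 'r) mps" where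
  "cst c = Mps (\<lambda>m. if m = 0 then c else 0)"

definition var :: "'n idx \<Rightarrow> ('n idx, 'r::zero_neq_one) mps" where
  "var A = Mps (\<lambda>m. if m = unit_exp A then 1 else 0)"

definition pdy :: "'i \<Rightarrow> ('i, 'r::semiring_1) mps \<Rightarrow> ('i, 'r) mps" where
  "pdy A a = Mps (\<lambda>m. of_nat (m A + 1) * coeff a (m(A := m A + 1)))"

definition cmap :: "('r \<Rightarrow> 'r) \<Rightarrow> ('i, 'r) mps \<Rightarrow> ('i, 'r) mps" where
  "cmap d a = Mps (\<lambda>m. d (coeff a m))"

lemma coeff_cst: "coeff (cst c) m = (if m = 0 then c else 0)"
  by (simp add: cst_def)

lemma coeff_var: "coeff (var A) m = (if m = unit_exp A then 1 else 0)"
  by (simp add: var_def)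

lemma coeff_pdy: "coeff (pdy A a) m = of_nat (m A + 1) * coeff a (m(A := m A + 1))"
  by (simp add: pdy_def)

lemma coeff_cmap [simp]: "coeff (cmap d a) m = d (coeff a m)"
  by (simp add: cmap_def)

lemma coeff_cst_mult [simp]:
  fixes a :: "('i::finite, 'r::comm_ring_1) mps"
  shows "coeff (cst c * a) m = c * coeff a m"
proof -
  have "coeff (cst c * a) m = (\<Sum>p\<in>{0}. c * coeff a (m - p))"
    unfolding coeff_mult coeff_cst
    by (rule sum.mono_neutral_cong_right) (auto simp: le_fun_def)
  then show ?thesis by (simp add: fun_diff_def)
qed

lemma coeff_var_mult:
  fixes a :: "('n::finite idx, 'r::comm_ring_1) mps"
  shows "coeff (var A * a) m = (if m A = 0 then 0 else coeff a (m(A := m A - 1)))"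
proof (cases "m A = 0")
  case True
  then have "unit_exp A \<notin> {..m}"
    by (auto simp: unit_exp_def le_fun_def)
  then show ?thesis using True
    by (auto simp: coeff_mult coeff_var intro!: sum.neutral)
next
  case False
  then have "unit_exp A \<in> {..m}"
    by (auto simp: unit_exp_def le_fun_def)
  then have "coeff (var A * a) m = (\<Sum>p\<in>{unit_exp A}. coeff a (m - p))"
    unfolding coeff_mult coeff_var by (intro sum.mono_neutral_cong_right) auto
  moreover have "m - unit_exp A = m(A := m A - 1)"
    by (auto simp: unit_exp_def fun_eq_iff)
  ultimately show ?thesis using False by (simp del: fun_upd_apply)
qed

lemma cst_add: "cst (a + b) = cst a + cst (b :: 'r::comm_monoid_add)"
  by (rule mps_eqI) (simp add: coeff_cst)

lemma cst_uminus: "cst (- a) = - cst (a :: 'r::ab_group_add)"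
  by (rule mps_eqI) (simp add: coeff_cst)

lemma cst_diff: "cst (a - b) = cst a - cst (b :: 'r::ab_group_add)"
  by (rule mps_eqI) (simp add: coeff_cst)

lemma cst_0 [simp]: "cst (0 :: 'r::comm_monoid_add) = 0"
  by (rule mps_eqI) (simp add: coeff_cst)

lemma cst_1 [simp]: "cst 1 = (1 :: ('i::finite, 'r::comm_ring_1) mps)"
  by (rule mps_eqI) (simp add: coeff_cst coeff_one)

lemma cst_sum: "cst (sum f A) = (\<Sum>x\<in>A. cst (f x :: 'r::comm_monoid_add))"
  by (rule mps_eqI) (simp add: coeff_cst)

lemma cst_scaleR: "cst (c *\<^sub>R a) = c *\<^sub>R cst (a :: 'r::real_vector)"
  by (rule mps_eqI) (simp add: coeff_cst)

lemma cst_mult: "cst (a * b) = (cst a * cst b :: ('i::finite, 'r::comm_ring_1) mps)"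
  by (rule mps_eqI) (simp add: coeff_cst)

section \<open>Derivations\<close>

locale derivation =
  fixes D :: "'a::{comm_ring_1, real_algebra_1} \<Rightarrow> 'a"
  assumes add: "D (a + b) = D a + D b"
    and scaleR: "D (c *\<^sub>R a) = c *\<^sub>R D a"
    and mult: "D (a * b) = D a * b + a * D b"
begin

lemma zero [simp]: "D 0 = 0"
  using add[of 0 0] by simp

lemma one [simp]: "D 1 = 0"
  using mult[of 1 1] by simp

lemma minus: "D (- a) = - D a"
  using add[of a "- a"] by (simp add: eq_neg_iff_add_eq_0 add.commute)

lemma diff: "D (a - b) = D a - D b"
  using add[of a "- b"] by (simp add: minus)

lemma sum: "D (sum f A) = (\<Sum>x\<in>A. D (f x))"
  by (induction A rule: infinite_finite_induct) (auto simp: add)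

lemmas linear = add minus diff sum scaleR

end

lemma coeff_var_pdy:
  fixes u :: "('n::finite idx, 'r::comm_ring_1) mps"
  shows "coeff (var A * pdy A u) m = of_nat (m A) * coeff u m"
proof (cases "m A = 0")
  case False
  then have "(m(A := m A - 1))(A := m A) = m"
    by (simp add: fun_upd_idem)
  with False show ?thesis
    by (simp add: coeff_var_mult coeff_pdy)
qed (simp add: coeff_var_mult)

lemma var_mult_cancel:
  fixes u v :: "('n::finite idx, 'r::comm_ring_1) mps"
  assumes "var A * u = var A * v"
  shows "u = v"
proof (rule mps_eqI)
  fix m
  show "coeff u m = coeff v m"
    using arg_cong[OF assms, of "\<lambda>w. coeff w (m(A := m A + 1))"] by (simp add: coeff_var_mult)
qed

text \<open>Multiplication by \<open>var A\<close> turns \<open>pdy A\<close> into the weight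
  operator that scales the coefficient at \<open>m\<close> by \<open>m A\<close>. For it the Leibniz
  rule is additivity of exponents, \<open>p A + (m - p) A = m A\<close>, and the extra factor
  cancels by \<open>var_mult_cancel\<close>.\<close>

lemma pdy_derivation: "derivation (pdy A :: ('n::finite idx, 'r::{comm_ring_1, real_algebra_1}) mps \<Rightarrow> _)"
proof
  fix a b :: "('n idx, 'r) mps" and c :: real
  show "pdy A (a + b) = pdy A a + pdy A b"
    by (rule mps_eqI) (simp add: coeff_pdy algebra_simps)
  show "pdy A (c *\<^sub>R a) = c *\<^sub>R pdy A a"
    by (rule mps_eqI) (simp add: coeff_pdy algebra_simps)
  show "pdy A (a * b) = pdy A a * b + a * pdy A b"
  proof (rule var_mult_cancel[of A], rule mps_eqI)
    fix m :: "'n idx \<Rightarrow> nat"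
    have "coeff (var A * (pdy A a * b + a * pdy A b)) m =
        coeff ((var A * pdy A a) * b) m + coeff (a * (var A * pdy A b)) m"
      by (simp add: distrib_left mult_ac)
    also have "\<dots> = (\<Sum>p\<in>{..m}. of_nat (p A + (m - p) A) * (coeff a p * coeff b (m - p)))"
      unfolding coeff_mult[of "var A * pdy A a"] coeff_mult[of a] coeff_var_pdy
      by (simp add: sum.distrib[symmetric] algebra_simps del: fun_diff_def minus_apply of_nat_diff)
    also have "\<dots> = of_nat (m A) * coeff (a * b) m"
      unfolding coeff_mult sum_distrib_left by (rule sum.cong) (auto simp: le_fun_def)
    finally show "coeff (var A * pdy A (a * b)) m = coeff (var A * (pdy A a * b + a * pdy A b)) m"
      by (simp add: coeff_var_pdy)
  qed
qed

lemma cmap_derivation: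
  assumes "derivation d"
  shows "derivation (cmap d :: ('i::finite, 'r::{comm_ring_1, real_algebra_1}) mps \<Rightarrow> _)"
proof -
  interpret derivation d by fact
  show ?thesis
    by standard (auto intro!: mps_eqI simp: coeff_mult linear mult sum.distrib)
qed

lemma pdy_commute: "pdy A (pdy B a) = pdy B (pdy A (a :: ('i, 'r::{comm_ring_1, real_algebra_1}) mps))"
  by (cases "A = B") (auto intro!: mps_eqI simp: coeff_pdy fun_upd_twist ac_simps)

lemma pdy_cst [simp]: "pdy A (cst (c::'r::comm_ring_1)) = 0"
  by (rule mps_eqI) (auto simp: coeff_pdy coeff_cst fun_eq_iff split: if_splits)

lemma pdy_var: "pdy A (var B :: ('n::finite idx, 'r::comm_ring_1) mps) = (if A = B then 1 else 0)"
proof (rule mps_eqI)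
  fix m :: "'n idx \<Rightarrow> nat"
  have "m(A := Suc (m A)) = unit_exp B \<longleftrightarrow> A = B \<and> m = 0"
    unfolding unit_exp_def fun_eq_iff by (metis One_nat_def fun_upd_apply nat.distinct(1) nat.inject zero_fun_apply)
  then show "coeff (pdy A (var B :: ('n idx, 'r) mps)) m = coeff (if A = B then 1 else 0) m"
    by (auto simp: coeff_pdy coeff_var coeff_one)
qed

lemma cmap_commute:
  assumes "\<And>r. d (e r) = e (d r)"
  shows "cmap d (cmap e a) = cmap e (cmap d a)"
  by (rule mps_eqI) (simp add: assms)

lemma cmap_pdy:
  assumes "derivation d"
  shows "cmap d (pdy A a) = pdy A (cmap d a)"
proof -
  interpret derivation d by fact
  have "d (of_nat k * r) = of_nat k * d r" for k r
    using scaleR[of "of_nat k" r] by (simp add: scaleR_conv_of_real)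
  from this[of "Suc _"] show ?thesis by (auto intro!: mps_eqI simp: coeff_pdy)
qed

lemma cmap_cst [simp]:
  assumes "derivation d"
  shows "cmap d (cst c) = cst (d c)"
proof -
  interpret derivation d by fact
  show ?thesis by (auto intro!: mps_eqI simp: coeff_cst)
qed

lemma cmap_var [simp]:
  assumes "derivation d"
  shows "cmap d (var A) = 0"
proof -
  interpret derivation d by fact
  show ?thesis by (auto intro!: mps_eqI simp: coeff_var)
qed

section \<open>Vector fields in commuting derivations\<close>

locale commuting_derivations =
  fixes D :: "'i::finite \<Rightarrow> 'm::{comm_ring_1, real_algebra_1} \<Rightarrow> 'm"
  assumes D_derivation: "derivation (D i)"
    and D_D: "D i (D j a) = D j (D i a)"
begin

sublocale D: derivation "D i" for i by (rule D_derivation)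

definition X :: "('i \<Rightarrow> 'm) \<Rightarrow> 'm \<Rightarrow> 'm" where
  "X f a = (\<Sum>j\<in>UNIV. f j * D j a)"

definition bracket :: "('i \<Rightarrow> 'm) \<Rightarrow> ('i \<Rightarrow> 'm) \<Rightarrow> 'i \<Rightarrow> 'm" where
  "bracket f g j = X f (g j) - X g (f j)"

lemma X_add_right: "X f (a + b) = X f a + X f b"
  by (simp add: X_def D.add distrib_left sum.distrib)

lemma X_diff_right: "X f (a - b) = X f a - X f b"
  by (simp add: X_def D.diff right_diff_distrib sum_subtractf)

lemma X_add_left: "X (\<lambda>j. f j + g j) a = X f a + X g a"
  by (simp add: X_def distrib_right sum.distrib)

lemma X_diff_left: "X (\<lambda>j. f j - g j) a = X f a - X g a"
  by (simp add: X_def left_diff_distrib sum_subtractf)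

lemma X_0_right [simp]: "X f 0 = 0"
  by (simp add: X_def)

lemma X_sum_right: "X f (sum g S) = (\<Sum>x\<in>S. X f (g x))"
  by (induction S rule: infinite_finite_induct) (auto simp: X_add_right)

lemma X_mult: "X f (a * b) = X f a * b + a * X f b"
  by (simp add: X_def D.mult sum_distrib_left sum_distrib_right algebra_simps sum.distrib)

lemma X_X: "X f (X g a) - X g (X f a) = X (bracket f g) a"
proof -
  have *: "X f (X g a) = (\<Sum>j\<in>UNIV. X f (g j) * D j a) + (\<Sum>i\<in>UNIV. \<Sum>j\<in>UNIV. f i * g j * D i (D j a))" for f g
  proof -
    have "X f (X g a) = (\<Sum>j\<in>UNIV. X f (g j) * D j a + g j * X f (D j a))"
      by (simp add: X_def[of g] X_sum_right X_mult)
    also have "\<dots> = (\<Sum>j\<in>UNIV. X f (g j) * D j a) + (\<Sum>j\<in>UNIV. \<Sum>i\<in>UNIV. f i * g j * D i (D j a))"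
      by (simp add: sum.distrib X_def[of f "D _ a"] sum_distrib_left mult_ac)
    finally show ?thesis by (subst sum.swap) simp
  qed
  have "(\<Sum>i\<in>UNIV. \<Sum>j\<in>UNIV. g i * f j * D i (D j a)) = (\<Sum>i\<in>UNIV. \<Sum>j\<in>UNIV. f i * g j * D i (D j a))"
    by (subst sum.swap) (simp add: D_D mult_ac)
  then have "X f (X g a) - X g (X f a) = (\<Sum>j\<in>UNIV. X f (g j) * D j a) - (\<Sum>j\<in>UNIV. X g (f j) * D j a)"
    by (simp add: *)
  also have "\<dots> = X (bracket f g) a"
    by (simp add: X_def[of "bracket f g"] bracket_def left_diff_distrib sum_subtractf)
  finally show ?thesis .
qed

lemma vector_field_derivation: "derivation (X f)"
  by standard (simp add: X_add_right, simp add: X_def D.scaleR scaleR_sum_right, simp add: X_mult)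

sublocale X: derivation "X f" for f by (rule vector_field_derivation)

text \<open>If \<open>d\<close> is a covariant derivative with connection matrix \<open>c\<close>,
  the vector field on the right is the covariant derivative of \<open>f\<close>: an upper index is
  rotated by \<open>c\<close>, opposite to the lower index of \<open>D\<close>.\<close>

lemma X_derivation:
  assumes d: "derivation d"
    and d_D: "\<And>i a. d (D i a) = D i (d a) + (\<Sum>j\<in>UNIV. c i j * D j a)"
  shows "d (X f a) = X (\<lambda>j. d (f j) + (\<Sum>m\<in>UNIV. c m j * f m)) a + X f (d a)"
proof -
  interpret d: derivation d by (rule d)
  have "d (X f a) = (\<Sum>j\<in>UNIV. d (f j) * D j a) + X f (d a) + (\<Sum>j\<in>UNIV. \<Sum>m\<in>UNIV. f j * (c j m * D m a))"
    by (simp add: X_def d.sum d.mult d_D distrib_left sum.distrib sum_distrib_left)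
  also have "(\<Sum>j\<in>UNIV. \<Sum>m\<in>UNIV. f j * (c j m * D m a)) = (\<Sum>j\<in>UNIV. (\<Sum>m\<in>UNIV. c m j * f m) * D j a)"
    by (subst sum.swap) (simp add: sum_distrib_right sum_distrib_left mult_ac)
  finally show ?thesis
    by (simp add: X_def distrib_right sum.distrib)
qed

end

section \<open>Wick commutators with elements linear in the antiholomorphic variables\<close>

locale wick_calculus = commuting_derivations D
  for D :: "'n::finite \<Rightarrow> 'm::{comm_ring_1, real_algebra_1} \<Rightarrow> 'm" +
  fixes E :: "'n \<Rightarrow> 'm \<Rightarrow> 'm" and p :: "'n \<Rightarrow> 'm"
  assumes E_derivation: "derivation (E i)"
    and E_E: "E i (E j a) = E j (E i a)"
    and D_E: "D i (E j a) = E j (D i a)"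
    and D_p [simp]: "D i (p j) = 0"
    and E_p: "E i (p j) = (if i = j then 1 else 0)"
begin

sublocale E: derivation "E i" for i by (rule E_derivation)

text \<open>
  In the application, \<open>D i = \<partial>/\<partial>y\<^sup>i\<close>, \<open>p j = \<omega>\<^bsub>j\<bar>k\<^esub> \<bar>y\<^sup>k\<close> and \<open>E i = - \<omega>\<^bsup>i\<bar>j\<^esup> \<partial>/\<partial>\<bar>y\<^sup>j\<close>, the derivative with respect to
  \<open>p i\<close>. Then \<open>beta k\<close> is the coefficient of \<open>\<hbar>\<^sup>k\<close> in the Wick product.
\<close>

fun beta :: "nat \<Rightarrow> 'm \<Rightarrow> 'm \<Rightarrow> 'm" where
  "beta 0 F a = F * a"
| "beta (Suc k) F a = - ((1 / real (Suc k)) *\<^sub>R (\<Sum>i\<in>UNIV. beta k (D i F) (E i a)))"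

declare beta.simps(2) [simp del]

lemma beta_Suc: "real (Suc k) *\<^sub>R beta (Suc k) F a = - (\<Sum>i\<in>UNIV. beta k (D i F) (E i a))"
  by (simp add: beta.simps(2) del: of_nat_Suc)

lemma beta_add_left: "beta k (F + G) a = beta k F a + beta k G a"
  by (induction k arbitrary: F G a)
     (simp_all add: beta.simps(2) D.add sum.distrib scaleR_add_right distrib_right)

lemma beta_add_right: "beta k F (a + b) = beta k F a + beta k F b"
  by (induction k arbitrary: F a b)
     (simp_all add: beta.simps(2) E.add sum.distrib scaleR_add_right distrib_left)

lemma beta_0_left [simp]: "beta k 0 a = 0"
  using beta_add_left[of k 0 0 a] by simp

lemma beta_0_right [simp]: "beta k F 0 = 0"
  using beta_add_right[of k F 0 0] by simp

lemma beta_minus_left: "beta k (- F) a = - beta k F a"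
  using beta_add_left[of k F "- F" a] by (simp add: eq_neg_iff_add_eq_0 add.commute)

lemma beta_minus_right: "beta k F (- a) = - beta k F a"
  using beta_add_right[of k F a "- a"] by (simp add: eq_neg_iff_add_eq_0 add.commute)

lemma beta_diff_left: "beta k (F - G) a = beta k F a - beta k G a"
  using beta_add_left[of k F "- G" a] by (simp add: beta_minus_left)

lemma beta_diff_right: "beta k F (a - b) = beta k F a - beta k F b"
  using beta_add_right[of k F a "- b"] by (simp add: beta_minus_right)

lemma beta_sum_left: "beta k (sum f S) a = (\<Sum>x\<in>S. beta k (f x) a)"
  by (induction S rule: infinite_finite_induct) (auto simp: beta_add_left)

lemma beta_sum_right: "beta k F (sum f S) = (\<Sum>x\<in>S. beta k F (f x))"
  by (induction S rule: infinite_finite_induct) (auto simp: beta_add_right)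

lemma beta_scalar_left:
  "(\<And>i. D i c = 0) \<Longrightarrow> beta k (c * F) a = c * beta k F a"
  by (induction k arbitrary: F a)
     (simp_all add: beta.simps(2) D.mult mult.assoc sum_distrib_left)

lemma beta_scalar_right:
  "(\<And>i. E i c = 0) \<Longrightarrow> beta k F (c * a) = c * beta k F a"
  by (induction k arbitrary: F a)
     (simp_all add: beta.simps(2) E.mult mult.left_commute sum_distrib_left)

text \<open>
  The condition on the commutators says that the bidifferential operator
  \<open>\<Sum>\<^sub>i D\<^sub>i \<otimes> E\<^sub>i\<close> is invariant under \<open>d\<close>.
\<close>

lemma beta_derivation:
  assumes d: "derivation d"
    and d_D: "\<And>i a. d (D i a) = D i (d a) + (\<Sum>j\<in>UNIV. c i j * D j a)"
    and d_E: "\<And>i a. d (E i a) = E i (d a) - (\<Sum>j\<in>UNIV. c j i * E j a)"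
    and D_c: "\<And>i j k. D k (c i j) = 0" and E_c: "\<And>i j k. E k (c i j) = 0"
  shows "d (beta k F a) = beta k (d F) a + beta k F (d a)"
proof (induction k arbitrary: F a)
  case 0
  then show ?case using derivation.mult[OF d] by simp
next
  case (Suc k)
  interpret d: derivation d by (rule d)
  have "(\<Sum>i\<in>UNIV. beta k (\<Sum>j\<in>UNIV. c i j * D j F) (E i a)) =
      (\<Sum>i\<in>UNIV. \<Sum>j\<in>UNIV. c i j * beta k (D j F) (E i a))"
    by (simp add: beta_sum_left beta_scalar_left[OF D_c])
  also have "\<dots> = (\<Sum>i\<in>UNIV. beta k (D i F) (\<Sum>j\<in>UNIV. c j i * E j a))"
    unfolding beta_sum_right beta_scalar_right[OF E_c] by (rule sum.swap)
  finally have "(\<Sum>i\<in>UNIV. d (beta k (D i F) (E i a))) =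
      (\<Sum>i\<in>UNIV. beta k (D i (d F)) (E i a)) + (\<Sum>i\<in>UNIV. beta k (D i F) (E i (d a)))"
    by (simp add: Suc.IH d_D d_E beta_add_left beta_diff_right sum.distrib sum_subtractf)
  then show ?case
    by (simp add: beta.simps(2) d.linear scaleR_add_right)
qed

lemma beta_D: "D i (beta k F a) = beta k (D i F) a + beta k F (D i a)"
  by (rule beta_derivation[where c = "\<lambda>_ _. 0"]) (simp_all add: D_derivation D_D D_E)

lemma beta_E: "E i (beta k F a) = beta k (E i F) a + beta k F (E i a)"
  by (rule beta_derivation[where c = "\<lambda>_ _. 0"]) (simp_all add: E_derivation E_E D_E)

text \<open>Independence of the barred fibre variables. The coefficients may still depend on the
  base point in any way.\<close>

definition hol :: "'m \<Rightarrow> bool" where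
  "hol F \<longleftrightarrow> (\<forall>i. E i F = 0)"

lemma hol_E: "hol F \<Longrightarrow> E i F = 0"
  by (simp add: hol_def)

lemma hol_D: "hol F \<Longrightarrow> hol (D i F)"
  by (simp add: hol_def D_E[symmetric])

lemma beta_hol_right: "hol G \<Longrightarrow> beta k F (G * a) = G * beta k F a"
  by (rule beta_scalar_right) (rule hol_E)

text \<open>At most one of the derivatives \<open>E\<close> can hit the linear factor
  \<open>p j\<close>. It leaves \<open>D j\<close> on the other argument and uses up one order of
  \<hbar>.\<close>

lemma beta_p:
  "beta (Suc k) F (p j * a) = p j * beta (Suc k) F a - beta k (D j F) a"
proof (induction k arbitrary: F a)
  case 0
  have "(\<Sum>i\<in>UNIV. D i F * (E i (p j) * a)) = D j F * a"
    by (simp add: E_p mult_delta_left mult_delta_right if_distrib[of "(*) _"] cong: if_cong)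
  then show ?case
    by (simp add: beta.simps(2) E.mult sum.distrib sum_distrib_left algebra_simps)
next
  case (Suc k)
  have Suc_scaleR: "- x - real (Suc k) *\<^sub>R x = - (real (Suc (Suc k)) *\<^sub>R x)" for x :: 'm
    unfolding of_nat_Suc[of "Suc k"] scaleR_add_left by simp
  have "(\<Sum>i\<in>UNIV. beta (Suc k) (D i F) (E i (p j) * a)) = (\<Sum>i\<in>UNIV. if i = j then beta (Suc k) (D j F) a else 0)"
    by (rule sum.cong) (auto simp: E_p)
  also have "\<dots> = beta (Suc k) (D j F) a" by simp
  finally have 1: "(\<Sum>i\<in>UNIV. beta (Suc k) (D i F) (E i (p j) * a)) = beta (Suc k) (D j F) a" .
  have "real (Suc (Suc k)) *\<^sub>R beta (Suc (Suc k)) F (p j * a) =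
      - (\<Sum>i\<in>UNIV. beta (Suc k) (D i F) (E i (p j) * a) + p j * beta (Suc k) (D i F) (E i a)
        - beta k (D j (D i F)) (E i a))"
    unfolding beta_Suc by (simp add: E.mult beta_add_right Suc.IH algebra_simps)
  also have "\<dots> = - beta (Suc k) (D j F) a - p j * (\<Sum>i\<in>UNIV. beta (Suc k) (D i F) (E i a))
      + (\<Sum>i\<in>UNIV. beta k (D i (D j F)) (E i a))"
    by (simp add: sum.distrib sum_subtractf 1 sum_distrib_left D_D[of j])
  also have "(\<Sum>i\<in>UNIV. beta k (D i (D j F)) (E i a)) = - (real (Suc k) *\<^sub>R beta (Suc k) (D j F) a)"
    by (simp only: beta_Suc minus_minus)
  also have "(\<Sum>i\<in>UNIV. beta (Suc k) (D i F) (E i a)) = - (real (Suc (Suc k)) *\<^sub>R beta (Suc (Suc k)) F a)"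
    by (simp only: beta_Suc[of "Suc k"] minus_minus)
  finally have "real (Suc (Suc k)) *\<^sub>R beta (Suc (Suc k)) F (p j * a) =
     real (Suc (Suc k)) *\<^sub>R (p j * beta (Suc (Suc k)) F a - beta (Suc k) (D j F) a)"
    by (simp add: scaleR_diff_right Suc_scaleR del: of_nat_Suc)
  then show ?case
    by (simp only: scaleR_cancel_left) simp
qed

lemma sum_shift_weight:
  fixes x :: "nat \<Rightarrow> 'm"
  shows "(\<Sum>s\<le>Suc n. real s *\<^sub>R x s) = (\<Sum>s\<le>n. real (Suc s) *\<^sub>R x (Suc s))"
  by (simp add: sum.atMost_Suc_shift del: sum.atMost_Suc of_nat_Suc)

text \<open>Each of the \<open>n\<close> derivatives of \<open>F * G\<close> falls on
  \<open>F\<close> or on \<open>G\<close>. The \<open>E\<close> paired with \<open>F\<close> pass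
  through \<open>G\<close>, which they annihilate, so that the terms become nested products; the
  factor 1/n! in \<open>beta n\<close> absorbs the binomial coefficients.\<close>

lemma beta_mult:
  assumes "hol G"
  shows "beta n (F * G) a = (\<Sum>s\<le>n. beta s F (beta (n - s) G a))"
  using assms
proof (induction n arbitrary: F G a)
  case 0
  then show ?case by (simp add: mult.assoc)
next
  case (Suc n)
  let ?x = "\<lambda>s. beta s F (beta (Suc n - s) G a)"
  have E: "E i (beta k G a) = beta k G (E i a)" for i k a
    using \<open>hol G\<close> by (simp add: beta_E hol_E)
  have "real (Suc n) *\<^sub>R beta (Suc n) (F * G) a =
      - (\<Sum>i\<in>UNIV. (\<Sum>s\<le>n. beta s (D i F) (beta (n - s) G (E i a)))
          + (\<Sum>s\<le>n. beta s F (beta (n - s) (D i G) (E i a))))"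
    unfolding beta_Suc D.mult beta_add_left
    by (simp add: Suc.IH Suc.prems hol_D)
  also have "\<dots> = (\<Sum>s\<le>n. - (\<Sum>i\<in>UNIV. beta s (D i F) (E i (beta (n - s) G a))))
      + (\<Sum>s\<le>n. beta s F (- (\<Sum>i\<in>UNIV. beta (n - s) (D i G) (E i a))))"
    by (simp add: sum.distrib sum_negf E beta_minus_right beta_sum_right sum.swap[of _ "{..n}"])
  also have "\<dots> = (\<Sum>s\<le>n. real (Suc s) *\<^sub>R ?x (Suc s))
      + (\<Sum>s\<le>n. real (Suc (n - s)) *\<^sub>R beta s F (beta (Suc (n - s)) G a))"
  proof -
    have "beta s F (c *\<^sub>R b) = c *\<^sub>R beta s F b" for s c b
      using beta_scalar_right[of "of_real c" s F b] E.scaleR[of _ c 1]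
      by (simp add: scaleR_conv_of_real)
    then show ?thesis
      by (simp add: beta_Suc[symmetric] del: of_nat_Suc)
  qed
  also have "(\<Sum>s\<le>n. real (Suc s) *\<^sub>R ?x (Suc s)) = (\<Sum>s\<le>Suc n. real s *\<^sub>R ?x s)"
    by (rule sum_shift_weight[symmetric])
  also have "(\<Sum>s\<le>n. real (Suc (n - s)) *\<^sub>R beta s F (beta (Suc (n - s)) G a)) =
      (\<Sum>s\<le>Suc n. real (Suc n - s) *\<^sub>R ?x s)"
    by (auto intro!: sum.cong simp: Suc_diff_le simp del: of_nat_Suc of_nat_diff)
  \<comment> \<open>The weights \<open>s\<close> and \<open>Suc n - s\<close>, counting derivatives
    on \<open>F\<close> and on \<open>G\<close>, add up to the constant \<open>Suc n\<close>, which
    cancels.\<close>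
  also have "(\<Sum>s\<le>Suc n. real s *\<^sub>R ?x s) + \<dots> = (\<Sum>s\<le>Suc n. real (Suc n) *\<^sub>R ?x s)"
    unfolding sum.distrib[symmetric]
    by (rule sum.cong) (auto simp: scaleR_add_left[symmetric] of_nat_diff simp del: sum.atMost_Suc of_nat_Suc)
  finally have "real (Suc n) *\<^sub>R beta (Suc n) (F * G) a = real (Suc n) *\<^sub>R (\<Sum>s\<le>Suc n. ?x s)"
    by (simp only: scaleR_sum_right)
  then show ?case
    by (simp only: scaleR_cancel_left) simp
qed

text \<open>The \<hbar>^n-coefficient of Wick multiplication from the left by the sum of
  \<open>p j * f j\<close>; the \<open>p j\<close> stand outside because every \<open>D i\<close>
  annihilates them.\<close>

definition K :: "nat \<Rightarrow> ('n \<Rightarrow> 'm) \<Rightarrow> 'm \<Rightarrow> 'm" where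
  "K n f a = (\<Sum>j\<in>UNIV. p j * beta n (f j) a)"

text \<open>
  \<open>ad f\<close> is \<open>\<hbar>\<^sup>-\<^sup>1\<close> times the Wick commutator with \<open>\<Sum>\<^sub>j p\<^sub>j f\<^sub>j\<close>; a sequence \<open>a\<close> stands for the power
  series in \<open>\<hbar>\<close> with coefficients \<open>a n\<close>.
\<close>

definition ad :: "('n \<Rightarrow> 'm) \<Rightarrow> (nat \<Rightarrow> 'm) \<Rightarrow> nat \<Rightarrow> 'm" where
  "ad f a N = (\<Sum>k\<le>N. K (Suc k) f (a (N - k))) + X f (a N)"

lemma K_add_right: "K n f (a + b) = K n f a + K n f b"
  by (simp add: K_def beta_add_right distrib_left sum.distrib)
lemma K_diff_right: "K n f (a - b) = K n f a - K n f b"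
  by (simp add: K_def beta_diff_right right_diff_distrib sum_subtractf)
lemma K_add_left: "K n (\<lambda>j. f j + g j) a = K n f a + K n g a"
  by (simp add: K_def beta_add_left distrib_left sum.distrib)
lemma K_diff_left: "K n (\<lambda>j. f j - g j) a = K n f a - K n g a"
  by (simp add: K_def beta_diff_left right_diff_distrib sum_subtractf)
lemma K_0_right [simp]: "K n f 0 = 0"
  by (simp add: K_def)
lemma K_sum_right: "K n f (sum g S) = (\<Sum>x\<in>S. K n f (g x))"
  by (induction S rule: infinite_finite_induct) (auto simp: K_add_right)
lemma ad_add_right: "ad f (\<lambda>N. a N + b N) N = ad f a N + ad f b N"
  by (simp add: ad_def K_add_right X_add_right sum.distrib)
lemma ad_diff_right: "ad f (\<lambda>N. a N - b N) N = ad f a N - ad f b N"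
  by (simp add: ad_def K_diff_right X_diff_right sum_subtractf)
lemma ad_add_left: "ad (\<lambda>j. f j + g j) a N = ad f a N + ad g a N"
  by (simp add: ad_def K_add_left X_add_left sum.distrib)
lemma ad_diff_left: "ad (\<lambda>j. f j - g j) a N = ad f a N - ad g a N"
  by (simp add: ad_def K_diff_left X_diff_left sum_subtractf)

lemma X_K:
  assumes "\<And>i. hol (g i)"
  shows "X g (K n f a) = K n f (X g a) + (\<Sum>j\<in>UNIV. p j * (\<Sum>i\<in>UNIV. beta n (D i (f j)) (g i * a)))"
proof -
  have "X g (K n f a) = (\<Sum>j\<in>UNIV. p j * X g (beta n (f j) a))"
    by (simp add: K_def X_sum_right X_mult) (simp add: X_def)
  also have "\<dots> = (\<Sum>j\<in>UNIV. p j * ((\<Sum>i\<in>UNIV. beta n (D i (f j)) (g i * a)) + beta n (f j) (X g a)))"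
    using assms by (simp add: X_def beta_D beta_sum_right beta_hol_right distrib_left sum.distrib)
  finally show ?thesis
    by (simp add: K_def distrib_left sum.distrib)
qed

text \<open>By \<open>beta_p\<close>, the outer contractions either spare \<open>p i\<close>, which
  gives the part quadratic in \<open>p\<close>, or consume it, which gives the part linear in
  \<open>p\<close>.\<close>

lemma K_K:
  "K (Suc s) f (K t g a) = (\<Sum>j\<in>UNIV. \<Sum>i\<in>UNIV. p j * p i * beta (Suc s) (f j) (beta t (g i) a))
     - (\<Sum>j\<in>UNIV. p j * (\<Sum>i\<in>UNIV. beta s (D i (f j)) (beta t (g i) a)))"
  by (simp add: K_def beta_sum_right beta_p sum_distrib_left right_diff_distrib sum_subtractf mult.assoc)

text \<open>The two end terms of \<open>beta_mult\<close> are split off. The right-hand side is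
  visibly symmetric in \<open>F\<close> and \<open>G\<close>, and this makes the quadratic part of
  the commutator of two \<open>K\<close> cancel.\<close>

lemma beta_mult_inner:
  assumes "hol G"
  shows "(\<Sum>k\<le>n. beta (Suc k) F (beta (Suc (n - k)) G a)) =
    beta (Suc (Suc n)) (F * G) a - F * beta (Suc (Suc n)) G a - G * beta (Suc (Suc n)) F a"
proof -
  have "beta (Suc (Suc n)) (F * G) a = (\<Sum>s\<le>Suc (Suc n). beta s F (beta (Suc (Suc n) - s) G a))"
    by (rule beta_mult[OF assms])
  also have "\<dots> = F * beta (Suc (Suc n)) G a + (\<Sum>k\<le>Suc n. beta (Suc k) F (beta (Suc n - k) G a))"
    by (subst sum.atMost_Suc_shift) simp
  also have "(\<Sum>k\<le>Suc n. beta (Suc k) F (beta (Suc n - k) G a)) =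
      (\<Sum>k\<le>n. beta (Suc k) F (beta (Suc (n - k)) G a)) + beta (Suc (Suc n)) F (G * a)"
    by (simp add: Suc_diff_le)
  finally show ?thesis
    by (simp add: beta_hol_right[OF assms])
qed

text \<open>This compares \<hbar>^n-coefficients, without the \<hbar>-free bracket of vector fields.
  The part quadratic in \<open>p\<close> is symmetric in \<open>f\<close> and \<open>g\<close>. In
  the linear part, the contractions that consumed a \<open>p i\<close> and the terms in which
  \<open>X g\<close> differentiates \<open>f j\<close> are exactly the two kinds of terms of
  \<open>beta_mult\<close> for \<open>g i * D i (f j)\<close>.\<close>

lemma K_commutator:
  assumes f: "\<And>i. hol (f i)" and g: "\<And>i. hol (g i)"
  shows "(\<Sum>k\<le>n. K (Suc k) f (K (Suc (n - k)) g a)) - (\<Sum>k\<le>n. K (Suc k) g (K (Suc (n - k)) f a))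
    + (K (Suc n) f (X g a) - X g (K (Suc n) f a)) - (K (Suc n) g (X f a) - X f (K (Suc n) g a))
    = K (Suc n) (bracket f g) a"
proof -
  let ?H = "\<lambda>f g. \<Sum>j\<in>UNIV. p j * (\<Sum>i\<in>UNIV. beta (Suc n) (g i * D i (f j)) a)"
  let ?Q = "\<lambda>f g. \<Sum>j\<in>UNIV. \<Sum>i\<in>UNIV. p j * p i * (\<Sum>k\<le>n. beta (Suc k) (f j) (beta (Suc (n - k)) (g i) a))"
  have KK: "(\<Sum>k\<le>n. K (Suc k) f (K (Suc (n - k)) g a)) + (K (Suc n) f (X g a) - X g (K (Suc n) f a))
      = ?Q f g - ?H f g" if g: "\<And>i. hol (g i)" for f g
  proof -
    have "beta (Suc n) (g i * D i (f j)) a =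
        (\<Sum>k\<le>n. beta k (D i (f j)) (beta (Suc (n - k)) (g i) a)) + beta (Suc n) (D i (f j)) (g i * a)" for i j
      using beta_mult[OF g, of "Suc n" "D i (f j)"]
      by (simp add: Suc_diff_le mult.commute)
    then have H: "?H f g = (\<Sum>k\<le>n. \<Sum>j\<in>UNIV. p j * (\<Sum>i\<in>UNIV. beta k (D i (f j)) (beta (Suc (n - k)) (g i) a)))
        + (\<Sum>j\<in>UNIV. p j * (\<Sum>i\<in>UNIV. beta (Suc n) (D i (f j)) (g i * a)))"
      by (simp add: sum.distrib distrib_left sum_distrib_left sum.swap[of _ "{..n}"])
    have "?Q f g = (\<Sum>k\<le>n. \<Sum>j\<in>UNIV. \<Sum>i\<in>UNIV. p j * p i * beta (Suc k) (f j) (beta (Suc (n - k)) (g i) a))"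
      by (simp add: sum_distrib_left sum.swap[of _ "{..n}"])
    then show ?thesis
      unfolding H K_K X_K[OF g] by (simp add: sum_subtractf)
  qed
  have "?Q f g = ?Q g f"
    unfolding beta_mult_inner[OF g] beta_mult_inner[OF f]
    by (subst sum.swap) (simp add: algebra_simps)
  moreover have "K (Suc n) (bracket f g) a = ?H g f - ?H f g"
    by (simp add: K_def bracket_def X_def beta_diff_left beta_sum_left right_diff_distrib sum_subtractf)
  moreover have "a1 - a2 + b1 - b2 = (a1 + b1) - (a2 + b2)" for a1 a2 b1 b2 :: 'm
    by simp
  ultimately show ?thesis
    by (simp only: KK[OF g, of f] KK[OF f, of g]) simp
qed

lemma ad_commutator:
  assumes f: "\<And>i. hol (f i)" and g: "\<And>i. hol (g i)"
  shows "ad f (ad g a) N - ad g (ad f a) N = ad (bracket f g) a N"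
proof -
  \<comment> \<open>The double sum over the orders \<open>k\<close>, \<open>l\<close> of the two
    operators is regrouped by the total order \<open>n = k + l\<close>.\<close>
  have split: "ad f (ad g a) N = (\<Sum>n\<le>N. \<Sum>k\<le>n. K (Suc k) f (K (Suc (n - k)) g (a (N - n))))
     + (\<Sum>n\<le>N. K (Suc n) f (X g (a (N - n)))) + (\<Sum>n\<le>N. X f (K (Suc n) g (a (N - n)))) + X f (X g (a N))"
    for f g
  proof -
    have "(\<Sum>k\<le>N. \<Sum>l\<le>N - k. K (Suc k) f (K (Suc l) g (a (N - k - l)))) =
        (\<Sum>n\<le>N. \<Sum>k\<le>n. K (Suc k) f (K (Suc (n - k)) g (a (N - n))))"
      by (simp add: sum.Sigma, rule sum.reindex_bij_witness[where i = "\<lambda>(n, k). (k, n - k)" and j = "\<lambda>(k, l). (k + l, k)"])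
        auto
    then show ?thesis
      by (simp add: ad_def K_add_right X_add_right K_sum_right X_sum_right sum.distrib)
  qed
  have "ad f (ad g a) N - ad g (ad f a) N =
    (\<Sum>n\<le>N. (\<Sum>k\<le>n. K (Suc k) f (K (Suc (n - k)) g (a (N - n)))) - (\<Sum>k\<le>n. K (Suc k) g (K (Suc (n - k)) f (a (N - n))))
    + (K (Suc n) f (X g (a (N - n))) - X g (K (Suc n) f (a (N - n)))) - (K (Suc n) g (X f (a (N - n))) - X f (K (Suc n) g (a (N - n)))))
    + (X f (X g (a N)) - X g (X f (a N)))"
    unfolding split by (simp add: sum.distrib sum_subtractf)
  then show ?thesis
    unfolding K_commutator[OF f g] X_X by (simp add: ad_def)
qed

text \<open>The operators \<open>D\<close> and \<open>p\<close> transform with the matrix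
  \<open>c\<close>, \<open>E\<close> with its dual. All contractions in \<open>ad\<close> are
  therefore invariant, and only \<open>f\<close> contributes, through its covariant
  derivative.\<close>

lemma ad_derivation:
  assumes d: "derivation d"
    and d_D: "\<And>i a. d (D i a) = D i (d a) + (\<Sum>j\<in>UNIV. c i j * D j a)"
    and d_E: "\<And>i a. d (E i a) = E i (d a) - (\<Sum>j\<in>UNIV. c j i * E j a)"
    and d_p: "\<And>i. d (p i) = (\<Sum>j\<in>UNIV. c i j * p j)"
    and D_c: "\<And>i j k. D k (c i j) = 0" and E_c: "\<And>i j k. E k (c i j) = 0"
  shows "d (ad f a N) = ad (\<lambda>j. d (f j) + (\<Sum>m\<in>UNIV. c m j * f m)) a N + ad f (\<lambda>N. d (a N)) N"
proof -
  interpret d: derivation d by (rule d)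
  have K: "d (K n f a) = K n (\<lambda>j. d (f j) + (\<Sum>m\<in>UNIV. c m j * f m)) a + K n f (d a)" for n a
  proof -
    have "d (K n f a) = (\<Sum>j\<in>UNIV. \<Sum>m\<in>UNIV. c j m * p m * beta n (f j) a)
        + (\<Sum>j\<in>UNIV. p j * beta n (d (f j)) a) + K n f (d a)"
      by (simp add: K_def d.sum d.mult d_p beta_derivation[OF d d_D d_E D_c E_c] distrib_left
          sum.distrib sum_distrib_right)
    also have "(\<Sum>j\<in>UNIV. \<Sum>m\<in>UNIV. c j m * p m * beta n (f j) a) =
        (\<Sum>j\<in>UNIV. p j * beta n (\<Sum>m\<in>UNIV. c m j * f m) a)"
      unfolding beta_sum_left beta_scalar_left[OF D_c] sum_distrib_left
      by (subst sum.swap) (simp add: mult_ac)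
    finally show ?thesis
      by (simp add: K_def beta_add_left distrib_left sum.distrib)
  qed
  show ?thesis
    by (simp add: ad_def d.add d.sum K X_derivation[OF d d_D] sum.distrib)
qed

text \<open>The extra term comes from \<open>E i\<close> hitting the explicit factor
  \<open>p i\<close> in \<open>K\<close>; \<open>X f\<close> contains no \<open>p\<close>.\<close>

lemma E_ad:
  assumes "\<And>i. hol (f i)"
  shows "E i (ad f a N) = ad f (\<lambda>N. E i (a N)) N + (\<Sum>k\<le>N. beta (Suc k) (f i) (a (N - k)))"
proof -
  have "E i (K n f b) = K n f (E i b) + beta n (f i) b" for n b
  proof -
    have "(\<Sum>j\<in>UNIV. E i (p j) * beta n (f j) b) = (\<Sum>j\<in>UNIV. if i = j then beta n (f j) b else 0)"
      by (rule sum.cong) (auto simp: E_p)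
    then show ?thesis
      using assms by (simp add: K_def E.sum E.mult beta_E hol_E sum.distrib)
  qed
  moreover have "E i (X f b) = X f (E i b)" for b
    using assms by (simp add: X_def E.sum E.mult hol_E D_E)
  ultimately show ?thesis
    by (simp add: ad_def E.add E.sum sum.distrib)
qed

end

section \<open>Formal Kaehler geometry over a differential ring\<close>

lemma sum_if_delta_mult [simp]:
  fixes f :: "'a::finite \<Rightarrow> 'b::comm_ring_1"
  shows "(\<Sum>i\<in>UNIV. (if i = k then - 1 else 0) * f i) = - f k"
    and "(\<Sum>i\<in>UNIV. (if k = i then - 1 else 0) * f i) = - f k"
    and "(\<Sum>i\<in>UNIV. f i * (if i = k then - 1 else 0)) = - f k"
    and "(\<Sum>i\<in>UNIV. f i * (if k = i then - 1 else 0)) = - f k"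
  by (simp_all add: if_distrib[of "(*) _"] if_distrib[of "\<lambda>x. x * _"] cong: if_cong)

lemma sum_mult_swap:
  fixes a :: "'a \<Rightarrow> 'c::comm_ring_1"
  shows "(\<Sum>j\<in>S. a j * (\<Sum>k\<in>U. b j k * c k)) = (\<Sum>k\<in>U. (\<Sum>j\<in>S. a j * b j k) * c k)"
  by (simp add: sum_distrib_left sum_distrib_right mult.assoc) (rule sum.swap)

lemma sum_swap4:
  "(\<Sum>k\<in>A. \<Sum>j\<in>B. \<Sum>m\<in>C. \<Sum>n\<in>D. t k j m n) = (\<Sum>m\<in>C. \<Sum>n\<in>D. \<Sum>k\<in>A. \<Sum>j\<in>B. t k j m n)"
  by (simp only: sum.swap[of _ C B] sum.swap[of _ C A] sum.swap[of _ D B] sum.swap[of _ D A])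

text \<open>The value -1 instead of 1 reflects the convention that \<omega> with upper indices is
  minus the transposed inverse of \<omega>.\<close>

locale inverse_matrices =
  fixes om W :: "'n::finite \<Rightarrow> 'n \<Rightarrow> 'r::{comm_ring_1, real_algebra_1}"
  assumes W_om: "(\<Sum>j\<in>UNIV. W i j * om k j) = (if i = k then - 1 else 0)"
    and om_W: "(\<Sum>i\<in>UNIV. W i j * om i k) = (if j = k then - 1 else 0)"
begin

text \<open>The matrix \<open>d om\<close> times the inverse of \<open>om\<close>, that is, the
  connection matrix of the Chern connection; the minus sign undoes the sign of
  \<open>W\<close>.\<close>

definition chern :: "('r \<Rightarrow> 'r) \<Rightarrow> 'n \<Rightarrow> 'n \<Rightarrow> 'r" where
  "chern d j k = - (\<Sum>e\<in>UNIV. W k e * d (om j e))"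

lemma chern_om: "(\<Sum>k\<in>UNIV. chern d j k * om k l) = d (om j l)"
proof -
  have "(\<Sum>k\<in>UNIV. chern d j k * om k l) = - (\<Sum>e\<in>UNIV. (\<Sum>k\<in>UNIV. W k e * om k l) * d (om j e))"
    unfolding chern_def sum_distrib_right sum_negf[symmetric] mult_minus_left
    by (subst sum.swap) (simp add: sum_negf mult_ac)
  then show ?thesis
    by (simp add: om_W)
qed

lemma derivation_W:
  assumes "derivation d"
  shows "d (W k b) = - (\<Sum>a\<in>UNIV. chern d a k * W a b)"
proof -
  interpret derivation d by fact
  have 1: "(\<Sum>e\<in>UNIV. d (W k e) * om a e) = chern d a k" for a
  proof -
    have "d (\<Sum>e\<in>UNIV. W k e * om a e) = 0"
      by (simp add: W_om minus)
    then show ?thesis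
      by (simp add: chern_def sum mult sum.distrib add_eq_0_iff)
  qed
  have "(\<Sum>a\<in>UNIV. chern d a k * W a b) = (\<Sum>e\<in>UNIV. d (W k e) * (\<Sum>a\<in>UNIV. W a b * om a e))"
    unfolding 1[symmetric] sum_distrib_right sum_distrib_left
    by (subst sum.swap) (simp add: mult_ac)
  then show ?thesis
    by (simp add: om_W)
qed

text \<open>A matrix of one-forms of the shape (d om) om^(-1) is pure gauge, so it satisfies the
  Maurer-Cartan equation for any two commuting derivations. Used within one type, this kills the
  (2,0)- and (0,2)-parts of the curvature.\<close>

lemma chern_flat:
  assumes d: "derivation d" and e: "derivation e" and comm: "\<And>r. d (e r) = e (d r)"
  shows "d (chern e j k) - e (chern d j k) =
    (\<Sum>a\<in>UNIV. chern e a k * chern d j a) - (\<Sum>a\<in>UNIV. chern d a k * chern e j a)"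
proof -
  have *: "d (chern e j k) = - (\<Sum>a\<in>UNIV. chern d a k * chern e j a) - (\<Sum>b\<in>UNIV. W k b * d (e (om j b)))"
    if "derivation d" "derivation e" for d e
  proof -
    interpret d: derivation d by fact
    have "(\<Sum>b\<in>UNIV. d (W k b) * e (om j b)) = - (\<Sum>a\<in>UNIV. chern d a k * (\<Sum>b\<in>UNIV. W a b * e (om j b)))"
      unfolding derivation_W[OF \<open>derivation d\<close>] sum_distrib_left sum_distrib_right mult_minus_left sum_negf
      by (subst sum.swap) (simp add: mult_ac)
    then show ?thesis
      unfolding chern_def[of e] by (simp add: d.linear d.mult sum.distrib sum_negf)
  qed
  show ?thesis
    unfolding *[OF d e] *[OF e d] by (simp add: comm)
qed

end

interpretation V: commuting_derivations "pdy :: 'n::finite idx \<Rightarrow> ('n idx, 'r::{comm_ring_1, real_algebra_1}) mps \<Rightarrow> _"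
  by standard (simp_all add: pdy_derivation derivation.add derivation.mult derivation.scaleR pdy_commute)

lemma sum_idx: "(\<Sum>A\<in>UNIV. h A) = (\<Sum>i\<in>UNIV. h (Inl i)) + (\<Sum>i\<in>UNIV. h (Inr i))"
  for h :: "'n::finite idx \<Rightarrow> 'a::comm_monoid_add"
  using sum.Plus[of "UNIV :: 'n set" "UNIV :: 'n set" h] by simp

text \<open>Here \<open>kaehler10\<close> and \<open>kaehler01\<close> are the (2,1)- and
  (1,2)-components of the closedness of \<omega>. They make the Chern connection
  torsion-free.\<close>

locale kaehler_ring = inverse_matrices om W
  for om W :: "'n::{finite, linorder} \<Rightarrow> 'n \<Rightarrow> 'r::{comm_ring_1, real_algebra_1}" +
  fixes d :: "'n idx \<Rightarrow> 'r \<Rightarrow> 'r"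
  assumes d_derivation: "derivation (d A)"
    and d_commute: "d A (d B r) = d B (d A r)"
    and kaehler10: "d (Inl k) (om i j) = d (Inl i) (om k j)"
    and kaehler01: "d (Inr k) (om i j) = d (Inr j) (om i k)"
begin

sublocale d: derivation "d A" for A by (rule d_derivation)
sublocale T: inverse_matrices "\<lambda>i j. om j i" "\<lambda>i j. W j i"
  by standard (simp_all add: W_om om_W)

text \<open>\<open>Gam i j k = \<Gamma>\<^sup>k\<^bsub>ij\<^esub>\<close>, and \<open>Gamb i j k\<close> has barred indices.\<close>

definition Gam :: "'n \<Rightarrow> 'n \<Rightarrow> 'n \<Rightarrow> 'r" where
  "Gam i = chern (d (Inl i))"
definition Gamb :: "'n \<Rightarrow> 'n \<Rightarrow> 'n \<Rightarrow> 'r" where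
  "Gamb i = T.chern (d (Inr i))"

lemma Gam_sym: "Gam i j k = Gam j i k"
  by (simp add: Gam_def chern_def kaehler10[of i j])
lemma Gamb_sym: "Gamb i j k = Gamb j i k"
  by (simp add: Gamb_def T.chern_def kaehler01[of i _ j])

text \<open>Only symbols of pure type are nonzero. That the Koszul formula produces these values is
  shown separately in \<open>chr_koszul\<close>.\<close>

fun chr :: "'n idx \<Rightarrow> 'n idx \<Rightarrow> 'n idx \<Rightarrow> 'r" where
  "chr (Inl k) (Inl i) (Inl j) = Gam i j k"
| "chr (Inr k) (Inr i) (Inr j) = Gamb i j k"
| "chr _ _ _ = 0"

definition gam :: "'n idx \<Rightarrow> 'n idx \<Rightarrow> ('n idx, 'r) mps" where
  "gam A C = (\<Sum>B\<in>UNIV. cst (chr C A B) * var B)"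

definition conn :: "'n idx \<Rightarrow> ('n idx, 'r) mps \<Rightarrow> ('n idx, 'r) mps" where
  "conn A a = cmap (d A) a - V.X (gam A) a"

lemma cmap_d_derivation: "derivation (cmap (d A) :: ('n idx, 'r) mps \<Rightarrow> _)"
  by (rule cmap_derivation) (rule d_derivation)

sublocale cm: derivation "cmap (d A) :: ('n idx, 'r) mps \<Rightarrow> _" for A
  by (rule cmap_d_derivation)

lemma conn_derivation: "derivation (conn A)"
  by standard (simp_all add: conn_def cm.linear V.X.linear cm.mult V.X.mult algebra_simps)

sublocale conn: derivation "conn A" for A by (rule conn_derivation)

lemma cmap_pdy_d: "cmap (d A) (pdy B a) = pdy B (cmap (d A) a)"
  by (rule cmap_pdy) (rule d_derivation)

lemma conn_cst [simp]: "conn A (cst c) = cst (d A c)"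
  by (simp add: conn_def V.X_def cmap_cst[OF d_derivation])

lemma X_var [simp]: "V.X u (var B) = u B"
proof -
  have "V.X u (var B) = (\<Sum>A\<in>UNIV. if A = B then u A else 0)"
    unfolding V.X_def by (rule sum.cong) (auto simp: pdy_var)
  then show ?thesis by simp
qed

lemma conn_var: "conn A (var C) = - gam A C"
  by (simp add: conn_def cmap_var[OF d_derivation])

lemma pdy_gam: "pdy B (gam A C) = cst (chr C A B)"
proof -
  have "pdy B (gam A C) = (\<Sum>E\<in>UNIV. if B = E then cst (chr C A E) else 0)"
    unfolding gam_def V.D.sum by (rule sum.cong) (auto simp: V.D.mult pdy_var)
  then show ?thesis by simp
qed

lemma X_comm_pdy: "V.X u (pdy B a) = pdy B (V.X u a) - V.X (\<lambda>C. pdy B (u C)) a"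
  by (simp add: V.X_def V.D.sum V.D.mult sum.distrib pdy_commute[of B])

lemma conn_pdy: "conn A (pdy B a) = pdy B (conn A a) + (\<Sum>C\<in>UNIV. cst (chr C A B) * pdy C a)"
  by (simp add: conn_def cmap_pdy_d X_comm_pdy V.D.diff pdy_gam) (simp add: V.X_def)

definition Rm :: "'n idx \<Rightarrow> 'n idx \<Rightarrow> 'n idx \<Rightarrow> 'n idx \<Rightarrow> 'r" where
  "Rm C A B E = d B (chr C A E) - d A (chr C B E)
     + (\<Sum>G\<in>UNIV. chr C B G * chr G A E) - (\<Sum>G\<in>UNIV. chr C A G * chr G B E)"

text \<open>Each \<open>conn A\<close> is a coefficient derivation minus the linear vector field
  \<open>gam A\<close>, so the curvature is again a linear vector field, obtained from a bracket by
  \<open>V.X_X\<close>.\<close>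

lemma conn_conn:
  "conn A (conn B a) - conn B (conn A a) = V.X (\<lambda>C. \<Sum>E\<in>UNIV. cst (Rm C A B E) * var E) a"
proof -
  have cX: "cmap (d A) (V.X u a) = V.X (\<lambda>C. cmap (d A) (u C)) a + V.X u (cmap (d A) a)"
    for A a and u :: "'n idx \<Rightarrow> ('n idx, 'r) mps"
    using V.X_derivation[OF cmap_d_derivation, of A "\<lambda>_ _. 0" u a] by (simp add: cmap_pdy_d)
  have Xgam: "V.X u (gam B C) = (\<Sum>G\<in>UNIV. cst (chr C B G) * u G)" for u B C
    by (simp add: gam_def V.X.sum V.X.mult) (simp add: V.X_def)
  have Xg: "V.X (gam A) (gam B C) = (\<Sum>E\<in>UNIV. cst (\<Sum>G\<in>UNIV. chr C B G * chr G A E) * var E)" for A B C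
    unfolding Xgam gam_def[of A] sum_distrib_left
    by (subst sum.swap) (simp add: cst_sum cst_mult sum_distrib_right mult.assoc)
  have cg: "cmap (d A) (gam B C) = (\<Sum>E\<in>UNIV. cst (d A (chr C B E)) * var E)" for A B C
    by (simp add: gam_def cm.sum cm.mult cmap_cst[OF d_derivation] cmap_var[OF d_derivation])
  have "conn A (conn B a) - conn B (conn A a) =
     V.X (\<lambda>C. cmap (d B) (gam A C) - cmap (d A) (gam B C) + V.bracket (gam A) (gam B) C) a"
    unfolding V.X_add_left V.X_diff_left V.X_X[symmetric] conn_def cm.diff V.X_diff_right cX
    by (simp add: cmap_commute[of "d B" "d A"] d_commute)
  also have "(\<lambda>C. cmap (d B) (gam A C) - cmap (d A) (gam B C) + V.bracket (gam A) (gam B) C) =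
      (\<lambda>C. \<Sum>E\<in>UNIV. cst (Rm C A B E) * var E)"
    by (simp add: V.bracket_def Xg cg Rm_def cst_add cst_diff distrib_right left_diff_distrib
        sum.distrib sum_subtractf add_diff_eq)
  finally show ?thesis .
qed

lemma Gam_flat: "d (Inl i) (Gam l j k) - d (Inl l) (Gam i j k) =
    (\<Sum>a\<in>UNIV. Gam l a k * Gam i j a) - (\<Sum>a\<in>UNIV. Gam i a k * Gam l j a)"
  unfolding Gam_def by (rule chern_flat) (auto simp: d_derivation d_commute)

lemma Gamb_flat: "d (Inr i) (Gamb l j k) - d (Inr l) (Gamb i j k) =
    (\<Sum>a\<in>UNIV. Gamb l a k * Gamb i j a) - (\<Sum>a\<in>UNIV. Gamb i a k * Gamb l j a)"
  unfolding Gamb_def by (rule T.chern_flat) (auto simp: d_derivation d_commute)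

lemma Rm_Inl_Inl: "Rm C (Inl i) (Inl l) E = 0"
  using Gam_flat[of i l] by (cases C; cases E) (simp_all add: Rm_def sum_idx, simp add: algebra_simps)

lemma Rm_Inr_Inr: "Rm C (Inr i) (Inr l) E = 0"
  using Gamb_flat[of i l] by (cases C; cases E) (simp_all add: Rm_def sum_idx, simp add: algebra_simps)

lemma conn_Inl_commute: "conn (Inl i) (conn (Inl l) a) = conn (Inl l) (conn (Inl i) a)"
  using conn_conn[of "Inl i" "Inl l" a] by (simp add: Rm_Inl_Inl) (simp add: V.X_def)

lemma conn_Inr_commute: "conn (Inr i) (conn (Inr l) a) = conn (Inr l) (conn (Inr i) a)"
  using conn_conn[of "Inr i" "Inr l" a] by (simp add: Rm_Inr_Inr) (simp add: V.X_def)

definition rho :: "'n \<Rightarrow> 'n \<Rightarrow> 'n \<Rightarrow> ('n idx, 'r) mps" where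
  "rho i l k = (\<Sum>j\<in>UNIV. cst (d (Inr l) (Gam i j k)) * var (Inl j))"

definition DD :: "'n \<Rightarrow> ('n idx, 'r) mps \<Rightarrow> ('n idx, 'r) mps" where
  "DD i = pdy (Inl i)"
definition EE :: "'n \<Rightarrow> ('n idx, 'r) mps \<Rightarrow> ('n idx, 'r) mps" where
  "EE i a = - (\<Sum>j\<in>UNIV. cst (W i j) * pdy (Inr j) a)"
definition pp :: "'n \<Rightarrow> ('n idx, 'r) mps" where
  "pp j = (\<Sum>k\<in>UNIV. cst (om j k) * var (Inr k))"

lemma pdy_pp: "pdy (Inr b) (pp j) = cst (om j b)"
proof -
  have "pdy (Inr b) (pp j) = (\<Sum>E\<in>UNIV. if b = E then cst (om j E) else 0)"
    unfolding pp_def V.D.sum by (rule sum.cong) (auto simp: V.D.mult pdy_var)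
  then show ?thesis by simp
qed

lemma DD_pp: "DD i (pp j) = 0"
  by (simp add: pp_def DD_def V.D.sum V.D.mult pdy_var)

lemma EE_pp: "EE i (pp j) = (if i = j then 1 else 0)"
  by (simp add: EE_def pdy_pp cst_mult[symmetric] cst_sum[symmetric] W_om cst_uminus)

sublocale wick_calculus DD EE pp
proof
  fix i j a b and c :: real
  show "DD i (a + b) = DD i a + DD i b" "DD i (c *\<^sub>R a) = c *\<^sub>R DD i a" "DD i (a * b) = DD i a * b + a * DD i b"
      "DD i (DD j a) = DD j (DD i a)"
    by (simp_all add: DD_def V.D.linear V.D.mult V.D_D)
  show "EE i (a + b) = EE i a + EE i b"
    by (simp add: EE_def V.D.linear distrib_left sum.distrib)
  show "EE i (c *\<^sub>R a) = c *\<^sub>R EE i a"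
    by (simp add: EE_def V.D.linear scaleR_sum_right)
  show "EE i (a * b) = EE i a * b + a * EE i b"
    by (simp add: EE_def V.D.mult distrib_left sum.distrib sum_distrib_left sum_distrib_right mult_ac)
  show "EE i (EE j a) = EE j (EE i a)"
    unfolding EE_def V.D.minus V.D.sum V.D.mult
    by (simp add: sum_distrib_left sum_negf)
       (subst sum.swap, simp add: mult.left_commute V.D_D)
  show "DD i (EE j a) = EE j (DD i a)"
    by (simp add: DD_def EE_def V.D.linear V.D.mult V.D_D[of "Inl i"])
qed (simp_all add: DD_pp EE_pp)

lemma pdy_Inr_EE: "pdy (Inr l) a = (\<Sum>j\<in>UNIV. cst (om j l) * EE j a)"
proof -
  have "(\<Sum>j\<in>UNIV. cst (om j l) * EE j a) = - (\<Sum>k\<in>UNIV. cst (\<Sum>j\<in>UNIV. W j k * om j l) * pdy (Inr k) a)"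
    unfolding EE_def mult_minus_right sum_negf sum_mult_swap by (simp add: cst_sum cst_mult mult.commute)
  then show ?thesis
    by (simp add: om_W if_distrib[of cst] cst_uminus cong: if_cong)
qed

lemma hol_iff: "hol F \<longleftrightarrow> (\<forall>j. pdy (Inr j) F = 0)"
proof
  show "hol F \<Longrightarrow> \<forall>j. pdy (Inr j) F = 0"
    by (simp add: hol_def pdy_Inr_EE)
  show "\<forall>j. pdy (Inr j) F = 0 \<Longrightarrow> hol F"
    by (simp add: hol_def EE_def)
qed

lemma conn_Inl_DD: "conn (Inl i) (DD j a) = DD j (conn (Inl i) a) + (\<Sum>m\<in>UNIV. cst (Gam i j m) * DD m a)"
  by (simp add: DD_def conn_pdy sum_idx)

lemma conn_Inl_pdy_Inr: "conn (Inl i) (pdy (Inr l) a) = pdy (Inr l) (conn (Inl i) a)"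
  by (simp add: conn_pdy sum_idx)

lemma conn_Inr_DD: "conn (Inr l) (DD j a) = DD j (conn (Inr l) a)"
  by (simp add: DD_def conn_pdy sum_idx)

lemma conn_Inr_pdy_Inr: "conn (Inr l) (pdy (Inr k) a) = pdy (Inr k) (conn (Inr l) a)
    + (\<Sum>m\<in>UNIV. cst (Gamb l k m) * pdy (Inr m) a)"
  by (simp add: conn_pdy sum_idx)

lemma conn_Inl_EE: "conn (Inl i) (EE k a) = EE k (conn (Inl i) a) - (\<Sum>m\<in>UNIV. cst (Gam i m k) * EE m a)"
proof -
  have "conn (Inl i) (EE k a) = EE k (conn (Inl i) a) - (\<Sum>j\<in>UNIV. cst (d (Inl i) (W k j)) * pdy (Inr j) a)"
    by (simp add: EE_def conn.linear conn.mult conn_Inl_pdy_Inr sum.distrib)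
  also have "(\<Sum>j\<in>UNIV. cst (d (Inl i) (W k j)) * pdy (Inr j) a) = (\<Sum>m\<in>UNIV. cst (Gam i m k) * EE m a)"
    unfolding derivation_W[OF d_derivation] EE_def Gam_def cst_uminus cst_sum sum_distrib_left sum_distrib_right
      mult_minus_right sum_negf mult_minus_left
    by (subst sum.swap) (simp add: cst_mult mult_ac)
  finally show ?thesis .
qed

text \<open>The derivative of \<open>W\<close> cancels against the barred Christoffel symbols
  because \<omega> is parallel; the remaining index of \<open>EE\<close> is unbarred and sees no
  connection in this direction.\<close>

lemma conn_Inr_EE: "conn (Inr l) (EE k a) = EE k (conn (Inr l) a)"
proof -
  have "conn (Inr l) (EE k a) = EE k (conn (Inr l) a) - (\<Sum>j\<in>UNIV. cst (d (Inr l) (W k j)) * pdy (Inr j) a)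
     - (\<Sum>j\<in>UNIV. \<Sum>m\<in>UNIV. cst (W k j) * (cst (Gamb l j m) * pdy (Inr m) a))"
    by (simp add: EE_def conn.linear conn.mult conn_Inr_pdy_Inr sum.distrib distrib_left sum_distrib_left)
  also have "(\<Sum>j\<in>UNIV. cst (d (Inr l) (W k j)) * pdy (Inr j) a) =
      - (\<Sum>j\<in>UNIV. \<Sum>m\<in>UNIV. cst (W k j) * (cst (Gamb l j m) * pdy (Inr m) a))"
    unfolding T.derivation_W[OF d_derivation] Gamb_def cst_uminus cst_sum sum_distrib_left sum_distrib_right
      mult_minus_right sum_negf mult_minus_left
    by (subst sum.swap) (simp add: cst_mult mult_ac)
  finally show ?thesis by simp
qed

lemma conn_Inl_pp: "conn (Inl i) (pp j) = (\<Sum>m\<in>UNIV. cst (Gam i j m) * pp m)"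
proof -
  have "(\<Sum>m\<in>UNIV. cst (Gam i j m) * pp m) = (\<Sum>k\<in>UNIV. cst (\<Sum>m\<in>UNIV. Gam i j m * om m k) * var (Inr k))"
    unfolding pp_def sum_mult_swap by (simp add: cst_sum cst_mult)
  then show ?thesis
    by (simp add: pp_def conn.sum conn.mult conn_var gam_def chern_om Gam_def)
qed

lemma conn_Inr_pp: "conn (Inr l) (pp j) = 0"
proof -
  have "conn (Inr l) (pp j) = (\<Sum>k\<in>UNIV. cst (d (Inr l) (om j k)) * var (Inr k))
     - (\<Sum>k\<in>UNIV. cst (om j k) * (\<Sum>b\<in>UNIV. cst (Gamb l b k) * var (Inr b)))"
    by (simp add: pp_def conn.sum conn.mult conn_var gam_def sum.distrib sum_negf sum_subtractf sum_idx)
  also have "(\<Sum>k\<in>UNIV. cst (om j k) * (\<Sum>b\<in>UNIV. cst (Gamb l b k) * var (Inr b))) =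
     (\<Sum>b\<in>UNIV. cst (\<Sum>k\<in>UNIV. Gamb l b k * om j k) * var (Inr b))"
    unfolding sum_mult_swap by (simp add: cst_sum cst_mult mult.commute)
  finally show ?thesis
    by (simp add: Gamb_def T.chern_om)
qed

text \<open>The curvature with lowered indices can be computed from either kind of Christoffel
  symbols. Both sides equal the mixed second derivative of \<open>om j b\<close> minus the same
  quadratic term in the symbols.\<close>

lemma Gamb_om: "(\<Sum>m\<in>UNIV. d (Inl i) (Gamb l b m) * om j m) = (\<Sum>k\<in>UNIV. d (Inr l) (Gam i j k) * om k b)"
proof -
  have 1: "(\<Sum>m\<in>UNIV. d (Inl i) (Gamb l b m) * om j m) + (\<Sum>m\<in>UNIV. Gamb l b m * d (Inl i) (om j m)) =
      d (Inl i) (d (Inr l) (om j b))"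
    using arg_cong[OF T.chern_om[of "d (Inr l)" b j], of "d (Inl i)"]
    by (simp add: Gamb_def d.sum d.mult sum.distrib)
  have 2: "(\<Sum>m\<in>UNIV. d (Inr l) (Gam i j m) * om m b) + (\<Sum>m\<in>UNIV. Gam i j m * d (Inr l) (om m b)) =
      d (Inr l) (d (Inl i) (om j b))"
    using arg_cong[OF chern_om[of "d (Inl i)" j b], of "d (Inr l)"]
    by (simp add: Gam_def d.sum d.mult sum.distrib)
  have "(\<Sum>m\<in>UNIV. Gamb l b m * d (Inl i) (om j m)) = (\<Sum>m\<in>UNIV. \<Sum>k\<in>UNIV. Gamb l b m * (Gam i j k * om k m))"
    by (simp add: Gam_def chern_om[symmetric, of "d (Inl i)"] sum_distrib_left)
  also have "\<dots> = (\<Sum>m\<in>UNIV. Gam i j m * d (Inr l) (om m b))"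
    unfolding Gamb_def T.chern_om[symmetric, of "d (Inr l)"] sum_distrib_left
    by (subst sum.swap) (simp add: mult_ac)
  finally show ?thesis
    using 1 2 by (simp add: d_commute[of "Inl i"] eq_diff_eq[symmetric])
qed

lemma DD_cst [simp]: "DD i (cst c) = 0"
  by (simp add: DD_def)

lemma EE_cst: "EE i (cst c) = 0"
  by (simp add: EE_def)

lemma DD_rho: "DD j (rho i l k) = cst (d (Inr l) (Gam i j k))"
proof -
  have "DD j (rho i l k) = (\<Sum>b\<in>UNIV. if j = b then cst (d (Inr l) (Gam i b k)) else 0)"
    unfolding rho_def D.sum by (rule sum.cong) (auto simp: DD_def V.D.mult pdy_var)
  then show ?thesis by simp
qed

text \<open>The field \<open>rho\<close> is linear in y, so contractions of order two and more
  vanish. What remains is \<open>X\<close>, the action of the curvature on the holomorphic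
  variables, and a single contraction, which is its action on the barred variables once indices are
  lowered by \<open>om\<close> and raised by \<open>W\<close>.\<close>

lemma rho_ad:
  "conn (Inl i) (conn (Inr l) (a N)) - conn (Inr l) (conn (Inl i) (a N)) = ad (rho i l) a N"
proof -
  have b0: "beta (Suc k) (cst c) a = 0" for k c a
    by (simp add: beta.simps(2))
  have "K (Suc (Suc k)) (rho i l) b = 0" for k b
    by (simp add: K_def beta.simps(2)[of "Suc k"] DD_rho b0)
  then have ad: "ad (rho i l) a N = K (Suc 0) (rho i l) (a N) + X (rho i l) (a N)"
    by (simp add: ad_def sum.atMost_shift)
  \<comment> \<open>This is \<open>Gamb_om\<close> with the barred index raised by \<open>W\<close>,
    which brings in the minus sign.\<close>
  have dGamb: "- d (Inl i) (Gamb l b m) = (\<Sum>k\<in>UNIV. \<Sum>j\<in>UNIV. d (Inr l) (Gam i j k) * om k b * W j m)" for b m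
  proof -
    have "(\<Sum>k\<in>UNIV. \<Sum>j\<in>UNIV. d (Inr l) (Gam i j k) * om k b * W j m)
        = (\<Sum>j\<in>UNIV. (\<Sum>k\<in>UNIV. d (Inr l) (Gam i j k) * om k b) * W j m)"
      by (subst sum.swap) (simp add: sum_distrib_right)
    also have "\<dots> = (\<Sum>n\<in>UNIV. d (Inl i) (Gamb l b n) * (\<Sum>j\<in>UNIV. W j m * om j n))"
      unfolding Gamb_om[symmetric] sum_distrib_left sum_distrib_right
      by (subst sum.swap) (simp add: mult_ac)
    finally show ?thesis by (simp add: om_W)
  qed
  have K1: "K (Suc 0) (rho i l) b =
     (\<Sum>m\<in>UNIV. \<Sum>n\<in>UNIV. cst (- d (Inl i) (Gamb l n m)) * var (Inr n) * pdy (Inr m) b)" for b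
  proof -
    have "K (Suc 0) (rho i l) b = (\<Sum>k\<in>UNIV. \<Sum>j\<in>UNIV. \<Sum>m\<in>UNIV. \<Sum>n\<in>UNIV.
        cst (d (Inr l) (Gam i j k) * om k n * W j m) * var (Inr n) * pdy (Inr m) b)"
    proof -
      have "pp k * (cst c * EE j b) = - (\<Sum>m\<in>UNIV. \<Sum>n\<in>UNIV. cst (c * om k n * W j m) * var (Inr n) * pdy (Inr m) b)"
        for k j c
      proof -
        have "pp k * (cst c * EE j b) = - (\<Sum>m\<in>UNIV. (cst c * cst (W j m) * pdy (Inr m) b) * pp k)"
          by (simp add: EE_def sum_distrib_left sum_distrib_right mult_ac)
        then show ?thesis
          by (simp add: pp_def sum_distrib_left cst_mult mult_ac)
      qed
      then show ?thesis
        by (simp add: K_def beta.simps DD_rho sum_distrib_left sum_negf)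
    qed
    also have "\<dots> = (\<Sum>m\<in>UNIV. \<Sum>n\<in>UNIV. \<Sum>k\<in>UNIV. \<Sum>j\<in>UNIV.
        cst (d (Inr l) (Gam i j k) * om k n * W j m) * var (Inr n) * pdy (Inr m) b)"
      by (rule sum_swap4)
    finally show ?thesis
      by (simp add: dGamb cst_sum sum_distrib_right)
  qed
  show ?thesis
    unfolding conn_conn ad K1 V.X_def
    by (simp add: sum_idx Rm_def X_def rho_def DD_def sum_distrib_right cst_uminus)
qed

text \<open>\<open>cov\<close> is \<open>\<nabla>\<^bsup>1,0\<^esup>\<close> on sections with values in the holomorphic tangent bundle.\<close>

definition cov :: "'n \<Rightarrow> ('n \<Rightarrow> ('n idx, 'r) mps) \<Rightarrow> 'n \<Rightarrow> ('n idx, 'r) mps" where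
  "cov i u k = conn (Inl i) (u k) + (\<Sum>m\<in>UNIV. cst (Gam i m k) * u m)"

lemma conn_Inl_ad:
  "conn (Inl i) (ad f a N) = ad (cov i f) a N + ad f (\<lambda>N. conn (Inl i) (a N)) N"
proof -
  have "ad (cov i f) a N = ad (\<lambda>j. conn (Inl i) (f j) + (\<Sum>m\<in>UNIV. cst (Gam i m j) * f m)) a N"
    by (simp add: cov_def[abs_def])
  then show ?thesis
    using ad_derivation[OF conn_derivation conn_Inl_DD conn_Inl_EE conn_Inl_pp, where f = f and a = a and N = N]
    by (simp add: DD_def EE_def)
qed

lemma DD_ad: "DD i (ad f a N) = ad (\<lambda>j. DD i (f j)) a N + ad f (\<lambda>N. DD i (a N)) N"
  using ad_derivation[OF D_derivation[of i], of "\<lambda>_ _. 0" f a N] by (simp add: D_D D_E)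

lemma conn_Inr_ad:
  "conn (Inr l) (ad f a N) = ad (\<lambda>j. conn (Inr l) (f j)) a N + ad f (\<lambda>N. conn (Inr l) (a N)) N"
  using ad_derivation[OF conn_derivation[of "Inr l"], of "\<lambda>_ _. 0" f a N]
  by (simp add: conn_Inr_DD conn_Inr_EE conn_Inr_pp)

text \<open>The correction term differentiates the factors \<open>p j\<close>, whose derivatives are
  the entries \<open>om j l\<close>. Its symmetry in the two barred indices is what
  \<open>T_Inr_Inr\<close> has to assume.\<close>

lemma pdy_Inr_ad:
  assumes "\<And>j. hol (f j)"
  shows "pdy (Inr l) (ad f a N) = ad f (\<lambda>N. pdy (Inr l) (a N)) N
    + (\<Sum>k\<le>N. beta (Suc k) (\<Sum>j\<in>UNIV. cst (om j l) * f j) (a (N - k)))"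
proof -
  have K: "K n f (\<Sum>j\<in>UNIV. cst (om j l) * EE j b) = (\<Sum>j\<in>UNIV. cst (om j l) * K n f (EE j b))" for n b
  proof -
    have "K n f (cst c * b) = cst c * K n f b" for c b
      unfolding K_def beta_scalar_right[OF EE_cst] sum_distrib_left by (simp add: mult.left_commute)
    then show ?thesis by (simp add: K_sum_right)
  qed
  have X: "X f (\<Sum>j\<in>UNIV. cst (om j l) * EE j b) = (\<Sum>j\<in>UNIV. cst (om j l) * X f (EE j b))" for b
    by (simp add: X_sum_right X_mult) (simp add: X_def)
  have "pdy (Inr l) (ad f a N) = (\<Sum>j\<in>UNIV. cst (om j l) * ad f (\<lambda>N. EE j (a N)) N)
     + (\<Sum>j\<in>UNIV. cst (om j l) * (\<Sum>k\<le>N. beta (Suc k) (f j) (a (N - k))))"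
    using assms by (simp add: pdy_Inr_EE E_ad distrib_left sum.distrib)
  also have "(\<Sum>j\<in>UNIV. cst (om j l) * ad f (\<lambda>N. EE j (a N)) N) = ad f (\<lambda>N. pdy (Inr l) (a N)) N"
    by (simp add: ad_def pdy_Inr_EE K X distrib_left sum.distrib sum_distrib_left sum.swap[of _ "{..N}"])
  also have "(\<Sum>j\<in>UNIV. cst (om j l) * (\<Sum>k\<le>N. beta (Suc k) (f j) (a (N - k)))) =
      (\<Sum>k\<le>N. beta (Suc k) (\<Sum>j\<in>UNIV. cst (om j l) * f j) (a (N - k)))"
    by (simp add: beta_sum_left beta_scalar_left[OF DD_cst] sum_distrib_left sum.swap[of _ "{..N}"])
  finally show ?thesis .
qed

section \<open>Components of the connection and their commutators\<close>

definition T :: "('n \<Rightarrow> 'n \<Rightarrow> ('n idx, 'r) mps) \<Rightarrow> 'n idx \<Rightarrow> (nat \<Rightarrow> ('n idx, 'r) mps) \<Rightarrow> nat \<Rightarrow> ('n idx, 'r) mps" where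
  "T f A a N = conn A (a N) - pdy A (a N) + (case A of Inl _ \<Rightarrow> 0 | Inr l \<Rightarrow> ad (f l) a N)"

lemma T_Inl: "T f (Inl i) a = (\<lambda>N. conn (Inl i) (a N) - DD i (a N))"
  by (simp add: T_def DD_def fun_eq_iff)

lemma T_Inr: "T f (Inr l) a = (\<lambda>N. conn (Inr l) (a N) - pdy (Inr l) (a N) + ad (f l) a N)"
  by (simp add: T_def fun_eq_iff)

lemma T_Inl_Inl: "T f (Inl i) (T f (Inl l) a) N = T f (Inl l) (T f (Inl i) a) N"
  by (simp add: T_Inl conn.diff D.diff conn_Inl_commute[of i l] D_D[of i] conn_Inl_DD Gam_sym[of i l])

lemma DD_pdy: "DD i (pdy A a) = pdy A (DD i a)"
  by (simp add: DD_def V.D_D)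

text \<open>The derivatives along y and along the barred variables commute with the covariant
  derivatives of opposite type. The commutator is thus \<open>ad\<close> of the curvature plus
  \<open>cov i (f l)\<close> minus the y-derivative of \<open>f l\<close>.\<close>

lemma T_Inl_Inr:
  assumes K: "\<And>k. cov i (f l) k + rho i l k = DD i (f l k)"
  shows "T f (Inl i) (T f (Inr l) a) N = T f (Inr l) (T f (Inl i) a) N"
proof -
  have "ad (\<lambda>k. DD i (f l k)) a N = ad (cov i (f l)) a N + ad (rho i l) a N"
    by (simp add: ad_add_left[symmetric] K)
  then show ?thesis
    using rho_ad[of i l a N, symmetric]
    by (simp add: T_Inl T_Inr conn.diff conn.add D.add D.diff V.D.diff conn_Inl_pdy_Inr conn_Inl_ad
        DD_ad conn_Inr_DD DD_pdy ad_diff_right)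
qed

text \<open>The three kinds of terms cancel separately: mixed terms of \<open>conn\<close> and
  \<open>pdy\<close> by absence of torsion (\<open>Gamb_sym\<close>), mixed terms of
  \<open>pdy\<close> and \<open>ad\<close> by \<open>sym\<close>, and all others by
  \<open>MC\<close> together with the homomorphism property of \<open>ad\<close>.\<close>

lemma T_Inr_Inr:
  assumes hol: "\<And>l j. hol (f l j)"
    and sym: "\<And>l k. (\<Sum>j\<in>UNIV. cst (om j l) * f k j) = (\<Sum>j\<in>UNIV. cst (om j k) * f l j)"
    and MC: "\<And>l k j. conn (Inr l) (f k j) - conn (Inr k) (f l j) + bracket (f l) (f k) j = 0"
  shows "T f (Inr l) (T f (Inr k) a) N = T f (Inr k) (T f (Inr l) a) N"
proof -
  have "0 = ad (\<lambda>j. conn (Inr l) (f k j) - conn (Inr k) (f l j) + bracket (f l) (f k) j) a N"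
    by (simp add: MC) (simp add: ad_def K_def X_def)
  also have "\<dots> = ad (\<lambda>j. conn (Inr l) (f k j)) a N - ad (\<lambda>j. conn (Inr k) (f l j)) a N
      + (ad (f l) (ad (f k) a) N - ad (f k) (ad (f l) a) N)"
    by (simp add: ad_commutator[OF hol hol] ad_add_left ad_diff_left)
  finally have "ad (\<lambda>j. conn (Inr k) (f l j)) a N = ad (\<lambda>j. conn (Inr l) (f k j)) a N
      + (ad (f l) (ad (f k) a) N - ad (f k) (ad (f l) a) N)"
    by (simp add: algebra_simps)
  then show ?thesis
    by (simp add: T_Inr conn.diff conn.add V.D.add V.D.diff conn_Inr_pdy_Inr conn_Inr_ad
        pdy_Inr_ad[OF hol] conn_Inr_commute[of l k] V.D_D[of "Inr l"] ad_diff_right ad_add_right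
        Gamb_sym[of l k] sym[of l k])
qed

end

section \<open>Kapranov's section\<close>

text \<open>The filtration by order of vanishing in the holomorphic variables; barred exponents do
  not count. Covariant derivatives preserve it, and derivatives along y lower it by one.\<close>

definition low :: "nat \<Rightarrow> ('n::finite idx, 'r::zero) mps \<Rightarrow> bool" where
  "low n u \<longleftrightarrow> (\<forall>m. y_deg m < n \<longrightarrow> coeff u m = 0)"

lemma y_deg_Inr [simp]: "y_deg (m(Inr i := k)) = y_deg m"
  by (simp add: y_deg_def)

lemma y_deg_Inl: "y_deg (m(Inl i := k)) + m (Inl i) = y_deg m + k"
proof -
  have "y_deg (m(Inl i := k)) = k + (\<Sum>j\<in>UNIV - {i}. m (Inl j))"
    unfolding y_deg_def by (subst sum.remove[of _ i]) auto
  moreover have "y_deg m = m (Inl i) + (\<Sum>j\<in>UNIV - {i}. m (Inl j))"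
    unfolding y_deg_def by (subst sum.remove[of _ i]) auto
  ultimately show ?thesis by simp
qed

lemma y_deg_Inl_Suc [simp]: "y_deg (m(Inl i := Suc (m (Inl i)))) = Suc (y_deg m)"
  using y_deg_Inl[of m i "Suc (m (Inl i))"] by simp

lemma y_deg_Inl_pred: "m (Inl i) \<noteq> 0 \<Longrightarrow> Suc (y_deg (m(Inl i := m (Inl i) - Suc 0))) = y_deg m"
  using y_deg_Inl[of m i "m (Inl i) - Suc 0"] by simp

lemma low_0_eq: "(\<And>n. low n u) \<Longrightarrow> u = 0"
  by (rule mps_eqI) (metis coeff_zero lessI low_def)

lemma low_0 [simp]: "low 0 u" "low n 0"
  by (auto simp: low_def)

lemma low_mono: "low n u \<Longrightarrow> k \<le> n \<Longrightarrow> low k u"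
  by (auto simp: low_def)

lemma low_sum: "(\<And>x. x \<in> A \<Longrightarrow> low n (f x :: ('n::finite idx, 'r::{comm_ring_1, real_algebra_1}) mps)) \<Longrightarrow> low n (sum f A)"
  by (auto simp: low_def)

lemma of_nat_mult_eq_0:
  assumes "k \<noteq> 0" "of_nat k * x = (0 :: 'r::{comm_ring_1, real_algebra_1})"
  shows "x = 0"
proof -
  have "real k *\<^sub>R x = 0"
    using assms by (simp add: scaleR_conv_of_real)
  with assms show ?thesis by simp
qed

definition euler :: "('n::finite idx, 'r::comm_ring_1) mps \<Rightarrow> ('n idx, 'r) mps" where
  "euler u = (\<Sum>i\<in>UNIV. var (Inl i) * pdy (Inl i) u)"

lemma coeff_euler: "coeff (euler u) m = of_nat (y_deg m) * coeff u m"
  by (simp add: euler_def coeff_var_pdy y_deg_def sum_distrib_right)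

context
  fixes u v :: "('n::finite idx, 'r::{comm_ring_1, real_algebra_1}) mps"
begin

lemma low_add: "low n u \<Longrightarrow> low n v \<Longrightarrow> low n (u + v)"
  and low_diff: "low n u \<Longrightarrow> low n v \<Longrightarrow> low n (u - v)"
  by (auto simp: low_def)

lemma low_cst_mult: "low n u \<Longrightarrow> low n (cst c * u)"
  by (auto simp: low_def)

lemma low_var_Inr_mult: "low n u \<Longrightarrow> low n (var (Inr i) * u)"
  by (auto simp: low_def coeff_var_mult)

lemma low_pdy: "low (Suc n) u \<Longrightarrow> low n (pdy (Inl i) u)"
  by (auto simp: low_def coeff_pdy)

lemma low_pdy_Inr: "low n u \<Longrightarrow> low n (pdy (Inr i) u)"
  by (auto simp: low_def coeff_pdy)

lemma low_var_mult:
  assumes "low n u"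
  shows "low (Suc n) (var (Inl i) * u)"
  unfolding low_def
proof (intro allI impI)
  fix m :: "'n idx \<Rightarrow> nat" assume "y_deg m < Suc n"
  show "coeff (var (Inl i) * u) m = 0"
  proof (cases "m (Inl i) = 0")
    case False
    with \<open>y_deg m < Suc n\<close> have "y_deg (m(Inl i := m (Inl i) - Suc 0)) < n"
      using y_deg_Inl_pred[of m i, OF False] by linarith
    then show ?thesis
      using assms by (simp add: low_def coeff_var_mult)
  qed (simp add: coeff_var_mult)
qed

lemma low_Suc_pdy:
  assumes "\<And>i. low n (pdy (Inl i) u)" and "low 1 u"
  shows "low (Suc n) u"
  unfolding low_def
proof (intro allI impI)
  fix m :: "'n idx \<Rightarrow> nat" assume m: "y_deg m < Suc n"
  show "coeff u m = 0"
  proof (cases "y_deg m = 0")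
    case True
    then show ?thesis using \<open>low 1 u\<close> by (simp add: low_def)
  next
    case False
    then obtain i where i: "m (Inl i) \<noteq> 0"
      by (auto simp: y_deg_def)
    let ?m = "m(Inl i := m (Inl i) - Suc 0)"
    have "y_deg ?m < n"
      using m y_deg_Inl_pred[of m i, OF i] by simp
    then have "coeff (pdy (Inl i) u) ?m = 0"
      using assms(1) by (simp add: low_def)
    moreover have "?m(Inl i := Suc (?m (Inl i))) = m"
      using i by (auto simp: fun_eq_iff)
    ultimately have "of_nat (m (Inl i)) * coeff u m = 0"
      using i by (simp add: coeff_pdy)
    then show ?thesis
      using i of_nat_mult_eq_0 by blast
  qed
qed

text \<open>The operator \<open>euler + 1\<close> multiplies the coefficient at \<open>m\<close> by
  \<open>y_deg m + 1\<close>, a positive integer, hence cancellable over a real algebra.\<close>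

lemma low_euler:
  assumes "low n (euler u + u)"
  shows "low n u"
  unfolding low_def
proof (intro allI impI)
  fix m :: "'n idx \<Rightarrow> nat" assume "y_deg m < n"
  then have "of_nat (Suc (y_deg m)) * coeff u m = 0"
    using assms by (simp add: low_def coeff_euler algebra_simps)
  then show "coeff u m = 0"
    using of_nat_mult_eq_0 by blast
qed

end

lemma low_var_pdy:
  fixes u :: "('n::finite idx, 'r::{comm_ring_1, real_algebra_1}) mps"
  assumes "low n u"
  shows "low n (var (Inl i) * pdy (Inl j) u)"
  using assms by (cases n) (auto intro: low_var_mult low_pdy)

definition inv_euler :: "('n::finite idx, 'r::real_vector) mps \<Rightarrow> ('n idx, 'r) mps" where
  "inv_euler u = Mps (\<lambda>m. (1 / real (1 + y_deg m)) *\<^sub>R coeff u m)"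

lemma coeff_inv_euler: "coeff (inv_euler u) m = (1 / real (1 + y_deg m)) *\<^sub>R coeff u m"
  by (simp add: inv_euler_def)

section \<open>Covariant derivatives and the degree filtration; the recursion\<close>

context kaehler_ring
begin

lemma low_conn: "low n u \<Longrightarrow> low n (conn A u)"
  unfolding conn_def V.X_def gam_def sum_idx
  by (cases A)
     (auto intro!: low_diff low_add low_sum low_cst_mult low_var_pdy low_var_Inr_mult low_pdy_Inr
       simp: sum_distrib_right mult.assoc, auto simp: low_def)

lemma low_cov: "(\<And>k. low n (u k)) \<Longrightarrow> low n (cov i u k)"
  by (auto simp: cov_def intro!: low_add low_sum low_conn low_cst_mult)

text \<open>The right-hand side of the equation preserves the order of vanishing in y while
  \<open>DD\<close> lowers it by one, so the order grows without bound. The matrices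
  \<open>c\<close> cover scalars (\<open>c = 0\<close>) and tangent-valued series (Christoffel
  symbols) alike.\<close>

lemma parallel_eq_0:
  assumes "\<And>i k. DD i (u k) = conn (Inl i) (u k) + (\<Sum>m\<in>UNIV. cst (c i k m) * u m)"
    and "\<And>k. low 1 (u k)"
  shows "u k = 0"
proof -
  have "low n (u k)" for n k
  proof (induction n arbitrary: k)
    case (Suc n)
    show ?case
    proof (rule low_Suc_pdy)
      show "low n (pdy (Inl i) (u k))" for i
        unfolding DD_def[symmetric] assms(1)
        by (intro low_add low_sum low_conn low_cst_mult Suc.IH)
    qed (rule assms(2))
  qed simp
  then show ?thesis by (rule low_0_eq)
qed

lemma cov_add: "cov i (\<lambda>k. u k + v k) k = cov i u k + cov i v k"
  by (simp add: cov_def conn.add distrib_left sum.distrib)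

lemma cov_diff: "cov i (\<lambda>k. u k - v k) k = cov i u k - cov i v k"
  by (simp add: cov_def conn.diff right_diff_distrib sum_subtractf)

lemma cov_flat: "cov i (cov l u) k = cov l (cov i u) k"
proof -
  have *: "cov i (cov l u) k = conn (Inl i) (conn (Inl l) (u k)) +
     (\<Sum>m\<in>UNIV. cst (d (Inl i) (Gam l m k) + (\<Sum>a\<in>UNIV. Gam i a k * Gam l m a)) * u m)
     + ((\<Sum>m\<in>UNIV. cst (Gam l m k) * conn (Inl i) (u m)) + (\<Sum>m\<in>UNIV. cst (Gam i m k) * conn (Inl l) (u m)))" for i l
  proof -
    have "(\<Sum>a\<in>UNIV. cst (Gam i a k) * (\<Sum>m\<in>UNIV. cst (Gam l m a) * u m)) =
        (\<Sum>m\<in>UNIV. cst (\<Sum>a\<in>UNIV. Gam i a k * Gam l m a) * u m)"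
      unfolding sum_mult_swap by (simp add: cst_sum cst_mult)
    then show ?thesis
      by (simp add: cov_def conn.add conn.sum conn.mult distrib_left distrib_right sum.distrib cst_add)
  qed
  have "d (Inl i) (Gam l m k) + (\<Sum>a\<in>UNIV. Gam i a k * Gam l m a) =
      d (Inl l) (Gam i m k) + (\<Sum>a\<in>UNIV. Gam l a k * Gam i m a)" for m
    using Gam_flat[of i l m k] by (simp add: algebra_simps)
  then show ?thesis
    unfolding *[of i l] *[of l i] by (simp add: conn_Inl_commute[of i l] add.commute)
qed

lemma DD_cov: "DD j (cov i u k) = cov i (\<lambda>k. DD j (u k)) k - (\<Sum>m\<in>UNIV. cst (Gam i j m) * DD m (u k))"
  by (simp add: cov_def D.add D.sum D.mult conn_Inl_DD)

lemma conn_Inl_var: "conn (Inl i) (var (Inl j)) = - (\<Sum>b\<in>UNIV. cst (Gam i b j) * var (Inl b))"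
  by (simp add: conn_var gam_def sum_idx)

text \<open>The second Bianchi identity. It is the flatness equation \<open>Gam_flat\<close>
  differentiated in the antiholomorphic direction \<open>l\<close>.\<close>

lemma bianchi: "cov i (rho j l) k = cov j (rho i l) k"
proof -
  have *: "cov i (rho j l) k = (\<Sum>b\<in>UNIV. cst (d (Inl i) (d (Inr l) (Gam j b k))
      - (\<Sum>a\<in>UNIV. d (Inr l) (Gam j a k) * Gam i b a) + (\<Sum>a\<in>UNIV. Gam i a k * d (Inr l) (Gam j b a))) * var (Inl b))"
    for i j
  proof -
    have "conn (Inl i) (rho j l k) = (\<Sum>b\<in>UNIV. cst (d (Inl i) (d (Inr l) (Gam j b k))) * var (Inl b))
        - (\<Sum>a\<in>UNIV. cst (d (Inr l) (Gam j a k)) * (\<Sum>b\<in>UNIV. cst (Gam i b a) * var (Inl b)))"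
      by (simp add: rho_def conn.sum conn.mult conn_Inl_var sum_subtractf)
    then show ?thesis
      unfolding cov_def rho_def[of j] sum_mult_swap
      by (simp add: cst_sum cst_mult cst_add cst_diff distrib_right left_diff_distrib sum.distrib sum_subtractf)
  qed
  have flat: "d (Inl i) (d (Inr l) (Gam j b k)) - d (Inl j) (d (Inr l) (Gam i b k)) =
      (\<Sum>a\<in>UNIV. d (Inr l) (Gam j a k) * Gam i b a) + (\<Sum>a\<in>UNIV. Gam j a k * d (Inr l) (Gam i b a))
      - ((\<Sum>a\<in>UNIV. d (Inr l) (Gam i a k) * Gam j b a) + (\<Sum>a\<in>UNIV. Gam i a k * d (Inr l) (Gam j b a)))" for b
    using arg_cong[OF Gam_flat[of i j b k], of "d (Inr l)"]
    by (simp add: d.diff d.sum d.mult sum.distrib d_commute[of "Inr l"] mult.commute)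
  have rearrange: "x - y = a + b - (c + e) \<Longrightarrow> x - a + e = y - c + b" for x y a b c e :: 'r
    by (simp add: algebra_simps)
  show ?thesis
    unfolding * rearrange[OF flat] ..
qed

text \<open>
  \<open>kap n l j\<close> is the coefficient of \<open>d\<bar>z\<^sup>l \<otimes> \<partial>\<^sub>j\<close> in \<open>R\<^sub>n\<^sup>*\<close>. In the recursion \<open>(\<delta>\<^bsup>1,0\<^esup>)\<^bsup>-1\<^esup>\<close> meets forms of type
  \<open>(1,1)\<close>, whence the factor \<open>1 / (1 + y_deg m)\<close> of \<open>inv_euler\<close>.
\<close>

fun kap :: "nat \<Rightarrow> 'n \<Rightarrow> 'n \<Rightarrow> ('n idx, 'r) mps" where
  "kap 0 l j = 0"
| "kap (Suc 0) l j = 0"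
| "kap (Suc (Suc 0)) l j = (\<Sum>i\<in>UNIV. \<Sum>k\<in>UNIV.
      cst ((1 / 2) *\<^sub>R d (Inr l) (Gam i k j)) * (var (Inl i) * var (Inl k)))"
| "kap (Suc (Suc (Suc n))) l j = (\<Sum>k\<in>UNIV. var (Inl k) * inv_euler (cov k (kap (Suc (Suc n)) l) j))"

text \<open>The infinite sum of all \<open>kap n\<close>. As \<open>kap n\<close> is homogeneous of
  degree \<open>n\<close> in y, only the summand \<open>n = y_deg m\<close> reaches the coefficient
  at \<open>m\<close>.\<close>

definition kapranov :: "'n \<Rightarrow> 'n \<Rightarrow> ('n idx, 'r) mps" where
  "kapranov l j = Mps (\<lambda>m. coeff (kap (y_deg m) l j) m)"

text \<open>The connection preserves the degree in y. This allows \<open>kapranov\<close> to be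
  replaced by a single \<open>kap n\<close> under \<open>conn\<close> when one coefficient is
  inspected.\<close>

lemma coeff_conn_cong:
  assumes "\<And>m'. y_deg m' = y_deg m \<Longrightarrow> coeff u m' = coeff v m'"
  shows "coeff (conn (Inl i) u) m = coeff (conn (Inl i) v) m"
proof -
  have "coeff (var (Inl b) * pdy (Inl a) u) m = coeff (var (Inl b) * pdy (Inl a) v) m" for a b
    using assms by (simp add: coeff_var_mult coeff_pdy y_deg_Inl_pred del: fun_upd_apply)
  then show ?thesis
    using assms[of m]
    by (simp add: conn_def V.X_def sum_idx gam_def sum_distrib_right mult.assoc)
qed

lemma coeff_cov_cong:
  assumes "\<And>j m'. y_deg m' = y_deg m \<Longrightarrow> coeff (u j) m' = coeff (v j) m'"
  shows "coeff (cov i u k) m = coeff (cov i v k) m"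
  using coeff_conn_cong[of m "u k" "v k" i] assms by (simp add: cov_def)

lemma cov_0: "cov i (\<lambda>_. 0) k = 0"
  by (simp add: cov_def)

lemma coeff_kap: "y_deg m \<noteq> n \<Longrightarrow> coeff (kap n l j) m = 0"
proof (induction n l j arbitrary: m rule: kap.induct)
  case (3 l j)
  have "coeff (var (Inl i) * var (Inl k)) m = (0 :: 'r)" for i k :: 'n
  proof -
    have "y_deg (unit_exp (Inl k :: 'n idx)) = 1"
      by (simp add: y_deg_def unit_exp_def)
    then show ?thesis
      using 3 y_deg_Inl_pred[of m i] by (cases "m (Inl i) = 0") (auto simp: coeff_var_mult coeff_var)
  qed
  then show ?case by simp
next
  case (4 n l j)
  have "coeff (var (Inl k) * inv_euler (cov k (kap (Suc (Suc n)) l) j)) m = 0" for k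
  proof (cases "m (Inl k) = 0")
    case False
    let ?m = "m(Inl k := m (Inl k) - Suc 0)"
    have "y_deg ?m \<noteq> Suc (Suc n)"
      using y_deg_Inl_pred[of m k, OF False] 4 by simp
    then have "coeff (cov k (kap (Suc (Suc n)) l) j) ?m = coeff (cov k (\<lambda>_. 0) j) ?m"
      by (intro coeff_cov_cong) (use "4.IH" in auto)
    then show ?thesis
      by (simp add: coeff_var_mult coeff_inv_euler cov_0)
  qed (simp add: coeff_var_mult)
  then show ?case by simp
qed auto

lemma low_kapranov: "low 2 (kapranov l j)"
proof -
  have "coeff (kapranov l j) m = 0" if "y_deg m < 2" for m
    using that by (auto simp: kapranov_def less_2_cases_iff)
  then show ?thesis by (simp add: low_def)
qed

lemma pdy_Inr_var_mult:
  "pdy (Inr i) (var (Inl k) * u) = var (Inl k) * pdy (Inr i) (u :: ('n idx, 'r) mps)"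
  by (simp add: V.D.mult pdy_var)

lemma pdy_Inr_kap: "pdy (Inr i) (kap n l j) = 0"
proof (induction n l j rule: kap.induct)
  case (3 l j)
  then show ?case by (simp add: V.D.sum V.D.mult pdy_var)
next
  case (4 n l j)
  have "pdy (Inr i) (cov k (kap (Suc (Suc n)) l) j) = 0" for k
    by (simp add: cov_def V.D.add V.D.sum V.D.mult conn_Inl_pdy_Inr[symmetric] 4)
  moreover have "pdy (Inr i) (inv_euler u) = inv_euler (pdy (Inr i) u)" for u :: "('n idx, 'r) mps"
    by (rule mps_eqI) (simp add: coeff_pdy coeff_inv_euler)
  moreover have "inv_euler 0 = (0 :: ('n idx, 'r) mps)"
    by (rule mps_eqI) (simp add: coeff_inv_euler)
  ultimately show ?case
    by (simp add: V.D.sum pdy_Inr_var_mult)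
qed auto

lemma pdy_Inr_kapranov: "pdy (Inr i) (kapranov l j) = 0"
proof (rule mps_eqI)
  fix m
  show "coeff (pdy (Inr i) (kapranov l j)) m = coeff 0 m"
    using arg_cong[OF pdy_Inr_kap[of i "y_deg m" l j], of "\<lambda>u. coeff u m"]
    by (simp add: coeff_pdy kapranov_def)
qed

lemma hol_kapranov: "hol (kapranov l j)"
  by (simp add: hol_iff pdy_Inr_kapranov)

text \<open>The recursion summed over all degrees: the factor \<open>y_deg m\<close> from
  \<open>euler\<close> clears the denominators of \<open>inv_euler\<close>, and only the initial
  term in degree 2 is left over.\<close>

lemma euler_kapranov:
  "euler (kapranov l j) = 2 * kap 2 l j + (\<Sum>k\<in>UNIV. var (Inl k) * cov k (kapranov l) j)"
proof (rule mps_eqI)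
  fix m
  have kap2: "coeff (2 * kap 2 l j) m = 2 * coeff (kap 2 l j) m"
    by (simp only: mult_2 coeff_add)
  have cov: "coeff (cov k (kapranov l) j) m' = coeff (cov k (kap (y_deg m') l) j) m'" for k m'
    by (rule coeff_cov_cong) (simp add: kapranov_def)
  have summand: "coeff (var (Inl k) * cov k (kapranov l) j) m =
      (if m (Inl k) = 0 then 0 else coeff (cov k (kap (y_deg m - 1) l) j) (m(Inl k := m (Inl k) - 1)))" for k
  proof (cases "m (Inl k) = 0")
    case False
    then have "y_deg m - 1 = y_deg (m(Inl k := m (Inl k) - Suc 0))"
      using y_deg_Inl_pred[of m k] by linarith
    with False show ?thesis by (simp add: coeff_var_mult cov)
  qed (simp add: coeff_var_mult)
  consider "y_deg m = 0" | "y_deg m = 1" | "y_deg m = 2" | n where "y_deg m = Suc (Suc (Suc n))"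
    by (metis One_nat_def Suc_1 not0_implies_Suc)
  then show "coeff (euler (kapranov l j)) m =
      coeff (2 * kap 2 l j + (\<Sum>k\<in>UNIV. var (Inl k) * cov k (kapranov l) j)) m"
  proof cases
    case 1
    then have "m (Inl k) = 0" for k by (simp add: y_deg_def)
    then show ?thesis using 1 by (simp add: coeff_euler kap2 coeff_kap summand del: kap.simps)
  next
    case 2
    have "cov k (kap 0 l) j = 0" for k using cov_0[of k j] by (simp add: cov_def)
    then show ?thesis using 2 by (simp add: coeff_euler kap2 coeff_kap summand kapranov_def cong: if_cong)
  next
    case 3
    have "cov k (kap (Suc 0) l) j = 0" for k using cov_0[of k j] by (simp add: cov_def)
    then show ?thesis using 3 by (simp add: coeff_euler kap2[unfolded numeral_2_eq_2] summand kapranov_def numeral_2_eq_2 del: kap.simps cong: if_cong)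
  next
    case (4 n)
    have "of_nat (y_deg m) * coeff (var (Inl k) * inv_euler (cov k (kap (Suc (Suc n)) l) j)) m =
        coeff (var (Inl k) * cov k (kapranov l) j) m" for k
    proof (cases "m (Inl k) = 0")
      case False
      \<comment> \<open>Multiplication by \<open>var (Inl k)\<close> shifts the degree, so the
        denominator \<open>1 + y_deg\<close> at the shifted index is exactly
        \<open>y_deg m\<close>.\<close>
      have "of_nat (Suc N) * ((1 / real (Suc N)) *\<^sub>R x) = x" for N and x :: 'r
        using scaleR_scaleR[of "real (Suc N)" "1 / real (Suc N)" x]
        by (simp add: scaleR_conv_of_real del: scaleR_scaleR)
      from this[of "Suc (Suc n)"] show ?thesis
        using y_deg_Inl_pred[of m k, OF False] 4 False
        unfolding summand by (simp add: coeff_var_mult coeff_inv_euler del: of_nat_Suc)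
    qed (simp add: coeff_var_mult)
    then show ?thesis
      using 4 by (simp add: coeff_euler kap2 coeff_kap kapranov_def sum_distrib_left del: kap.simps(3))
  qed
qed

lemma rho_sym: "DD j (rho i l k) = DD i (rho j l k)"
  by (simp add: DD_rho Gam_sym[of i j])

lemma euler_rho: "(\<Sum>i\<in>UNIV. var (Inl i) * rho i l k) = 2 * kap 2 l k"
proof -
  have "2 * ((1 / 2) *\<^sub>R x) = x" for x :: "('n idx, 'r) mps"
    by (simp add: scaleR_2[symmetric] mult_2)
  then show ?thesis
    by (simp add: numeral_2_eq_2 rho_def cst_scaleR sum_distrib_left mult_ac)
qed

lemma var_cov:
  "(\<Sum>j\<in>UNIV. var (Inl j) * cov i (u j) k) =
    cov i (\<lambda>k. \<Sum>j\<in>UNIV. var (Inl j) * u j k) k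
    + (\<Sum>j\<in>UNIV. (\<Sum>b\<in>UNIV. cst (Gam i b j) * var (Inl b)) * u j k)"
proof -
  have "(\<Sum>m\<in>UNIV. cst (Gam i m k) * (\<Sum>j\<in>UNIV. var (Inl j) * u j m)) =
      (\<Sum>j\<in>UNIV. var (Inl j) * (\<Sum>m\<in>UNIV. cst (Gam i m k) * u j m))"
    unfolding sum_distrib_left by (subst sum.swap) (simp add: mult_ac)
  then show ?thesis
    by (simp add: cov_def conn.sum conn.mult conn_Inl_var distrib_left sum.distrib sum_subtractf)
qed

lemma DD_var: "DD i (var (Inl j)) = (if i = j then 1 else 0)"
  by (simp add: DD_def pdy_var)

text \<open>
  \<open>defect\<close> is the failure of the recursion to solve \<open>\<nabla>f + \<rho> = \<delta>f\<close>. It is killed by contraction with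
  \<open>y\<close>, and the flatness of \<open>\<nabla>\<^bsup>1,0\<^esup>\<close> makes it closed up to lower order, so that it vanishes degree by degree.
\<close>

definition defect :: "'n \<Rightarrow> 'n \<Rightarrow> 'n \<Rightarrow> ('n idx, 'r) mps" where
  "defect l i k = DD i (kapranov l k) - cov i (kapranov l) k - rho i l k"

lemma defect_contract: "(\<Sum>i\<in>UNIV. var (Inl i) * defect l i k) = 0"
  using euler_kapranov[of l k]
  by (simp add: defect_def right_diff_distrib sum_subtractf euler_rho euler_def DD_def)

text \<open>After antisymmetrization in \<open>i\<close> and \<open>j\<close> only derivatives of
  \<open>defect\<close> survive. Second y-derivatives commute, and the other terms are symmetric by
  \<open>cov_flat\<close>, \<open>bianchi\<close>, \<open>rho_sym\<close> and the absence of
  torsion.\<close>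

lemma defect_closed:
  "DD j (defect l i k) - DD i (defect l j k) =
    cov j (defect l i) k - cov i (defect l j) k"
proof -
  have *: "DD j (defect l i k) = DD j (DD i (kapranov l k)) - cov i (defect l j) k
      - cov i (cov j (kapranov l)) k - cov i (rho j l) k
      + (\<Sum>m\<in>UNIV. cst (Gam i j m) * DD m (kapranov l k)) - DD j (rho i l k)" for i j
  proof -
    have "cov i (\<lambda>k. DD j (kapranov l k)) k =
        cov i (defect l j) k + cov i (cov j (kapranov l)) k + cov i (rho j l) k"
      unfolding cov_add[symmetric] by (simp add: defect_def)
    then show ?thesis
      by (simp add: defect_def[of l i] D.diff DD_cov)
  qed
  show ?thesis
    unfolding *[of i j] *[of j i]
    by (simp add: D_D[of i j] cov_flat[of i j] bianchi[of i j] rho_sym[of i j] Gam_sym[of i j])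
qed

text \<open>Homotopy formula for a one-form in the index \<open>i\<close>: the Euler field acts by
  contraction of the differential plus differential of the contraction. The latter is zero, and by
  \<open>defect_closed\<close> the former has one factor of y more than \<open>defect\<close>, so
  the order of vanishing increases.\<close>

lemma defect_eq_0: "defect l i k = 0"
proof -
  have "low n (defect l i k)" for n i k
  proof (induction n arbitrary: i k)
    case (Suc n)
    have "euler (defect l i k) = (\<Sum>j\<in>UNIV. var (Inl j) * DD j (defect l i k))"
      by (simp add: euler_def DD_def)
    also have "\<dots> = (\<Sum>j\<in>UNIV. var (Inl j) * DD i (defect l j k))
        + (\<Sum>j\<in>UNIV. var (Inl j) * cov j (defect l i) k) - (\<Sum>j\<in>UNIV. var (Inl j) * cov i (defect l j) k)"
    proof -
      have "DD j (defect l i k) = DD i (defect l j k)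
          + cov j (defect l i) k - cov i (defect l j) k" for j
        using defect_closed[of j l i k] by (simp add: algebra_simps)
      then show ?thesis
        by (simp add: distrib_left right_diff_distrib sum.distrib sum_subtractf)
    qed
    \<comment> \<open>Differentiating the vanishing contraction makes \<open>DD i\<close> hit the
      variable itself; this is the source of the 1 in \<open>euler + 1\<close>.\<close>
    also have "(\<Sum>j\<in>UNIV. var (Inl j) * DD i (defect l j k)) = - defect l i k"
    proof -
      have "(\<Sum>j\<in>UNIV. DD i (var (Inl j)) * defect l j k) =
          (\<Sum>j\<in>UNIV. if i = j then defect l j k else 0)"
        by (rule sum.cong) (auto simp: DD_var)
      moreover have "(\<Sum>j\<in>UNIV. DD i (var (Inl j)) * defect l j k)
          + (\<Sum>j\<in>UNIV. var (Inl j) * DD i (defect l j k)) = 0"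
        using arg_cong[OF defect_contract[of l k], of "DD i"]
        by (simp only: D.sum D.mult sum.distrib D.zero)
      ultimately show ?thesis
        by (simp add: add_eq_0_iff)
    qed
    also have "(\<Sum>j\<in>UNIV. var (Inl j) * cov i (defect l j) k) =
       (\<Sum>j\<in>UNIV. (\<Sum>b\<in>UNIV. cst (Gam i b j) * var (Inl b)) * defect l j k)"
      by (simp add: var_cov defect_contract cov_0)
    finally have eq: "euler (defect l i k) + defect l i k =
      (\<Sum>j\<in>UNIV. var (Inl j) * cov j (defect l i) k)
       - (\<Sum>j\<in>UNIV. \<Sum>b\<in>UNIV. cst (Gam i b j) * (var (Inl b) * defect l j k))"
      by (simp add: sum_distrib_right mult.assoc)
    show ?case
    proof (rule low_euler)
      show "low (Suc n) (euler (defect l i k) + defect l i k)"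
        unfolding eq by (intro low_diff low_sum low_cst_mult low_var_mult low_cov Suc.IH)
    qed
  qed simp
  then show ?thesis by (rule low_0_eq)
qed

lemma kapranov_equation: "cov i (kapranov l) k + rho i l k = DD i (kapranov l k)"
  using defect_eq_0[of l i k] by (simp add: defect_def diff_eq_eq add.commute)

text \<open>Lowering the tangent index with \<open>om\<close> absorbs the Christoffel term because
  \<omega> is parallel. The difference of both sides is therefore a scalar to which
  \<open>parallel_eq_0\<close> applies with \<open>c = 0\<close>.\<close>

lemma kapranov_sym: "(\<Sum>j\<in>UNIV. cst (om j l) * kapranov k j) = (\<Sum>j\<in>UNIV. cst (om j k) * kapranov l j)"
proof -
  have low: "low 1 (kapranov l j)" for l j
    using low_kapranov by (rule low_mono) simp
  define S where "S l k = (\<Sum>j\<in>UNIV. cst (om j l) * kapranov k j)" for l k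
  have DS: "DD i (S l k) = conn (Inl i) (S l k) + (\<Sum>j\<in>UNIV. cst (om j l) * rho i k j)" for i l k
  proof -
    have "(\<Sum>j\<in>UNIV. cst (om j l) * (\<Sum>m\<in>UNIV. cst (Gam i m j) * kapranov k m)) =
        (\<Sum>m\<in>UNIV. cst (d (Inl i) (om m l)) * kapranov k m)"
      unfolding sum_mult_swap chern_om[symmetric, of "d (Inl i)"] Gam_def[symmetric]
      by (simp add: cst_sum cst_mult mult.commute)
    then show ?thesis
      by (simp add: S_def D.sum D.mult kapranov_equation[symmetric] cov_def conn.sum conn.mult
          distrib_left sum.distrib add_ac)
  qed
  \<comment> \<open>Symmetry of the lowered curvature in its barred indices: \<open>Gamb_om\<close>
    rewrites it through \<open>Gamb\<close>, which is symmetric by \<open>Gamb_sym\<close>.\<close>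
  have "(\<Sum>j\<in>UNIV. cst (om j l) * rho i k j) = (\<Sum>j\<in>UNIV. cst (om j k) * rho i l j)" for i
  proof -
    have *: "(\<Sum>j\<in>UNIV. cst (om j l) * rho i k j) =
       (\<Sum>a\<in>UNIV. cst (\<Sum>m\<in>UNIV. d (Inl i) (Gamb k l m) * om a m) * var (Inl a))" for l k
      unfolding rho_def sum_mult_swap Gamb_om by (simp add: cst_sum cst_mult mult.commute)
    show ?thesis
      unfolding * by (simp add: Gamb_sym[of k l])
  qed
  then have "DD i (S l k - S k l) = conn (Inl i) (S l k - S k l)" for i
    by (simp add: D.diff conn.diff DS)
  moreover have "low 1 (S l k - S k l)"
    unfolding S_def by (intro low_diff low_sum low_cst_mult low)
  ultimately have "S l k - S k l = 0"
    using parallel_eq_0[of "\<lambda>_. S l k - S k l" "\<lambda>_ _ _. 0"] by simp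
  then show ?thesis by (simp add: S_def)
qed

lemma cov_bracket: "cov i (bracket f g) k = bracket (cov i f) g k + bracket f (cov i g) k"
proof -
  have X: "conn (Inl i) (X f a) = X (cov i f) a + X f (conn (Inl i) a)" for f a
    using X_derivation[OF conn_derivation conn_Inl_DD, where f = f and a = a] by (simp add: cov_def[abs_def])
  have Xc: "X f (cov i g k) = X f (conn (Inl i) (g k)) + (\<Sum>m\<in>UNIV. cst (Gam i m k) * X f (g m))" for f g
  proof -
    have "X f (cst c) = 0" for c by (simp add: X_def)
    then show ?thesis by (simp add: cov_def X_add_right X_sum_right X_mult)
  qed
  show ?thesis
    by (simp add: cov_def[of i "bracket f g"] bracket_def conn.diff X Xc right_diff_distrib sum_subtractf)
qed

lemma conn_Inr_cov:
  assumes "\<And>j. hol (f j)"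
  shows "conn (Inr l) (cov i f k) = cov i (\<lambda>k. conn (Inr l) (f k)) k - bracket (rho i l) f k"
proof -
  have hol: "beta (Suc n) F (f k) = 0" for n F
    using hol_E[OF assms] by (simp add: beta.simps(2))
  \<comment> \<open>A constant sequence is inserted in \<open>rho_ad\<close> at order 0; the
    contraction terms vanish since \<open>f k\<close> contains no barred variable.\<close>
  have "conn (Inl i) (conn (Inr l) (f k)) - conn (Inr l) (conn (Inl i) (f k)) = X (rho i l) (f k)"
    using rho_ad[of i l "\<lambda>_. f k" 0] by (simp add: ad_def K_def hol del: beta.simps)
  moreover have "X f (rho i l k) = (\<Sum>m\<in>UNIV. cst (d (Inr l) (Gam i m k)) * f m)"
    by (simp add: X_def DD_rho mult.commute)
  ultimately show ?thesis
    by (simp add: cov_def bracket_def conn.add conn.sum conn.mult sum.distrib algebra_simps)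
qed

lemma conn_Inr_rho: "conn (Inr l) (rho i k j) = conn (Inr k) (rho i l j)"
  by (simp add: rho_def conn.sum conn.mult conn_var gam_def sum_idx d_commute[of "Inr l"])

text \<open>The curvature brackets produced by commuting \<open>conn (Inr l)\<close> past
  \<open>cov\<close> cancel those produced by the y-derivative of the Lie bracket, and the
  antiholomorphic derivatives of \<open>rho\<close> cancel by symmetry. This leaves
  \<open>DD i (M j) = cov i M j\<close>.\<close>

lemma maurer_cartan:
  "conn (Inr l) (kapranov k j) - conn (Inr k) (kapranov l j) + bracket (kapranov l) (kapranov k) j = 0"
proof -
  define M where "M j = conn (Inr l) (kapranov k j) - conn (Inr k) (kapranov l j)
    + bracket (kapranov l) (kapranov k) j" for j
  have DDb: "DD i (bracket f g j) = bracket (\<lambda>j. DD i (f j)) g j + bracket f (\<lambda>j. DD i (g j)) j" for i f g j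
  proof -
    have "DD i (X f a) = X (\<lambda>j. DD i (f j)) a + X f (DD i a)" for f a
      using X_derivation[OF D_derivation, of i "\<lambda>_ _. 0" f a] by (simp add: D_D)
    then show ?thesis by (simp add: bracket_def D.diff)
  qed
  have br: "bracket (\<lambda>j. f j + g j) h j = bracket f h j + bracket g h j"
     "bracket h (\<lambda>j. f j + g j) j = bracket h f j + bracket h g j"
     "bracket f g j = - bracket g f j" for f g h j
    by (simp_all add: bracket_def X_add_left X_add_right)
  have DDc: "DD i (conn (Inr l) (kapranov k j)) = cov i (\<lambda>j. conn (Inr l) (kapranov k j)) j
      - bracket (rho i l) (kapranov k) j + conn (Inr l) (rho i k j)" for i l k j
    by (simp add: conn_Inr_DD[symmetric] kapranov_equation[symmetric] conn.add conn_Inr_cov[OF hol_kapranov])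
  have "DD i (M j) = cov i M j" for i j
  proof -
    have "cov i M j = cov i (\<lambda>j. conn (Inr l) (kapranov k j)) j - cov i (\<lambda>j. conn (Inr k) (kapranov l j)) j
       + bracket (cov i (kapranov l)) (kapranov k) j + bracket (kapranov l) (cov i (kapranov k)) j"
      by (simp add: M_def[abs_def] cov_add cov_diff cov_bracket)
    moreover have "DD i (bracket (kapranov l) (kapranov k) j) =
       bracket (cov i (kapranov l)) (kapranov k) j + bracket (rho i l) (kapranov k) j
       + bracket (kapranov l) (cov i (kapranov k)) j - bracket (rho i k) (kapranov l) j"
      by (simp add: DDb kapranov_equation[symmetric] br(1,2) br(3)[of "kapranov l" "rho i k"])
    ultimately show ?thesis
      by (simp add: M_def D.add D.diff DDc conn_Inr_rho[of l i k j])
  qed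
  moreover have "low 1 (M j)" for j
  proof -
    have low: "low 1 (kapranov l j)" for l j
      using low_kapranov by (rule low_mono) simp
    \<comment> \<open>The bracket loses one degree to differentiation, which is affordable because
      \<open>kapranov\<close> starts in degree 2.\<close>
    have "low 1 (DD i (kapranov l j))" for i l j
      unfolding DD_def by (rule low_pdy) (simp add: low_kapranov numeral_2_eq_2[symmetric])
    then have "low 1 (kapranov k i * DD i (kapranov l j))" for i k l j
      by (auto simp: low_def coeff_mult y_deg_def)
    then show ?thesis
      unfolding M_def bracket_def X_def by (intro low_add low_diff low_sum low_conn low)
  qed
  ultimately have "M j = 0"
    by (intro parallel_eq_0) (auto simp: cov_def)
  then show ?thesis by (simp add: M_def)
qed

lemma T_commute: "T kapranov A (T kapranov B a) N = T kapranov B (T kapranov A a) N"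
  by (cases A; cases B)
    (simp_all add: T_Inl_Inl T_Inl_Inr T_Inr_Inr kapranov_equation hol_kapranov kapranov_sym maurer_cartan)

end

section \<open>Smooth functions\<close>

lemma Ck_on_SucD:
  assumes "open S" "Ck_on (Suc k) S f" "z \<in> S"
  shows "f differentiable (at z)"
  using assms by (simp add: differentiable_on_eq_differentiable_at)

lemma Ck_on_cong:
  assumes "open S" "Ck_on k S f" "\<And>z. z \<in> S \<Longrightarrow> f z = g z"
  shows "Ck_on k S g"
  using assms
proof (induction k arbitrary: f g)
  case 0
  then show ?case by (simp cong: continuous_on_cong)
next
  case (Suc k)
  have g: "(g has_derivative frechet_derivative f (at z)) (at z)" if z: "z \<in> S" for z
    using Ck_on_SucD[OF Suc.prems(1,2) z] frechet_derivative_works Suc.prems z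
    by (blast intro: has_derivative_transform_within_open)
  then have "g differentiable_on S"
    using \<open>open S\<close> by (auto simp: differentiable_on_eq_differentiable_at differentiable_def)
  moreover have "Ck_on k S (\<lambda>z. frechet_derivative g (at z) v)" for v
    by (rule Suc.IH[of "\<lambda>z. frechet_derivative f (at z) v"])
      (use Suc.prems frechet_derivative_at[OF g] in auto)
  ultimately show ?case by simp
qed

lemma Ck_on_intro:
  assumes S: "open S" and f: "\<And>z. z \<in> S \<Longrightarrow> (f has_derivative f' z) (at z)" and f': "\<And>v. Ck_on k S (\<lambda>z. f' z v)"
  shows "Ck_on (Suc k) S f"
proof -
  have "Ck_on k S (\<lambda>z. frechet_derivative f (at z) v)" for v
    by (rule Ck_on_cong[OF S f'[of v]]) (simp add: frechet_derivative_at[OF f, symmetric])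
  moreover have "f differentiable_on S"
    using S f by (auto simp: differentiable_on_eq_differentiable_at differentiable_def)
  ultimately show ?thesis by simp
qed

lemma Ck_on_has_derivative:
  assumes "open S" "Ck_on (Suc k) S f" "z \<in> S"
  shows "(f has_derivative frechet_derivative f (at z)) (at z)"
  using Ck_on_SucD[OF assms] frechet_derivative_works by blast

lemma Ck_on_derivative: "Ck_on (Suc k) S f \<Longrightarrow> Ck_on k S (\<lambda>z. frechet_derivative f (at z) v)"
  by simp

declare Ck_on.simps(2) [simp del]

lemma Ck_on_pred: "open S \<Longrightarrow> Ck_on (Suc k) S f \<Longrightarrow> Ck_on k S f"
proof (induction k arbitrary: f)
  case 0
  then show ?case by (simp add: Ck_on.simps(2) differentiable_imp_continuous_on)
next
  case (Suc k)
  then show ?case by (auto simp: Ck_on.simps(2)[of "Suc k"] Ck_on.simps(2)[of k])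
qed

lemma Ck_on_subset: "open S \<Longrightarrow> open T \<Longrightarrow> T \<subseteq> S \<Longrightarrow> Ck_on k S f \<Longrightarrow> Ck_on k T f"
proof (induction k arbitrary: f)
  case 0
  then show ?case by (auto intro: continuous_on_subset)
next
  case (Suc k)
  then show ?case
    by (auto simp: Ck_on.simps(2) intro: differentiable_on_subset)
qed

lemma Ck_on_const: "open S \<Longrightarrow> Ck_on k S (\<lambda>_. c)"
proof (induction k arbitrary: c)
  case (Suc k)
  show ?case by (rule Ck_on_intro[where f' = "\<lambda>_ _. 0"]) (simp_all add: Suc)
qed simp

lemma Ck_on_add: "open S \<Longrightarrow> Ck_on k S f \<Longrightarrow> Ck_on k S g \<Longrightarrow> Ck_on k S (\<lambda>z. f z + g z)"
proof (induction k arbitrary: f g)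
  case (Suc k)
  show ?case
    by (rule Ck_on_intro[OF Suc.prems(1) has_derivative_add[OF Ck_on_has_derivative Ck_on_has_derivative]])
      (use Suc in \<open>auto intro: Ck_on_derivative\<close>)
qed (simp add: continuous_on_add)

lemma Ck_on_mult: "open S \<Longrightarrow> Ck_on k S f \<Longrightarrow> Ck_on k S g \<Longrightarrow> Ck_on k S (\<lambda>z. f z * g z)"
proof (induction k arbitrary: f g)
  case (Suc k)
  show ?case
    by (rule Ck_on_intro[OF Suc.prems(1) has_derivative_mult[OF Ck_on_has_derivative Ck_on_has_derivative]])
      (use Suc in \<open>auto intro!: Ck_on_add intro: Ck_on_derivative Ck_on_pred\<close>)
qed (simp add: continuous_on_mult)

lemma Ck_on_inverse:
  "open S \<Longrightarrow> Ck_on k S f \<Longrightarrow> (\<And>z. z \<in> S \<Longrightarrow> f z \<noteq> 0) \<Longrightarrow> Ck_on k S (\<lambda>z. inverse (f z))"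
proof (induction k arbitrary: f)
  case (Suc k)
  show ?case
  proof (rule Ck_on_intro[OF Suc.prems(1) Deriv.has_derivative_inverse[OF _ Ck_on_has_derivative]])
    show "Ck_on k S (\<lambda>z. - (inverse (f z) * frechet_derivative f (at z) v * inverse (f z)))" for v
    proof -
      have "Ck_on k S (\<lambda>z. (- 1) * (inverse (f z) * frechet_derivative f (at z) v * inverse (f z)))"
        using Suc by (intro Ck_on_mult Ck_on_const) (auto intro: Ck_on_derivative Ck_on_pred)
      then show ?thesis by simp
    qed
  qed (use Suc.prems in auto)
qed (simp add: continuous_on_inverse)

lemma open_vimage_shift: "open S \<Longrightarrow> open ((+) a -` S)" for S :: "'a::real_normed_vector set"
  by (rule open_vimage) (auto intro: continuous_intros)

lemma Ck_on_shift:
  "open S \<Longrightarrow> Ck_on k S f \<Longrightarrow> Ck_on k ((+) a -` S) (\<lambda>x. f (a + x))"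
proof (induction k arbitrary: f)
  case 0
  show ?case
    using 0 by (auto intro!: continuous_on_compose2[of S f] continuous_intros)
next
  case (Suc k)
  show ?case
  proof (rule Ck_on_intro[where f' = "\<lambda>x. frechet_derivative f (at (a + x))"])
    fix x assume "x \<in> (+) a -` S"
    then have "(f has_derivative frechet_derivative f (at (a + x))) (at (a + x))"
      using Ck_on_has_derivative[OF Suc.prems] by auto
    moreover have "((\<lambda>x. a + x) has_derivative (\<lambda>x. x)) (at x)"
      by (auto intro!: derivative_eq_intros)
    ultimately show "((\<lambda>x. f (a + x)) has_derivative frechet_derivative f (at (a + x))) (at x)"
      using diff_chain_at[of "\<lambda>x. a + x" "\<lambda>x. x" x f] by (simp add: o_def)
  qed (use Suc in \<open>auto intro: open_vimage_shift Ck_on_derivative\<close>)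
qed

lemma smooth_on_cong: "open S \<Longrightarrow> smooth_on S f \<Longrightarrow> (\<And>z. z \<in> S \<Longrightarrow> f z = g z) \<Longrightarrow> smooth_on S g"
  unfolding smooth_on_def by (blast intro: Ck_on_cong)

lemma smooth_on_subset: "smooth_on S f \<Longrightarrow> open S \<Longrightarrow> open T \<Longrightarrow> T \<subseteq> S \<Longrightarrow> smooth_on T f"
  unfolding smooth_on_def by (blast intro: Ck_on_subset)

lemma smooth_on_const: "open S \<Longrightarrow> smooth_on S (\<lambda>_. c)"
  by (simp add: smooth_on_def Ck_on_const)

lemma smooth_on_add: "open S \<Longrightarrow> smooth_on S f \<Longrightarrow> smooth_on S g \<Longrightarrow> smooth_on S (\<lambda>z. f z + g z)"
  by (simp add: smooth_on_def Ck_on_add)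

lemma smooth_on_mult: "open S \<Longrightarrow> smooth_on S f \<Longrightarrow> smooth_on S g \<Longrightarrow> smooth_on S (\<lambda>z. f z * g z)"
  by (simp add: smooth_on_def Ck_on_mult)

lemma smooth_on_inverse:
  "open S \<Longrightarrow> smooth_on S f \<Longrightarrow> (\<And>z. z \<in> S \<Longrightarrow> f z \<noteq> 0) \<Longrightarrow> smooth_on S (\<lambda>z. inverse (f z))"
  by (simp add: smooth_on_def Ck_on_inverse)

lemma smooth_on_shift: "open S \<Longrightarrow> smooth_on S f \<Longrightarrow> smooth_on ((+) a -` S) (\<lambda>x. f (a + x))"
  unfolding smooth_on_def using Ck_on_shift by blast

lemma smooth_on_derivative: "smooth_on S f \<Longrightarrow> smooth_on S (\<lambda>z. frechet_derivative f (at z) v)"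
  unfolding smooth_on_def using Ck_on_derivative by blast

lemma smooth_on_has_derivative:
  "smooth_on S f \<Longrightarrow> open S \<Longrightarrow> z \<in> S \<Longrightarrow> (f has_derivative frechet_derivative f (at z)) (at z)"
  unfolding smooth_on_def using Ck_on_has_derivative by blast

section \<open>Symmetry of second derivatives\<close>

lemma has_derivative_line:
  assumes "(f has_derivative F) (at (w + s *\<^sub>R u))"
  shows "((\<lambda>s. f (w + s *\<^sub>R u)) has_derivative (\<lambda>t. t *\<^sub>R F u)) (at s)"
proof -
  have "((\<lambda>s. w + s *\<^sub>R u) has_derivative (\<lambda>t. t *\<^sub>R u)) (at s)"
    by (auto intro!: derivative_eq_intros)
  from diff_chain_at[OF this assms] show ?thesis
    by (simp add: o_def linear_cmul[OF has_derivative_linear[OF assms]])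
qed

text \<open>The mean value theorem is applied along \<open>u\<close> to the increment of
  \<open>f\<close> in direction \<open>v\<close>. The second difference over the parallelogram is
  symmetric in \<open>u\<close> and \<open>v\<close>, so comparing its two estimates gives the
  symmetry of second derivatives.\<close>

lemma second_difference:
  fixes f :: "'a::real_normed_vector \<Rightarrow> 'b::real_inner"
  assumes S: "open S" "z \<in> S" and f: "\<And>x. x \<in> S \<Longrightarrow> (f has_derivative f' x) (at x)"
    and F: "((\<lambda>x. f' x u) has_derivative F) (at z)" and "0 < e"
  shows "\<exists>r>0. \<forall>h. 0 < h \<and> h < r \<longrightarrow>
    norm (f (z + h *\<^sub>R v + h *\<^sub>R u) - f (z + h *\<^sub>R u) - (f (z + h *\<^sub>R v) - f z) - (h * h) *\<^sub>R F v) \<le> e * (h * h)"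
proof -
  interpret F: bounded_linear F
    using F by (rule has_derivative_bounded_linear)
  \<comment> \<open>The two remainder terms are taken at points whose distances from
    \<open>z\<close> add up to at most \<open>h * (C - 1)\<close>; the summand 1 keeps
    \<open>C\<close> positive.\<close>
  define C where "C = 2 * norm u + norm v + 1"
  have "0 < C" by (simp add: C_def add_nonneg_pos)
  with F \<open>0 < e\<close> obtain d where "0 < d" and
    d: "\<And>y. norm (y - z) < d \<Longrightarrow> norm (f' y u - f' z u - F (y - z)) \<le> e / C * norm (y - z)"
    unfolding has_derivative_at_alt by (meson divide_pos_pos)
  obtain d' where "0 < d'" and d': "ball z d' \<subseteq> S"
    using S open_contains_ball by blast
  show ?thesis
  proof (intro exI conjI allI impI)
    show "0 < min d d' / C"
      using \<open>0 < C\<close> \<open>0 < d\<close> \<open>0 < d'\<close> by simp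
    fix h assume h: "0 < h \<and> h < min d d' / C"
    then have hC: "h * C < min d d'"
      using \<open>0 < C\<close> by (simp add: pos_less_divide_eq)
    have norm_le: "norm (t *\<^sub>R v + s *\<^sub>R u) \<le> t * norm v + h * norm u" if "s \<in> {0..h}" "0 \<le> t" for s t
      using norm_triangle_ineq[of "t *\<^sub>R v" "s *\<^sub>R u"] mult_right_mono[of s h "norm u"] that by simp
    have near: "norm (t *\<^sub>R v + s *\<^sub>R u) < min d d'" if "s \<in> {0..h}" "t \<in> {0, h}" for s t
    proof -
      have "0 \<le> t" "t * norm v + h * norm u \<le> h * C"
        using that h by (auto simp: C_def algebra_simps)
      then show ?thesis using norm_le[OF that(1), of t] hC by linarith
    qed
    have inS: "z + t *\<^sub>R v + s *\<^sub>R u \<in> S" if "s \<in> {0..h}" "t \<in> {0, h}" for s t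
      using near[OF that] subsetD[OF d'] unfolding mem_ball dist_commute[of z] by (simp add: dist_norm add.assoc)
    let ?g = "\<lambda>s. f (z + h *\<^sub>R v + s *\<^sub>R u) - f (z + s *\<^sub>R u) - s *\<^sub>R (h *\<^sub>R F v)"
    let ?g' = "\<lambda>s. f' (z + h *\<^sub>R v + s *\<^sub>R u) u - f' (z + s *\<^sub>R u) u - h *\<^sub>R F v"
    have der: "(?g has_derivative (\<lambda>t. t *\<^sub>R ?g' s)) (at s)" if "s \<in> {0..h}" for s
      using inS[OF that, of h] inS[OF that, of 0] unfolding scaleR_diff_right
      by (intro has_derivative_diff has_derivative_line f has_derivative_scaleR_left has_derivative_ident) auto
    moreover have "continuous_on {0..h} ?g"
      using der has_derivative_continuous by (blast intro: continuous_at_imp_continuous_on)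
    ultimately obtain s where s: "s \<in> {0<..<h}" and "norm (?g h - ?g 0) \<le> norm ((h - 0) *\<^sub>R ?g' s)"
      using mvt_general[of 0 h ?g "\<lambda>s t. t *\<^sub>R ?g' s"] h by auto
    moreover have "norm (?g' s) \<le> e * h"
    proof -
      have near': "norm (t *\<^sub>R v + s *\<^sub>R u) < d" if "t \<in> {0, h}" for t
        using near[of s t] that s by simp
      have "?g' s = (f' (z + h *\<^sub>R v + s *\<^sub>R u) u - f' z u - F (h *\<^sub>R v + s *\<^sub>R u))
          - (f' (z + s *\<^sub>R u) u - f' z u - F (s *\<^sub>R u))"
        by (simp add: F.add F.scaleR)
      also have "norm \<dots> \<le> e / C * norm (h *\<^sub>R v + s *\<^sub>R u) + e / C * norm (s *\<^sub>R u)"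
        using d[of "z + h *\<^sub>R v + s *\<^sub>R u"] d[of "z + s *\<^sub>R u"] near'[of h] near'[of 0]
        by - (rule order_trans[OF norm_triangle_ineq4 add_mono], simp_all add: add.assoc)
      also have "\<dots> \<le> e / C * (h * norm v + h * norm u) + e / C * (h * norm u)"
        using norm_le[of s h] norm_le[of s 0] s h \<open>0 < e\<close> \<open>0 < C\<close> by (intro add_mono mult_left_mono) auto
      also have "\<dots> = e / C * (h * (norm v + norm u + norm u))"
        by (simp only: distrib_left)
      also have "norm v + norm u + norm u = C - 1"
        by (simp add: C_def)
      also have "e / C * (h * (C - 1)) \<le> e / C * (h * C)"
        using h \<open>0 < e\<close> \<open>0 < C\<close> by (intro mult_left_mono) auto
      finally show ?thesis using \<open>0 < C\<close> by simp
    qed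
    then have "norm (h *\<^sub>R ?g' s) \<le> e * (h * h)"
      using h mult_left_mono[of "norm (?g' s)" "e * h" h] by (simp add: mult_ac)
    ultimately show "norm (f (z + h *\<^sub>R v + h *\<^sub>R u) - f (z + h *\<^sub>R u) - (f (z + h *\<^sub>R v) - f z) - (h * h) *\<^sub>R F v) \<le> e * (h * h)"
      by (simp add: algebra_simps)
  qed
qed

lemma second_derivative_symmetric:
  fixes f :: "'a::real_normed_vector \<Rightarrow> 'b::real_inner"
  assumes S: "open S" "z \<in> S" and f: "\<And>x. x \<in> S \<Longrightarrow> (f has_derivative f' x) (at x)"
    and F: "((\<lambda>x. f' x u) has_derivative F) (at z)" and G: "((\<lambda>x. f' x v) has_derivative G) (at z)"
  shows "F v = G u"
proof -
  have "norm (F v - G u) \<le> e" if "0 < e" for e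
  proof -
    have "0 < e / 2" using that by simp
    from second_difference[OF S f F this, of v] second_difference[OF S f G this, of u]
    obtain r r' where "0 < r" "0 < r'" and
      r: "\<And>h. 0 < h \<and> h < r \<Longrightarrow> norm (f (z + h *\<^sub>R v + h *\<^sub>R u) - f (z + h *\<^sub>R u) - (f (z + h *\<^sub>R v) - f z)
        - (h * h) *\<^sub>R F v) \<le> e / 2 * (h * h)" and
      r': "\<And>h. 0 < h \<and> h < r' \<Longrightarrow> norm (f (z + h *\<^sub>R u + h *\<^sub>R v) - f (z + h *\<^sub>R v) - (f (z + h *\<^sub>R u) - f z)
        - (h * h) *\<^sub>R G u) \<le> e / 2 * (h * h)"
      by blast
    define h where "h = min r r' / 2"
    have h: "0 < h" "h < r" "h < r'"
      using \<open>0 < r\<close> \<open>0 < r'\<close> by (auto simp: h_def)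
    have "norm ((h * h) *\<^sub>R (F v - G u)) \<le> e / 2 * (h * h) + e / 2 * (h * h)"
      using norm_triangle_mono[OF r'[of h] r[of h, unfolded norm_minus_commute[of _ "_ *\<^sub>R _"]]] h
      by (simp add: algebra_simps)
    then show ?thesis using h(1) by simp
  qed
  then have "norm (F v - G u) \<le> 0"
    by (rule field_le_epsilon[of _ 0, simplified])
  then show ?thesis by simp
qed
lemma smooth_on_second_derivative_symmetric:
  assumes f: "smooth_on S f" and S: "open S" and z: "z \<in> S"
  shows "frechet_derivative (\<lambda>x. frechet_derivative f (at x) u) (at z) v =
    frechet_derivative (\<lambda>x. frechet_derivative f (at x) v) (at z) u"
  by (rule second_derivative_symmetric[OF S z smooth_on_has_derivative[OF f S]
      smooth_on_has_derivative[OF smooth_on_derivative[OF f] S z]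
      smooth_on_has_derivative[OF smooth_on_derivative[OF f] S z]])

section \<open>Wirtinger derivatives\<close>

lemma wirt_has_derivative:
  assumes "(f has_derivative D) (at z)"
  shows "wirt A f z = (case A of Inl i \<Rightarrow> (D (axis i 1) - \<i> * D (axis i \<i>)) / 2
             | Inr i \<Rightarrow> (D (axis i 1) + \<i> * D (axis i \<i>)) / 2)"
  using frechet_derivative_at[OF assms, symmetric] by (simp add: wirt_def Let_def)

lemma smooth_on_wirt:
  assumes "open S" "smooth_on S f"
  shows "smooth_on S (wirt A f)"
proof -
  have "smooth_on S (\<lambda>z. (1 / 2) * (frechet_derivative f (at z) u + c * frechet_derivative f (at z) v))" for c u v
    using assms by (intro smooth_on_mult smooth_on_add smooth_on_const smooth_on_derivative)
  from this[of "axis _ 1" "- \<i>" "axis _ \<i>"] this[of "axis _ 1" "\<i>" "axis _ \<i>"] show ?thesis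
    by (cases A) (simp_all add: wirt_def[abs_def] Let_def)
qed

lemma wirt_cong:
  assumes "open S" "z \<in> S" "smooth_on S f" "\<And>x. x \<in> S \<Longrightarrow> f x = g x"
  shows "wirt A f z = wirt A g z"
proof -
  have F: "(f has_derivative frechet_derivative f (at z)) (at z)"
    using assms smooth_on_has_derivative by blast
  then have G: "(g has_derivative frechet_derivative f (at z)) (at z)"
    using assms by (blast intro: has_derivative_transform_within_open)
  show ?thesis
    unfolding wirt_has_derivative[OF F] wirt_has_derivative[OF G] ..
qed

context
  fixes S :: "('n::finite) cvec set" and f g
  assumes S: "open S" and f: "smooth_on S f" and g: "smooth_on S g"
begin

lemma wirt_add: "wirt A (\<lambda>x. f x + g x) z = wirt A f z + wirt A g z"
  and wirt_mult: "wirt A (\<lambda>x. f x * g x) z = wirt A f z * g z + f z * wirt A g z" if z: "z \<in> S"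
proof -
  note F = smooth_on_has_derivative[OF f S z] and G = smooth_on_has_derivative[OF g S z]
  show "wirt A (\<lambda>x. f x + g x) z = wirt A f z + wirt A g z"
    unfolding wirt_has_derivative[OF has_derivative_add[OF F G]] wirt_has_derivative[OF F] wirt_has_derivative[OF G]
    by (cases A) (simp_all add: field_simps)
  show "wirt A (\<lambda>x. f x * g x) z = wirt A f z * g z + f z * wirt A g z"
    unfolding wirt_has_derivative[OF has_derivative_mult[OF F G]] wirt_has_derivative[OF F] wirt_has_derivative[OF G]
    by (cases A) (simp_all add: field_simps)
qed

lemma wirt_wirt: "z \<in> S \<Longrightarrow> wirt A (wirt B f) z = wirt B (wirt A f) z"
proof -
  assume z: "z \<in> S"
  let ?D = "\<lambda>x. frechet_derivative f (at x)"
  let ?D2 = "\<lambda>u x. frechet_derivative (\<lambda>x. ?D x u) (at x)"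
  define H where "H u v = ?D2 u z v" for u v
  have H: "H u v = H v u" for u v
    unfolding H_def by (rule smooth_on_second_derivative_symmetric[OF f S z])
  have "((\<lambda>x. (?D x u + c * ?D x v) / 2) has_derivative (\<lambda>w. (H u w + c * H v w) / 2)) (at z)" for u v c
    unfolding H_def
    by (intro bounded_linear.has_derivative[OF bounded_linear_divide] has_derivative_add has_derivative_mult_right
        smooth_on_has_derivative[OF smooth_on_derivative[OF f] S z])
  note D = this[of "axis _ 1" "- \<i>" "axis _ \<i>"] this[of "axis _ 1" "\<i>" "axis _ \<i>"]
  have W: "wirt (Inl i) f = (\<lambda>x. (?D x (axis i 1) + - \<i> * ?D x (axis i \<i>)) / 2)"
     "wirt (Inr i) f = (\<lambda>x. (?D x (axis i 1) + \<i> * ?D x (axis i \<i>)) / 2)" for i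
    by (simp_all add: wirt_def[abs_def] Let_def)
  show ?thesis
    by (cases A; cases B) (simp_all only: W wirt_has_derivative[OF D(1)] wirt_has_derivative[OF D(2)] sum.case,
      simp_all add: H field_simps)
qed

end

lemma wirt_const [simp]: "wirt A (\<lambda>_. c) z = 0"
  by (simp add: wirt_def split: sum.split)

section \<open>Germs of smooth functions\<close>

text \<open>Smoothness is part of the relation, so it is reflexive only on functions smooth near 0.
  All germs live at the origin because the type cannot depend on the point; \<open>is_germ\<close>
  translates.\<close>

definition germ_rel :: "('n::finite cvec \<Rightarrow> complex) \<Rightarrow> ('n cvec \<Rightarrow> complex) \<Rightarrow> bool" where
  "germ_rel f g \<longleftrightarrow> (\<exists>U. open U \<and> 0 \<in> U \<and> smooth_on U f \<and> smooth_on U g \<and> (\<forall>x\<in>U. f x = g x))"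

lemma germ_relI: "open U \<Longrightarrow> 0 \<in> U \<Longrightarrow> smooth_on U f \<Longrightarrow> (\<And>x. x \<in> U \<Longrightarrow> f x = g x) \<Longrightarrow> germ_rel f g"
  unfolding germ_rel_def by (blast intro: smooth_on_cong)

lemma germ_relE:
  assumes "germ_rel f g"
  obtains U where "open U" "0 \<in> U" "smooth_on U f" "smooth_on U g" "\<And>x. x \<in> U \<Longrightarrow> f x = g x"
  using assms by (auto simp: germ_rel_def)

lemma germ_relE2:
  assumes "germ_rel f g" "germ_rel f' g'"
  obtains U where "open U" "0 \<in> U" "smooth_on U f" "smooth_on U g" "\<And>x. x \<in> U \<Longrightarrow> f x = g x"
    "smooth_on U f'" "smooth_on U g'" "\<And>x. x \<in> U \<Longrightarrow> f' x = g' x"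
proof -
  obtain U V where "open U" "0 \<in> U" "smooth_on U f" "smooth_on U g" "\<And>x. x \<in> U \<Longrightarrow> f x = g x"
    "open V" "0 \<in> V" "smooth_on V f'" "smooth_on V g'" "\<And>x. x \<in> V \<Longrightarrow> f' x = g' x"
    using assms by (elim germ_relE) blast
  then show ?thesis
    by (intro that[of "U \<inter> V"]) (auto intro: smooth_on_subset)
qed

lemma transp_germ_rel: "transp germ_rel"
proof (rule transpI)
  fix f g h :: "'n::finite cvec \<Rightarrow> complex"
  assume "germ_rel f g" "germ_rel g h"
  then obtain U where "open U" "0 \<in> U" "smooth_on U f" "\<And>x. x \<in> U \<Longrightarrow> f x = g x"
      "\<And>x. x \<in> U \<Longrightarrow> g x = h x"
    using germ_relE2[of f g g h] by metis
  then show "germ_rel f h"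
    by (intro germ_relI[of U]) simp_all
qed

quotient_type 'n germ = "'n::finite cvec \<Rightarrow> complex" / partial: germ_rel
proof (rule part_equivpI)
  show "\<exists>x. germ_rel x x"
    by (auto intro!: exI[of _ "\<lambda>_. 0"] germ_relI[of UNIV] smooth_on_const)
  show "symp germ_rel"
    unfolding symp_def germ_rel_def by metis
qed (rule transp_germ_rel)

lemma germ_rel_const: "germ_rel (\<lambda>_. c) (\<lambda>_. c)"
  by (auto intro!: germ_relI[of UNIV] smooth_on_const)

lemma germ_rel_add: "germ_rel f g \<Longrightarrow> germ_rel f' g' \<Longrightarrow> germ_rel (\<lambda>x. f x + f' x) (\<lambda>x. g x + g' x)"
  by (erule (1) germ_relE2, rule germ_relI, assumption, assumption, auto intro!: smooth_on_add)

lemma germ_rel_mult: "germ_rel f g \<Longrightarrow> germ_rel f' g' \<Longrightarrow> germ_rel (\<lambda>x. f x * f' x) (\<lambda>x. g x * g' x)"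
  by (erule (1) germ_relE2, rule germ_relI, assumption, assumption, auto intro!: smooth_on_mult)

lemma germ_rel_wirt: "germ_rel f g \<Longrightarrow> germ_rel (wirt A f) (wirt A g)"
  by (erule germ_relE, rule germ_relI, assumption, assumption, auto intro!: smooth_on_wirt wirt_cong)

lemma germ_rel_scale: "germ_rel f g \<Longrightarrow> germ_rel (\<lambda>x. c * f x) (\<lambda>x. c * g x)"
  by (rule germ_rel_mult[OF germ_rel_const])

lift_definition gconst :: "complex \<Rightarrow> 'n::finite germ" is "\<lambda>c _. c"
  by (rule germ_rel_const)

lift_definition geval :: "'n::finite germ \<Rightarrow> complex" is "\<lambda>f. f 0"
  by (auto elim: germ_relE)

lift_definition gderiv :: "'n::finite idx \<Rightarrow> 'n germ \<Rightarrow> 'n germ" is wirt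
  by (rule germ_rel_wirt)

instantiation germ :: (finite) comm_ring_1
begin
lift_definition zero_germ :: "'a germ" is "\<lambda>_. 0" by (rule germ_rel_const)
lift_definition one_germ :: "'a germ" is "\<lambda>_. 1" by (rule germ_rel_const)
lift_definition plus_germ :: "'a germ \<Rightarrow> 'a germ \<Rightarrow> 'a germ" is "\<lambda>f g x. f x + g x" by (rule germ_rel_add)
lift_definition times_germ :: "'a germ \<Rightarrow> 'a germ \<Rightarrow> 'a germ" is "\<lambda>f g x. f x * g x" by (rule germ_rel_mult)
lift_definition uminus_germ :: "'a germ \<Rightarrow> 'a germ" is "\<lambda>f x. (- 1) * f x" by (rule germ_rel_scale)
lift_definition minus_germ :: "'a germ \<Rightarrow> 'a germ \<Rightarrow> 'a germ" is "\<lambda>f g x. f x + (- 1) * g x"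
  by (intro germ_rel_add germ_rel_scale)
instance
proof
  fix a b c :: "'a germ"
  show "a + b + c = a + (b + c)"
    by transfer (simp only: add.assoc, intro germ_rel_add)
  show "a + b = b + a"
    by transfer (simp only: add.commute, intro germ_rel_add)
  show "0 + a = a"
    by transfer simp
  show "- a + a = 0"
    by transfer (simp add: germ_rel_const)
  show "a - b = a + - b"
    by transfer (intro germ_rel_add germ_rel_scale)
  show "a * b * c = a * (b * c)"
    by transfer (simp only: mult.assoc, intro germ_rel_mult)
  show "a * b = b * a"
    by transfer (simp only: mult.commute, intro germ_rel_mult)
  show "1 * a = a"
    by transfer simp
  show "(a + b) * c = a * c + b * c"
    by transfer (simp only: distrib_right, intro germ_rel_add germ_rel_mult)
  show "(0 :: 'a germ) \<noteq> 1"
    by transfer (auto elim: germ_relE)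
qed
end

instantiation germ :: (finite) real_algebra_1
begin
lift_definition scaleR_germ :: "real \<Rightarrow> 'a germ \<Rightarrow> 'a germ" is "\<lambda>c f x. of_real c * f x"
  by (rule germ_rel_scale)
instance
proof
  fix a b :: "'a germ" and r s :: real
  show "r *\<^sub>R (a + b) = r *\<^sub>R a + r *\<^sub>R b"
    by transfer (simp only: distrib_left, intro germ_rel_add germ_rel_scale)
  show "(r + s) *\<^sub>R a = r *\<^sub>R a + s *\<^sub>R a"
    by transfer (simp only: distrib_right of_real_add, intro germ_rel_add germ_rel_scale)
  show "r *\<^sub>R s *\<^sub>R a = (r * s) *\<^sub>R a"
    by transfer (simp only: mult.assoc of_real_mult, intro germ_rel_scale)
  show "1 *\<^sub>R a = a"
    by transfer simp
  show "r *\<^sub>R a * b = r *\<^sub>R (a * b)"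
    by transfer (simp only: mult.assoc, intro germ_rel_mult germ_rel_scale)
  show "a * r *\<^sub>R b = r *\<^sub>R (a * b)"
    by transfer (simp only: mult.left_commute, intro germ_rel_mult germ_rel_scale)
qed
end

lemma gderiv_derivation: "derivation (gderiv A)"
proof
  fix a b :: "'a germ" and c :: real
  show "gderiv A (a + b) = gderiv A a + gderiv A b"
    by transfer (erule (1) germ_relE2, rule germ_relI, assumption, assumption, auto intro!: smooth_on_wirt smooth_on_add simp: wirt_add)
  show mult: "gderiv A (a * b) = gderiv A a * b + a * gderiv A b" for a b :: "'a germ"
    by transfer (erule (1) germ_relE2, rule germ_relI, assumption, assumption, auto intro!: smooth_on_wirt smooth_on_mult simp: wirt_mult)
  have "gderiv A (of_real c) = 0"
  proof -
    have "gderiv A (c *\<^sub>R (1 :: 'a germ)) = 0"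
      by transfer (rule germ_relI[of UNIV], auto intro!: smooth_on_wirt smooth_on_const)
    then show ?thesis by (simp add: scaleR_conv_of_real)
  qed
  then show "gderiv A (c *\<^sub>R a) = c *\<^sub>R gderiv A a"
    by (simp add: scaleR_conv_of_real mult)
qed

lemma gderiv_commute: "gderiv A (gderiv B a) = gderiv B (gderiv A a)"
  by transfer (erule germ_relE, rule germ_relI, assumption, assumption, auto intro!: smooth_on_wirt wirt_wirt)

definition is_germ :: "'n::finite cvec \<Rightarrow> ('n cvec \<Rightarrow> complex) \<Rightarrow> 'n germ \<Rightarrow> bool" where
  "is_germ z f \<phi> \<longleftrightarrow> (\<exists>U. open U \<and> z \<in> U \<and> smooth_on U f) \<and> \<phi> = abs_germ (\<lambda>x. f (z + x))"

lemma germ_rel_shift: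
  assumes "open U" "z \<in> U" "smooth_on U f" "\<And>x. x \<in> U \<Longrightarrow> f x = g x"
  shows "germ_rel (\<lambda>x. f (z + x)) (\<lambda>x. g (z + x))"
  by (rule germ_relI[OF open_vimage_shift[OF assms(1), of z] _ smooth_on_shift[OF assms(1,3)]]) (use assms in auto)

lemma abs_germ_eqI: "germ_rel f g \<Longrightarrow> abs_germ f = abs_germ g"
  using Quotient_germ by (rule Quotient_rel_abs)

lemma is_germE:
  assumes "is_germ z f \<phi>"
  obtains U where "open U" "z \<in> U" "smooth_on U f" "\<phi> = abs_germ (\<lambda>x. f (z + x))"
    "germ_rel (\<lambda>x. f (z + x)) (\<lambda>x. f (z + x))"
  using assms germ_rel_shift unfolding is_germ_def by blast

lemma is_germE2:
  assumes "is_germ z f \<phi>" "is_germ z g \<psi>"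
  obtains U where "open U" "z \<in> U" "smooth_on U f" "smooth_on U g"
    "\<phi> = abs_germ (\<lambda>x. f (z + x))" "\<psi> = abs_germ (\<lambda>x. g (z + x))"
    "germ_rel (\<lambda>x. f (z + x)) (\<lambda>x. f (z + x))" "germ_rel (\<lambda>x. g (z + x)) (\<lambda>x. g (z + x))"
proof -
  obtain U V where "open U" "z \<in> U" "smooth_on U f" "\<phi> = abs_germ (\<lambda>x. f (z + x))"
    "germ_rel (\<lambda>x. f (z + x)) (\<lambda>x. f (z + x))" "open V" "z \<in> V" "smooth_on V g" "\<psi> = abs_germ (\<lambda>x. g (z + x))"
    "germ_rel (\<lambda>x. g (z + x)) (\<lambda>x. g (z + x))"
    using assms by (elim is_germE) blast
  then show ?thesis
    by (intro that[of "U \<inter> V"]) (auto intro: smooth_on_subset)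
qed

lemma is_germ_cong:
  assumes "is_germ z f \<phi>" "open U" "z \<in> U" "\<And>x. x \<in> U \<Longrightarrow> f x = g x"
  shows "is_germ z g \<phi>"
proof -
  obtain V where V: "open V" "z \<in> V" "smooth_on V f" "\<phi> = abs_germ (\<lambda>x. f (z + x))"
    using assms(1) by (rule is_germE)
  have UV: "open (U \<inter> V)" "z \<in> U \<inter> V" "smooth_on (U \<inter> V) f" "\<And>x. x \<in> U \<inter> V \<Longrightarrow> f x = g x"
    using V assms by (auto intro: smooth_on_subset)
  then have "smooth_on (U \<inter> V) g"
    using smooth_on_cong by blast
  moreover have "abs_germ (\<lambda>x. f (z + x)) = abs_germ (\<lambda>x. g (z + x))"
    using UV by (intro abs_germ_eqI germ_rel_shift)
  ultimately show ?thesis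
    using UV V by (auto simp: is_germ_def)
qed

lemma is_germ_exists: "open U \<Longrightarrow> z \<in> U \<Longrightarrow> smooth_on U f \<Longrightarrow> \<exists>\<phi>. is_germ z f \<phi>"
  by (auto simp: is_germ_def)

lemma is_germ_unique: "is_germ z f \<phi> \<Longrightarrow> is_germ z f \<psi> \<Longrightarrow> \<phi> = \<psi>"
  by (auto simp: is_germ_def)

lemma is_germ_eval: "is_germ z f \<phi> \<Longrightarrow> f z = geval \<phi>"
  by (erule is_germE) (simp add: geval.abs_eq)

lemma is_germ_const: "is_germ z (\<lambda>_. c) (gconst c)"
  by (auto simp: is_germ_def gconst.abs_eq intro!: exI[of _ UNIV] smooth_on_const)

lemma is_germ_0: "is_germ z (\<lambda>_. 0) 0"
  using is_germ_const[of z 0] by (simp add: gconst_def zero_germ_def)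

lemma is_germ_1: "is_germ z (\<lambda>_. 1) 1"
  using is_germ_const[of z 1] by (simp add: gconst_def one_germ_def)

lemma is_germ_add: "is_germ z f \<phi> \<Longrightarrow> is_germ z g \<psi> \<Longrightarrow> is_germ z (\<lambda>x. f x + g x) (\<phi> + \<psi>)"
  by (erule (1) is_germE2) (auto simp: is_germ_def plus_germ.abs_eq intro!: smooth_on_add)

lemma is_germ_mult: "is_germ z f \<phi> \<Longrightarrow> is_germ z g \<psi> \<Longrightarrow> is_germ z (\<lambda>x. f x * g x) (\<phi> * \<psi>)"
  by (erule (1) is_germE2) (auto simp: is_germ_def times_germ.abs_eq intro!: smooth_on_mult)

lemma is_germ_uminus: "is_germ z f \<phi> \<Longrightarrow> is_germ z (\<lambda>x. - f x) (- \<phi>)"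
proof (erule is_germE)
  fix U assume "open U" "z \<in> U" "smooth_on U f" "\<phi> = abs_germ (\<lambda>x. f (z + x))"
    "germ_rel (\<lambda>x. f (z + x)) (\<lambda>x. f (z + x))"
  moreover have "smooth_on U (\<lambda>x. (- 1) * f x)"
    using \<open>open U\<close> \<open>smooth_on U f\<close> by (intro smooth_on_mult smooth_on_const)
  ultimately show "is_germ z (\<lambda>x. - f x) (- \<phi>)"
    by (auto simp: is_germ_def uminus_germ.abs_eq)
qed

lemma is_germ_diff: "is_germ z f \<phi> \<Longrightarrow> is_germ z g \<psi> \<Longrightarrow> is_germ z (\<lambda>x. f x - g x) (\<phi> - \<psi>)"
  using is_germ_add[of z f \<phi> "\<lambda>x. - g x" "- \<psi>"] is_germ_uminus[of z g \<psi>] by simp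

lemma is_germ_scaleR: "is_germ z f \<phi> \<Longrightarrow> is_germ z (\<lambda>x. of_real c * f x) (c *\<^sub>R \<phi>)"
  by (erule is_germE) (auto simp: is_germ_def scaleR_germ.abs_eq intro!: smooth_on_mult smooth_on_const)

lemma is_germ_sum:
  "(\<And>i. i \<in> I \<Longrightarrow> is_germ z (f i) (\<phi> i)) \<Longrightarrow> is_germ z (\<lambda>x. \<Sum>i\<in>I. f i x) (\<Sum>i\<in>I. \<phi> i)"
  by (induction I rule: infinite_finite_induct) (auto intro: is_germ_add is_germ_0)

lemma is_germ_prod:
  "(\<And>i. i \<in> I \<Longrightarrow> is_germ z (f i) (\<phi> i)) \<Longrightarrow> is_germ z (\<lambda>x. \<Prod>i\<in>I. f i x) (\<Prod>i\<in>I. \<phi> i)"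
  by (induction I rule: infinite_finite_induct) (auto intro: is_germ_mult is_germ_1)

lemma is_germ_wirt: "is_germ z f \<phi> \<Longrightarrow> is_germ z (wirt A f) (gderiv A \<phi>)"
proof (erule is_germE)
  fix U assume U: "open U" "z \<in> U" "smooth_on U f" and \<phi>: "\<phi> = abs_germ (\<lambda>x. f (z + x))"
    and rel: "germ_rel (\<lambda>x. f (z + x)) (\<lambda>x. f (z + x))"
  have "germ_rel (\<lambda>x. wirt A f (z + x)) (wirt A (\<lambda>x. f (z + x)))"
  proof (rule germ_relI[OF open_vimage_shift[OF U(1), of z] _ smooth_on_shift[OF U(1) smooth_on_wirt[OF U(1,3)]]])
    fix x assume "x \<in> (+) z -` U"
    then have f: "(f has_derivative frechet_derivative f (at (z + x))) (at (z + x))"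
      using smooth_on_has_derivative[OF U(3,1)] by simp
    have "((\<lambda>x. z + x) has_derivative (\<lambda>x. x)) (at x)"
      by (auto intro!: derivative_eq_intros)
    from diff_chain_at[OF this f] have f': "((\<lambda>x. f (z + x)) has_derivative frechet_derivative f (at (z + x))) (at x)"
      by (simp add: o_def)
    show "wirt A f (z + x) = wirt A (\<lambda>x. f (z + x)) x"
      unfolding wirt_has_derivative[OF f] wirt_has_derivative[OF f'] ..
  qed (use U in auto)
  then have "abs_germ (\<lambda>x. wirt A f (z + x)) = gderiv A \<phi>"
    by (simp add: \<phi> gderiv.abs_eq[OF rel] abs_germ_eqI)
  with U show "is_germ z (wirt A f) (gderiv A \<phi>)"
    by (auto simp: is_germ_def intro!: smooth_on_wirt)
qed

lemma is_germ_eqI: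
  assumes "is_germ z f \<phi>" "is_germ z g \<psi>" "open U" "z \<in> U" "\<And>x. x \<in> U \<Longrightarrow> f x = g x"
  shows "\<phi> = \<psi>"
  using is_germ_unique[OF is_germ_cong[OF assms(1,3-5)] assms(2)] by simp

lemma gconst_mult: "gconst (c * d) = gconst c * gconst d"
  by transfer (rule germ_rel_const)

lemma gderiv_gconst [simp]: "gderiv A (gconst c) = 0"
  by transfer (rule germ_relI[of UNIV], auto intro!: smooth_on_wirt smooth_on_const)

section \<open>Smoothness of the inverse matrix\<close>

lemma smooth_on_sum:
  "open S \<Longrightarrow> (\<And>i. i \<in> I \<Longrightarrow> smooth_on S (f i)) \<Longrightarrow> smooth_on S (\<lambda>x. \<Sum>i\<in>I. f i x)"
  by (induction I rule: infinite_finite_induct) (auto intro: smooth_on_add smooth_on_const)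

lemma smooth_on_prod:
  "open S \<Longrightarrow> (\<And>i. i \<in> I \<Longrightarrow> smooth_on S (f i)) \<Longrightarrow> smooth_on S (\<lambda>x. \<Prod>i\<in>I. f i x)"
  by (induction I rule: infinite_finite_induct) (auto intro: smooth_on_mult smooth_on_const)

lemma matrix_inv_mult:
  fixes A :: "('a::field)^'m::finite^'m"
  assumes "det A \<noteq> 0"
  shows "A ** matrix_inv A = mat 1" "matrix_inv A ** A = mat 1"
proof -
  have "invertible A" using assms by (simp add: invertible_det_nz)
  then have "A ** matrix_inv A = mat 1 \<and> matrix_inv A ** A = mat 1"
    unfolding matrix_inv_def invertible_def by (rule someI_ex)
  then show "A ** matrix_inv A = mat 1" "matrix_inv A ** A = mat 1" by auto
qed

lemma matrix_inv_components:
  fixes A :: "('a::field)^'m::finite^'m"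
  assumes "det A \<noteq> 0"
  shows "(\<Sum>j\<in>UNIV. A $ i $ j * matrix_inv A $ j $ k) = (if i = k then 1 else 0)"
    and "(\<Sum>j\<in>UNIV. matrix_inv A $ i $ j * A $ j $ k) = (if i = k then 1 else 0)"
  using arg_cong[OF matrix_inv_mult(1)[OF assms], of "\<lambda>B. B $ i $ k"]
    arg_cong[OF matrix_inv_mult(2)[OF assms], of "\<lambda>B. B $ i $ k"]
  by (simp_all add: matrix_matrix_mult_def mat_def)

lemma smooth_on_det:
  fixes A :: "'n::finite cvec \<Rightarrow> complex^'m::finite^'m"
  assumes "open S" "\<And>i j. smooth_on S (\<lambda>z. A z $ i $ j)"
  shows "smooth_on S (\<lambda>z. det (A z))"
  unfolding det_def using assms by (intro smooth_on_sum smooth_on_mult smooth_on_const smooth_on_prod)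

lemma smooth_on_matrix_inv:
  fixes A :: "'n::finite cvec \<Rightarrow> complex^'m::finite^'m"
  assumes S: "open S" and A: "\<And>i j. smooth_on S (\<lambda>z. A z $ i $ j)" and det: "\<And>z. z \<in> S \<Longrightarrow> det (A z) \<noteq> 0"
  shows "smooth_on S (\<lambda>z. matrix_inv (A z) $ k $ l)"
proof (rule smooth_on_cong[OF S])
  \<comment> \<open>Cramer's rule: column \<open>l\<close> of the inverse solves the linear system
    with right-hand side the \<open>l\<close>-th unit vector, so its entries are quotients of smooth
    determinants.\<close>
  let ?B = "\<lambda>z. \<chi> i j. if j = k then axis l 1 $ i else A z $ i $ j"
  have "smooth_on S (\<lambda>z. ?B z $ i $ j)" for i j
    using A[of i j] smooth_on_const[OF S] by (cases "j = k") simp_all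
  then show "smooth_on S (\<lambda>z. det (?B z) * inverse (det (A z)))"
    using S A det by (intro smooth_on_mult smooth_on_inverse smooth_on_det) auto
  fix z assume "z \<in> S"
  have "A z *v (matrix_inv (A z) *v axis l 1) = axis l 1"
    by (simp add: matrix_vector_mul_assoc matrix_inv_mult det[OF \<open>z \<in> S\<close>])
  then have "matrix_inv (A z) *v axis l 1 =
     (\<chi> k. det (\<chi> i j. if j = k then axis l 1 $ i else A z $ i $ j) / det (A z))"
    using cramer[OF det[OF \<open>z \<in> S\<close>]] by blast
  then have "(matrix_inv (A z) *v axis l 1) $ k = det (?B z) / det (A z)"
    by simp
  moreover have "(matrix_inv (A z) *v axis l 1) $ k = matrix_inv (A z) $ k $ l"
    by (simp add: matrix_vector_mult_def axis_def if_distrib[of "(*) _"] cong: if_cong)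
  ultimately show "det (?B z) * inverse (det (A z)) = matrix_inv (A z) $ k $ l"
    by (simp add: divide_inverse)
qed

section \<open>Germs of Weyl-bundle-valued forms\<close>

text \<open>\<open>\<alpha> S N\<close> collects the \<open>\<hbar>\<^sup>N\<close>-coefficients of the \<open>dx\<^sup>S\<close>-component.\<close>

type_synonym 'n gmps = "('n idx, 'n germ) mps"

definition rep :: "'n::{finite, linorder} cvec \<Rightarrow> 'n weyl_field \<Rightarrow>
    ('n idx set \<Rightarrow> nat \<Rightarrow> 'n gmps) \<Rightarrow> bool" where
  "rep z a \<alpha> \<longleftrightarrow> (\<forall>S m N. is_germ z (\<lambda>x. fps_nth (a x S m) N) (coeff (\<alpha> S N) m))"

text \<open>The sign \<open>wedge_sign\<close> with values in an arbitrary ring, so that it can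
  multiply germs and power series.\<close>

definition sgw :: "'n::{finite, linorder} idx set \<Rightarrow> 'n idx set \<Rightarrow> 'r::ring_1" where
  "sgw S T = (- 1) ^ card {(s, t). s \<in> S \<and> t \<in> T \<and> idx_less t s}"

lemma repI: "(\<And>S m N. is_germ z (\<lambda>x. fps_nth (a x S m) N) (coeff (\<alpha> S N) m)) \<Longrightarrow> rep z a \<alpha>"
  by (simp add: rep_def)

lemma repD: "rep z a \<alpha> \<Longrightarrow> is_germ z (\<lambda>x. fps_nth (a x S m) N) (coeff (\<alpha> S N) m)"
  by (simp add: rep_def)

lemma rep_eq: "rep z a \<alpha> \<Longrightarrow> (\<And>S N. \<alpha> S N = \<beta> S N) \<Longrightarrow> rep z a \<beta>"
  by (simp add: rep_def)

lemma is_germ_neg1_power: "is_germ z (\<lambda>_. (- 1) ^ k) ((- 1) ^ k)"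
  using is_germ_1[of z] is_germ_uminus[OF is_germ_1, of z] by (cases "even k") auto

lemma is_germ_of_nat_mult: "is_germ z f \<phi> \<Longrightarrow> is_germ z (\<lambda>x. of_nat k * f x) (of_nat k * \<phi>)"
  using is_germ_scaleR[of z f \<phi> "real k"] by (simp add: scaleR_conv_of_real)

lemma sum_weyl_apply: "(\<Sum>i\<in>I. f i) S m = (\<Sum>i\<in>I. f i S m)"
  for f :: "'i \<Rightarrow> 'a \<Rightarrow> 'b \<Rightarrow> 'c::comm_monoid_add"
  by (induction I rule: infinite_finite_induct) auto

lemma rep_add: "rep z a \<alpha> \<Longrightarrow> rep z b \<beta> \<Longrightarrow> rep z (\<lambda>x. a x + b x) (\<lambda>S N. \<alpha> S N + \<beta> S N)"
  by (auto intro!: repI is_germ_add dest: repD)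

lemma rep_diff: "rep z a \<alpha> \<Longrightarrow> rep z b \<beta> \<Longrightarrow> rep z (\<lambda>x. a x - b x) (\<lambda>S N. \<alpha> S N - \<beta> S N)"
  by (auto intro!: repI is_germ_diff dest: repD)

lemma rep_sum:
  "(\<And>i. i \<in> I \<Longrightarrow> rep z (a i) (\<alpha> i)) \<Longrightarrow> rep z (\<lambda>x. \<Sum>i\<in>I. a i x) (\<lambda>S N. \<Sum>i\<in>I. \<alpha> i S N)"
  unfolding rep_def by (auto simp: sum_weyl_apply fps_sum_nth intro!: is_germ_sum)

lemma rep_scl: "is_germ z c \<gamma> \<Longrightarrow> rep z a \<alpha> \<Longrightarrow> rep z (\<lambda>x. c x *\<^sub>w a x) (\<lambda>S N. cst \<gamma> * \<alpha> S N)"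
  by (auto intro!: repI is_germ_mult dest: repD simp: scl_def)

lemma rep_dy: "rep z a \<alpha> \<Longrightarrow> rep z (\<lambda>x. dy A (a x)) (\<lambda>S N. pdy A (\<alpha> S N))"
proof (rule repI)
  fix S m N assume "rep z a \<alpha>"
  then have "is_germ z (\<lambda>x. of_nat (m A + 1) * fps_nth (a x S (m(A := m A + 1))) N)
      (of_nat (m A + 1) * coeff (\<alpha> S N) (m(A := m A + 1)))"
    by (intro is_germ_of_nat_mult repD)
  moreover have "fps_nth (of_nat k * f) N = of_nat k * fps_nth f N" for k and f :: "complex fps"
    using fps_mult_left_const_nth[of "of_nat k" f N] by (simp add: fps_of_nat)
  ultimately show "is_germ z (\<lambda>x. fps_nth (dy A (a x) S m) N) (coeff (pdy A (\<alpha> S N)) m)"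
    by (simp add: dy_def coeff_pdy del: of_nat_Suc of_nat_add)
qed

lemma rep_dx: "rep z (\<lambda>_. dx A) (\<lambda>S N. if S = {A} \<and> N = 0 then 1 else 0)"
  by (auto intro!: repI is_germ_0 is_germ_1 simp: dx_def coeff_one zero_fun_def)

lemma rep_yv: "rep z (\<lambda>_. yv A) (\<lambda>S N. if S = {} \<and> N = 0 then var A else 0)"
  by (auto intro!: repI is_germ_0 is_germ_1 simp: yv_def coeff_var)

lemma rep_pd: "rep z a \<alpha> \<Longrightarrow> rep z (pd A a) (\<lambda>S N. cmap (gderiv A) (\<alpha> S N))"
  by (auto intro!: repI is_germ_wirt dest: repD simp: pd_def)

lemma coeff_sgw_mult [simp]:
  "coeff (sgw S T * u) m = sgw S T * coeff (u :: ('i::finite, 'r::comm_ring_1) mps) m"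
  by (cases "even (card {(s, t). s \<in> S \<and> t \<in> T \<and> idx_less t s})") (auto simp: sgw_def)

lemma is_germ_wedge_sign: "is_germ z (\<lambda>_. wedge_sign S T) (sgw S T)"
  unfolding wedge_sign_def sgw_def by (rule is_germ_neg1_power)

lemma rep_wmul:
  assumes "rep z a \<alpha>" "rep z b \<beta>"
  shows "rep z (\<lambda>x. a x \<odot> b x) (\<lambda>S N. \<Sum>T\<in>Pow S. \<Sum>i\<le>N. sgw T (S - T) * (\<alpha> T i * \<beta> (S - T) (N - i)))"
proof (rule repI)
  fix S m N
  let ?f = "\<lambda>x. \<Sum>T\<in>Pow S. \<Sum>p\<in>{..m}. \<Sum>i\<le>N.
      wedge_sign T (S - T) * (fps_nth (a x T p) i * fps_nth (b x (S - T) (m - p)) (N - i))"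
  let ?c = "\<Sum>T\<in>Pow S. \<Sum>p\<in>{..m}. \<Sum>i\<le>N.
      sgw T (S - T) * (coeff (\<alpha> T i) p * coeff (\<beta> (S - T) (N - i)) (m - p))"
  have "is_germ z ?f ?c"
    by (intro is_germ_sum is_germ_mult is_germ_wedge_sign repD assms)
  moreover have "?c = coeff (\<Sum>T\<in>Pow S. \<Sum>i\<le>N. sgw T (S - T) * (\<alpha> T i * \<beta> (S - T) (N - i))) m"
    by (simp only: coeff_sum coeff_sgw_mult)
      (simp add: coeff_mult[of "\<alpha> _ _"] sum_distrib_left sum.swap[of _ "{..m}"])
  moreover have "fps_nth ((a x \<odot> b x) S m) N = ?f x" for x
  proof -
    have "{p. \<forall>A. p A \<le> m A} = {..m}" by (auto simp: le_fun_def)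
    moreover have "(\<lambda>A. m A - p A) = m - p" for p by (simp add: fun_diff_def)
    ultimately show ?thesis
      by (simp add: wmul_def fps_sum_nth mult.assoc fps_mult_nth[of "a x _ _"] sum_distrib_left atLeast0AtMost)
  qed
  ultimately show "is_germ z (\<lambda>x. fps_nth ((a x \<odot> b x) S m) N)
      (coeff (\<Sum>T\<in>Pow S. \<Sum>i\<le>N. sgw T (S - T) * (\<alpha> T i * \<beta> (S - T) (N - i))) m)"
    by simp
qed

lemma sgw_empty [simp]: "sgw {} T = 1" "sgw S {} = 1"
  by (simp_all add: sgw_def)

lemma rep_scalar_wmul:
  assumes "rep z a (\<lambda>S N. if S = {} \<and> N = 0 then u else 0)" "rep z b \<beta>"
  shows "rep z (\<lambda>x. a x \<odot> b x) (\<lambda>S N. u * \<beta> S N)"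
proof (rule rep_eq[OF rep_wmul[OF assms]])
  show "(\<Sum>T\<in>Pow S. \<Sum>i\<le>N. sgw T (S - T) * ((if T = {} \<and> i = 0 then u else 0) * \<beta> (S - T) (N - i))) = u * \<beta> S N"
    (is "?lhs = _") for S N
  proof -
    have "?lhs = (\<Sum>T\<in>{{}}. \<Sum>i\<in>{0}. sgw T (S - T) * (u * \<beta> (S - T) (N - i)))"
      by (intro sum.mono_neutral_cong_right) (auto intro!: sum.mono_neutral_cong_right)
    then show ?thesis by simp
  qed
qed

lemma rep_wmul_scalar:
  assumes "rep z a \<alpha>" "rep z b (\<lambda>S N. if S = {} \<and> N = 0 then u else 0)"
  shows "rep z (\<lambda>x. a x \<odot> b x) (\<lambda>S N. \<alpha> S N * u)"
proof (rule rep_eq[OF rep_wmul[OF assms]])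
  show "(\<Sum>T\<in>Pow S. \<Sum>i\<le>N. sgw T (S - T) * (\<alpha> T i * (if S - T = {} \<and> N - i = 0 then u else 0))) = \<alpha> S N * u"
    (is "?lhs = _") for S N
  proof -
    have "?lhs = (\<Sum>T\<in>{S}. \<Sum>i\<in>{N}. sgw T (S - T) * (\<alpha> T i * u))"
      by (intro sum.mono_neutral_cong_right) (auto intro!: sum.mono_neutral_cong_right sum.neutral
          split: if_splits)
    then show ?thesis by simp
  qed
qed

lemma rep_dx_wmul:
  assumes "rep z b \<beta>"
  shows "rep z (\<lambda>x. dx A \<odot> b x) (\<lambda>S N. if A \<in> S then sgw {A} (S - {A}) * \<beta> (S - {A}) N else 0)"
proof (rule rep_eq[OF rep_wmul[OF rep_dx assms]])
  show "(\<Sum>T\<in>Pow S. \<Sum>i\<le>N. sgw T (S - T) * ((if T = {A} \<and> i = 0 then 1 else 0) * \<beta> (S - T) (N - i))) =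
      (if A \<in> S then sgw {A} (S - {A}) * \<beta> (S - {A}) N else 0)" (is "?lhs = _") for S N
  proof (cases "A \<in> S")
    case True
    then have "?lhs = (\<Sum>T\<in>{{A}}. \<Sum>i\<in>{0}. sgw T (S - T) * \<beta> (S - T) (N - i))"
      by (intro sum.mono_neutral_cong_right) (auto intro!: sum.mono_neutral_cong_right)
    with True show ?thesis by simp
  qed (auto intro!: sum.neutral)
qed

lemma rep_dx_sum:
  assumes "\<And>A. A \<in> P \<Longrightarrow> rep z (b A) (\<beta> A)"
  shows "rep z (\<lambda>x. \<Sum>A\<in>P. dx A \<odot> b A x) (\<lambda>S N. \<Sum>A\<in>P \<inter> S. sgw {A} (S - {A}) * \<beta> A (S - {A}) N)"
  by (rule rep_eq[OF rep_sum[OF rep_dx_wmul[OF assms]]]) (auto simp: sum.inter_restrict)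

lemma rep_iota:
  "rep z a \<alpha> \<Longrightarrow> rep z (\<lambda>x. iota A (a x)) (\<lambda>S N. if A \<in> S then 0 else sgw {A} S * \<alpha> (insert A S) N)"
  by (auto intro!: repI is_germ_mult is_germ_wedge_sign is_germ_0 dest: repD simp: iota_def)

lemma rep_form_part: "rep z a \<alpha> \<Longrightarrow> rep z (\<lambda>x. form_part p (a x)) (\<lambda>S N. if card S = p then \<alpha> S N else 0)"
  by (auto intro!: repI is_germ_0 dest: repD simp: form_part_def)

lemma rep_hbar_div: "rep z a \<alpha> \<Longrightarrow> rep z (\<lambda>x. hbar_div (a x)) (\<lambda>S N. \<alpha> S (N + 1))"
  by (auto intro!: repI dest: repD simp: hbar_div_def)

definition scale_deg :: "nat \<Rightarrow> ('n::finite idx, 'r::real_vector) mps \<Rightarrow> ('n idx, 'r) mps" where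
  "scale_deg p u = Mps (\<lambda>m. (1 / real (p + y_deg m)) *\<^sub>R coeff u m)"

lemma rep_delta10_inv:
  assumes "rep z a \<alpha>"
  shows "rep z (\<lambda>x. delta10_inv (a x)) (\<lambda>S N. \<Sum>k\<in>UNIV. var (Inl k) *
     (if Inl k \<in> S then 0 else sgw {Inl k} S * scale_deg (form_deg10 (insert (Inl k) S)) (\<alpha> (insert (Inl k) S) N)))"
  unfolding delta10_inv_def
proof (intro rep_sum rep_scalar_wmul rep_yv rep_iota)
  show "rep z (\<lambda>x S m. fps_const (1 / of_nat (form_deg10 S + y_deg m)) * a x S m)
      (\<lambda>S N. scale_deg (form_deg10 S) (\<alpha> S N))"
  proof (rule repI)
    fix S m N
    show "is_germ z (\<lambda>x. fps_nth (fps_const (1 / of_nat (form_deg10 S + y_deg m)) * a x S m) N)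
        (coeff (scale_deg (form_deg10 S) (\<alpha> S N)) m)"
      using is_germ_scaleR[OF repD[OF assms], of "1 / real (form_deg10 S + y_deg m)" S m N]
      by (simp add: scale_deg_def)
  qed
qed

lemma rep_foldr_dy: "rep z a \<alpha> \<Longrightarrow> rep z (\<lambda>x. foldr dy As (a x)) (\<lambda>S N. foldr pdy As (\<alpha> S N))"
  by (induction As) (auto intro: rep_dy)

lemma rep_wick_term:
  assumes W: "\<And>i j. is_germ z (\<lambda>x. w x i j) (W i j)" and "rep z a \<alpha>" "rep z b \<beta>"
  shows "rep z (\<lambda>x. wick_term (w x) k (a x) (b x)) (\<lambda>S N. \<Sum>I\<in>{I. length I = k}. \<Sum>J\<in>{J. length J = k}.
     cst (\<Prod>r<k. W (I ! r) (J ! r)) * (\<Sum>T\<in>Pow S. \<Sum>i\<le>N. sgw T (S - T) *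
       (foldr pdy (map Inl I) (\<alpha> T i) * foldr pdy (map Inr J) (\<beta> (S - T) (N - i)))))"
  unfolding wick_term_def by (intro rep_sum rep_scl is_germ_prod W rep_wmul rep_foldr_dy assms)

lemma rep_wick_raw:
  assumes "\<And>k. rep z (\<lambda>x. wick_term (w x) k (a x) (b x)) (\<tau> k)"
  shows "rep z (\<lambda>x. wick (w x) (a x) (b x)) (\<lambda>S N. \<Sum>k\<le>N. (1 / fact k) *\<^sub>R \<tau> k S (N - k))"
proof (rule repI)
  fix S m N
  have "is_germ z (\<lambda>x. \<Sum>k\<le>N. of_real (1 / fact k) * fps_nth (wick_term (w x) k (a x) (b x) S m) (N - k))
     (\<Sum>k\<le>N. (1 / fact k) *\<^sub>R coeff (\<tau> k S (N - k)) m)"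
    by (intro is_germ_sum is_germ_scaleR repD assms)
  moreover have "fps_nth (wick (w x) (a x) (b x) S m) N =
      (\<Sum>k\<le>N. of_real (1 / fact k) * fps_nth (wick_term (w x) k (a x) (b x) S m) (N - k))" for x
    unfolding wick_def by (auto intro!: sum.cong simp: mult.assoc fps_X_power_mult_nth)
  ultimately show "is_germ z (\<lambda>x. fps_nth (wick (w x) (a x) (b x) S m) N) (coeff (\<Sum>k\<le>N. (1 / fact k) *\<^sub>R \<tau> k S (N - k)) m)"
    by simp
qed

section \<open>Signs\<close>

lemma idx_less_linear: "idx_less A B \<or> A = B \<or> idx_less B A"
  by (cases A; cases B) auto

lemma idx_less_asym: "idx_less A B \<Longrightarrow> \<not> idx_less B A"
  by (cases A; cases B) auto

lemma sgw_singleton: "sgw {A} S = (- 1) ^ card {t \<in> S. idx_less t A}"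
proof -
  have "{(s, t). s \<in> {A} \<and> t \<in> S \<and> idx_less t s} = Pair A ` {t \<in> S. idx_less t A}"
    by auto
  then show ?thesis
    by (simp add: sgw_def card_image inj_on_def)
qed

lemma sgw_insert:
  fixes S :: "'n::{finite, linorder} idx set"
  assumes "B \<notin> S"
  shows "sgw {A} (insert B S) = (if idx_less B A then - 1 else 1) * (sgw {A} S :: 'r::comm_ring_1)"
proof -
  have "{t \<in> insert B S. idx_less t A} =
      (if idx_less B A then insert B {t \<in> S. idx_less t A} else {t \<in> S. idx_less t A})"
    by auto
  then show ?thesis using assms by (simp add: sgw_singleton)
qed

text \<open>Anticommutativity of the one-forms \<open>dx A\<close> and \<open>dx B\<close>: exactly
  one of the two orders of removal counts the inversion between \<open>A\<close> and
  \<open>B\<close>.\<close>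

lemma sgw_antisym:
  fixes S :: "'n::{finite, linorder} idx set"
  assumes "A \<in> S" "B \<in> S" "A \<noteq> B"
  shows "sgw {A} (S - {A}) * sgw {B} (S - {A} - {B}) =
    - (sgw {B} (S - {B}) * sgw {A} (S - {B} - {A}) :: 'r::comm_ring_1)"
proof -
  have eq: "S - {A} = insert B (S - {A} - {B})" "S - {B} = insert A (S - {A} - {B})" "S - {B} - {A} = S - {A} - {B}"
    using assms by auto
  have "sgw {A} (S - {A}) = (if idx_less B A then - 1 else 1) * (sgw {A} (S - {A} - {B}) :: 'r)"
    using sgw_insert[of B "S - {A} - {B}" A] unfolding eq(1)[symmetric] by simp
  moreover have "sgw {B} (S - {B}) = (if idx_less A B then - 1 else 1) * (sgw {B} (S - {A} - {B}) :: 'r)"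
    using sgw_insert[of A "S - {A} - {B}" B] unfolding eq(2)[symmetric] by simp
  ultimately show ?thesis
    using assms idx_less_linear[of A B] idx_less_asym[of A B] by (auto simp: eq(3) mult.commute)
qed

text \<open>Every element of \<open>S\<close> forms an inversion with \<open>A\<close> on exactly
  one side. This is the sign that the graded commutator compensates.\<close>

lemma sgw_right_singleton:
  fixes S :: "'n::{finite, linorder} idx set"
  assumes "A \<notin> S"
  shows "sgw S {A} = (- 1) ^ card S * (sgw {A} S :: 'r::comm_ring_1)"
proof -
  have "{(s, t). s \<in> S \<and> t \<in> {A} \<and> idx_less t s} = (\<lambda>s. (s, A)) ` {s \<in> S. idx_less A s}"
    by auto
  then have 1: "sgw S {A} = ((- 1) ^ card {s \<in> S. idx_less A s} :: 'r)"
    by (simp add: sgw_def card_image inj_on_def)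
  have "{s \<in> S. idx_less A s} \<union> {s \<in> S. idx_less s A} = S"
    using assms idx_less_linear[of A] by auto
  moreover have "card ({s \<in> S. idx_less A s} \<union> {s \<in> S. idx_less s A}) =
      card {s \<in> S. idx_less A s} + card {s \<in> S. idx_less s A}"
    using idx_less_asym by (intro card_Un_disjoint) auto
  ultimately have "card S = card {s \<in> S. idx_less A s} + card {s \<in> S. idx_less s A}"
    by simp
  then have "(- 1) ^ card S * (sgw {A} S :: 'r) =
     (- 1) ^ card {s \<in> S. idx_less A s} * ((- 1) * (- 1)) ^ card {s \<in> S. idx_less s A}"
    unfolding sgw_singleton by (simp add: power_add power_mult_distrib[symmetric] mult.assoc)
  then show ?thesis by (simp add: 1)
qed

section \<open>The germ of a Kaehler metric\<close>

lemma matrix_inv_unique: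
  fixes A B :: "('a::field)^'m::finite^'m"
  assumes "A ** B = mat 1"
  shows "matrix_inv A = B"
proof -
  have "det A \<noteq> 0"
    using arg_cong[OF assms, of det] by (auto simp: det_mul)
  then have "matrix_inv A ** (A ** B) = B"
    by (simp add: matrix_mul_assoc matrix_inv_mult)
  then show ?thesis by (simp add: assms)
qed

text \<open>One chart domain with a chosen point, where positivity of the metric enters as
  nondegeneracy. Its germs at \<open>z\<close> form an instance of
  \<open>kaehler_ring\<close>.\<close>

locale kaehler_point =
  fixes G :: "'n::{finite, linorder} hmetric" and U :: "'n cvec set" and z :: "'n cvec"
  assumes open_U: "open U" and z_in_U: "z \<in> U"
    and metric_smooth: "smooth_on U (\<lambda>x. G x $ i $ j)"
    and metric_det: "x \<in> U \<Longrightarrow> det (G x) \<noteq> 0"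
    and form_closed: "x \<in> U \<Longrightarrow> ext_d (kaehler_form G) x = 0"
begin

definition om :: "'n \<Rightarrow> 'n \<Rightarrow> 'n germ" where
  "om i j = abs_germ (\<lambda>x. omega G (z + x) $ i $ j)"
definition W :: "'n \<Rightarrow> 'n \<Rightarrow> 'n germ" where
  "W i j = abs_germ (\<lambda>x. omega_inv G (z + x) i j)"

lemma smooth_on_omega: "smooth_on U (\<lambda>x. omega G x $ i $ j)"
  using smooth_on_mult[OF open_U smooth_on_const[OF open_U] metric_smooth] by (simp add: omega_def)

lemma det_omega: "x \<in> U \<Longrightarrow> det (omega G x) \<noteq> 0"
proof -
  have "omega G x = (\<chi> i. \<i> *s G x $ i)"
    by (simp add: omega_def vec_eq_iff)
  then show "x \<in> U \<Longrightarrow> det (omega G x) \<noteq> 0"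
    by (simp add: det_rows_mul metric_det)
qed

lemma is_germ_om: "is_germ z (\<lambda>x. omega G x $ i $ j) (om i j)"
  using open_U z_in_U smooth_on_omega by (auto simp: is_germ_def om_def)

lemma is_germ_W: "is_germ z (\<lambda>x. omega_inv G x i j) (W i j)"
proof -
  have "smooth_on U (\<lambda>x. (- 1) * matrix_inv (omega G x) $ j $ i)"
    by (intro smooth_on_mult smooth_on_const smooth_on_matrix_inv open_U smooth_on_omega det_omega)
  then show ?thesis
    using open_U z_in_U by (auto simp: is_germ_def W_def omega_inv_def)
qed

lemma is_germ_eq_on_U: "is_germ z f \<phi> \<Longrightarrow> is_germ z g \<psi> \<Longrightarrow> (\<And>x. x \<in> U \<Longrightarrow> f x = g x) \<Longrightarrow> \<phi> = \<psi>"
  using is_germ_eqI[OF _ _ open_U z_in_U] by blast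

lemma omega_inv_omega:
  assumes "x \<in> U"
  shows "(\<Sum>j\<in>UNIV. omega_inv G x i j * omega G x $ k $ j) = (if i = k then - 1 else 0)"
    and "(\<Sum>i\<in>UNIV. omega_inv G x i j * omega G x $ i $ k) = (if j = k then - 1 else 0)"
  using matrix_inv_components(1)[OF det_omega[OF assms], of k i]
    matrix_inv_components(2)[OF det_omega[OF assms], of j k]
  by (auto simp: omega_inv_def sum_negf mult.commute)

lemma is_germ_minus_delta: "is_germ z (\<lambda>_. if P then - 1 else 0) (if P then - 1 else 0)"
  using is_germ_uminus[OF is_germ_1] by (auto intro: is_germ_0)

lemma W_om: "(\<Sum>j\<in>UNIV. W i j * om k j) = (if i = k then - 1 else 0)"
  by (rule is_germ_eq_on_U[OF is_germ_sum[OF is_germ_mult[OF is_germ_W is_germ_om]] is_germ_minus_delta])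
    (rule omega_inv_omega)

lemma om_W: "(\<Sum>i\<in>UNIV. W i j * om i k) = (if j = k then - 1 else 0)"
  by (rule is_germ_eq_on_U[OF is_germ_sum[OF is_germ_mult[OF is_germ_W is_germ_om]] is_germ_minus_delta])
    (rule omega_inv_omega)

sublocale gd: derivation "gderiv A" for A
  by (rule gderiv_derivation)

section \<open>Components of the closedness of the Kaehler form\<close>

definition kf :: "'n idx set \<Rightarrow> nat \<Rightarrow> 'n gmps" where
  "kf S N = (\<Sum>i\<in>UNIV. \<Sum>j\<in>UNIV. cst (om i j) * (if S = {Inl i, Inr j} \<and> N = 0 then 1 else 0))"

lemma rep_kaehler_form: "rep z (kaehler_form G) kf"
proof -
  have "rep z (\<lambda>_. dx (Inl i) \<odot> dx (Inr j)) (\<lambda>S N. if S = {Inl i, Inr j} \<and> N = 0 then 1 else 0)" for i j :: 'n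
  proof (rule rep_eq[OF rep_dx_wmul[OF rep_dx]])
    fix S :: "'n idx set" and N :: nat
    show "(if Inl i \<in> S then sgw {Inl i} (S - {Inl i}) * (if S - {Inl i} = {Inr j} \<and> N = 0 then 1 else 0) else 0) =
        (if S = {Inl i, Inr j} \<and> N = 0 then 1 else 0 :: 'n gmps)"
    proof (cases "Inl i \<in> S \<and> S - {Inl i} = {Inr j}")
      case True
      then have "S = {Inl i, Inr j}" by blast
      moreover have "sgw {Inl i} {Inr j} = (1 :: 'n gmps)"
        using sgw_insert[of "Inr j" "{}" "Inl i"] by simp
      ultimately show ?thesis using True by simp
    next
      case False
      then have "S \<noteq> {Inl i, Inr j}" by blast
      with False show ?thesis by simp
    qed
  qed
  then show ?thesis
    unfolding kaehler_form_def[abs_def] kf_def[abs_def] by (intro rep_sum rep_scl is_germ_om)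
qed

lemma kf_Inl_Inr: "kf {Inl i, Inr j} 0 = cst (om i j)"
proof -
  have "kf {Inl i, Inr j} 0 = (\<Sum>i'\<in>UNIV. \<Sum>j'\<in>UNIV. if j' = j then (if i' = i then cst (om i' j') else 0) else 0)"
    unfolding kf_def by (intro sum.cong) (auto simp: doubleton_eq_iff)
  then show ?thesis by simp
qed

lemma kf_eq_0: "(\<And>i j. S \<noteq> {Inl i, Inr j}) \<Longrightarrow> kf S N = 0"
  by (simp add: kf_def)

lemma closed_component:
  "(\<Sum>A\<in>S. sgw {A} (S - {A}) * gderiv A (coeff (kf (S - {A}) 0) 0)) = 0"
proof -
  have "rep z (ext_d (kaehler_form G)) (\<lambda>S N. \<Sum>A\<in>UNIV \<inter> S. sgw {A} (S - {A}) * cmap (gderiv A) (kf (S - {A}) N))"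
    unfolding ext_d_def[abs_def] by (intro rep_dx_sum rep_pd rep_kaehler_form)
  then have "is_germ z (\<lambda>x. fps_nth (ext_d (kaehler_form G) x S 0) 0)
      (\<Sum>A\<in>S. sgw {A} (S - {A}) * gderiv A (coeff (kf (S - {A}) 0) 0))"
    by (auto dest: repD[of _ _ _ S 0 0])
  then show ?thesis
    by (rule is_germ_eq_on_U[OF _ is_germ_0]) (simp add: form_closed)
qed

lemma om_closed10: "gderiv (Inl k) (om i j) = gderiv (Inl i) (om k j)"
proof -
  have *: "gderiv (Inl k) (om i j) = gderiv (Inl i) (om k j)" if "i < k" for i k
  proof -
    have ne: "i \<noteq> k" "k \<noteq> i" "\<not> k < i"
      using that by auto
    have "kf {Inl i, Inl k} 0 = 0" using that by (intro kf_eq_0) auto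
    then show ?thesis
      using closed_component[of "{Inl i, Inl k, Inr j}"] that
      by (simp add: ne sgw_insert kf_Inl_Inr coeff_cst insert_Diff_if)
  qed
  show ?thesis
    using *[of i k] *[of k i] by (cases i k rule: linorder_cases) auto
qed

lemma om_closed01: "gderiv (Inr k) (om i j) = gderiv (Inr j) (om i k)"
proof -
  have *: "gderiv (Inr k) (om i j) = gderiv (Inr j) (om i k)" if "j < k" for j k
  proof -
    have ne: "j \<noteq> k" "k \<noteq> j" "\<not> k < j"
      using that by auto
    have "kf {Inr j, Inr k} 0 = 0" using that by (intro kf_eq_0) auto
    then show ?thesis
      using closed_component[of "{Inl i, Inr j, Inr k}"] that
      by (simp add: ne sgw_insert kf_Inl_Inr coeff_cst insert_Diff_if)
  qed
  show ?thesis
    using *[of j k] *[of k j] by (cases j k rule: linorder_cases) auto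
qed

sublocale kaehler_ring om W gderiv
  by (intro kaehler_ring.intro inverse_matrices.intro kaehler_ring_axioms.intro)
    (rule W_om om_W gderiv_derivation gderiv_commute om_closed10 om_closed01)+

section \<open>The Levi-Civita connection and its curvature on germs\<close>

definition cmg :: "'n idx \<Rightarrow> 'n idx \<Rightarrow> 'n germ" where
  "cmg A B = (case (A, B) of (Inl i, Inr j) \<Rightarrow> gconst (- \<i>) * om i j | (Inr j, Inl i) \<Rightarrow> gconst (- \<i>) * om i j | _ \<Rightarrow> 0)"
definition cmi :: "'n idx \<Rightarrow> 'n idx \<Rightarrow> 'n germ" where
  "cmi A B = (case (A, B) of (Inl i, Inr j) \<Rightarrow> gconst (- \<i>) * W i j | (Inr j, Inl i) \<Rightarrow> gconst (- \<i>) * W i j | _ \<Rightarrow> 0)"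

lemma is_germ_cmetric: "is_germ z (\<lambda>x. cmetric G x $ A $ B) (cmg A B)"
  using is_germ_mult[OF is_germ_const[of z "- \<i>"] is_germ_om]
  by (cases A; cases B) (auto simp: cmetric_def cmg_def omega_def intro: is_germ_0)

lemma is_germ_cmetric_inv: "is_germ z (\<lambda>x. matrix_inv (cmetric G x) $ A $ B) (cmi A B)"
proof (rule is_germ_cong[OF _ open_U z_in_U])
  let ?M = "\<lambda>x. (\<chi> A B. case (A, B) of (Inl i, Inr j) \<Rightarrow> - \<i> * omega_inv G x i j
     | (Inr j, Inl i) \<Rightarrow> - \<i> * omega_inv G x i j | _ \<Rightarrow> 0) :: complex^('n idx)^('n idx)"
  show "is_germ z (\<lambda>x. ?M x $ A $ B) (cmi A B)"
    using is_germ_mult[OF is_germ_const[of z "- \<i>"] is_germ_W]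
    by (cases A; cases B) (auto simp: cmi_def intro: is_germ_0)
  fix x assume x: "x \<in> U"
  have 1: "(\<Sum>j\<in>UNIV. - (G x $ i $ j * (\<i> * omega_inv G x k j))) = (if i = k then 1 else 0)" for i k
    using omega_inv_omega(1)[OF x, of k i] by (simp add: omega_def sum_negf mult_ac eq_commute[of i])
  have 2: "(\<Sum>j\<in>UNIV. - (G x $ j $ i * (\<i> * omega_inv G x j k))) = (if i = k then 1 else 0)" for i k
    using omega_inv_omega(2)[OF x, of k i] by (simp add: omega_def sum_negf mult_ac eq_commute[of i])
  have "(cmetric G x ** ?M x) $ A $ B = mat 1 $ A $ B" for A B
    by (cases A; cases B) (simp_all add: matrix_matrix_mult_def mat_def cmetric_def sum_idx 1 2)
  then have "matrix_inv (cmetric G x) = ?M x"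
    by (intro matrix_inv_unique) (simp add: vec_eq_iff)
  then show "?M x $ A $ B = matrix_inv (cmetric G x) $ A $ B" by simp
qed

text \<open>The Levi-Civita connection is the Chern connection. For three indices of equal type, one
  term of the Koszul formula vanishes by type and the other two agree by closedness; in mixed cases
  closedness or type makes everything cancel. The product of the two factors \<open>- \<i>\<close>,
  which convert between the metric and \<omega>, supplies the sign in \<open>chern\<close>.\<close>

lemma chr_koszul: "(1 / 2) *\<^sub>R (\<Sum>D\<in>UNIV. cmi C D *
   (gderiv A (cmg B D) + gderiv B (cmg A D) - gderiv D (cmg A B))) = chr C A B"
proof -
  have half: "(1 / 2) *\<^sub>R (a * (2 * x)) = a * x" for a x :: "'n germ"
    unfolding mult_2 distrib_left by (rule scaleR_half_double)
  have i_i: "(gconst (- \<i>) * x) * (gconst (- \<i>) * y) = - (x * y)" for x y :: "'n germ"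
  proof -
    have "(gconst (- \<i>) * x) * (gconst (- \<i>) * y) = gconst (- \<i> * - \<i>) * (x * y)"
      unfolding gconst_mult by (simp only: mult_ac)
    moreover have "gconst (- 1) = (- 1 :: 'n germ)"
      by (rule is_germ_unique[OF is_germ_const is_germ_uminus[OF is_germ_1]])
    ultimately show ?thesis by simp
  qed
  have closed: "c * gderiv (Inl i) (om j e) + c * gderiv (Inl j) (om i e) = c * (2 * gderiv (Inl i) (om j e))"
    "c * gderiv (Inr i) (om e j) + c * gderiv (Inr j) (om e i) = c * (2 * gderiv (Inr i) (om e j))"
    "c * gderiv (Inl i) (om j e) - c * gderiv (Inl j) (om i e) = 0"
    "c * gderiv (Inr i) (om e j) - c * gderiv (Inr j) (om e i) = 0" for c i j e
    using om_closed10[of i j e] om_closed01[of i e j] by (simp_all only: mult_2 distrib_left diff_self)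
  show ?thesis
    by (cases C; cases A; cases B)
      (simp_all add: sum_idx cmi_def cmg_def gd.mult closed i_i Gam_def Gamb_def chern_def T.chern_def
        scaleR_sum_right half sum_negf)
qed

lemma is_germ_christoffel: "is_germ z (\<lambda>x. christoffel G x C A B) (chr C A B)"
proof -
  have "is_germ z (\<lambda>x. of_real (1 / 2) * (\<Sum>D\<in>UNIV. matrix_inv (cmetric G x) $ C $ D *
      (wirt A (\<lambda>x. cmetric G x $ B $ D) x + wirt B (\<lambda>x. cmetric G x $ A $ D) x - wirt D (\<lambda>x. cmetric G x $ A $ B) x)))
     ((1 / 2) *\<^sub>R (\<Sum>D\<in>UNIV. cmi C D * (gderiv A (cmg B D) + gderiv B (cmg A D) - gderiv D (cmg A B))))"
    by (intro is_germ_scaleR is_germ_sum is_germ_mult is_germ_add is_germ_diff is_germ_cmetric_inv is_germ_wirt is_germ_cmetric)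
  then show ?thesis
    unfolding chr_koszul by (simp add: christoffel_def)
qed

lemma rep_nabla_component:
  assumes "rep z a \<alpha>"
  shows "rep z (\<lambda>x. pd A a x - (\<Sum>B\<in>UNIV. \<Sum>C\<in>UNIV. christoffel G x C A B *\<^sub>w (yv B \<odot> dy C (a x))))
    (\<lambda>S N. conn A (\<alpha> S N))"
proof (rule rep_eq)
  show "rep z (\<lambda>x. pd A a x - (\<Sum>B\<in>UNIV. \<Sum>C\<in>UNIV. christoffel G x C A B *\<^sub>w (yv B \<odot> dy C (a x))))
    (\<lambda>S N. cmap (gderiv A) (\<alpha> S N) - (\<Sum>B\<in>UNIV. \<Sum>C\<in>UNIV. cst (chr C A B) * (var B * pdy C (\<alpha> S N))))"
    by (intro rep_diff rep_pd rep_sum rep_scl is_germ_christoffel rep_scalar_wmul rep_yv rep_dy assms)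
  show "cmap (gderiv A) (\<alpha> S N) - (\<Sum>B\<in>UNIV. \<Sum>C\<in>UNIV. cst (chr C A B) * (var B * pdy C (\<alpha> S N))) = conn A (\<alpha> S N)" for S N
    unfolding conn_def V.X_def gam_def sum_distrib_right by (subst sum.swap) (simp add: mult.assoc)
qed

lemma rep_nabla:
  "rep z a \<alpha> \<Longrightarrow> rep z (nabla P G a) (\<lambda>S N. \<Sum>A\<in>P \<inter> S. sgw {A} (S - {A}) * conn A (\<alpha> (S - {A}) N))"
  unfolding nabla_def[abs_def] by (intro rep_dx_sum rep_nabla_component)

lemma is_germ_curv: "is_germ z (\<lambda>x. curv G x i j k m) (gderiv (Inr j) (Gam i k m))"
proof -
  define \<alpha> :: "'n idx set \<Rightarrow> nat \<Rightarrow> 'n gmps"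
    where "\<alpha> = (\<lambda>S N. if S = {} \<and> N = 0 then var (Inl m) else 0)"
  have "rep z (\<lambda>_. yv (Inl m)) \<alpha>"
    unfolding \<alpha>_def by (rule rep_yv)
  then have rep: "rep z (nabla UNIV G (nabla UNIV G (\<lambda>_. yv (Inl m)))) (\<lambda>S N. \<Sum>A\<in>UNIV \<inter> S. sgw {A} (S - {A}) *
      conn A (\<Sum>B\<in>UNIV \<inter> (S - {A}). sgw {B} (S - {A} - {B}) * conn B (\<alpha> (S - {A} - {B}) N)))"
    by (intro rep_nabla)
  let ?S = "{Inl i, Inr j}"
  have "conn (Inr j) (var (Inl m)) = 0"
    by (simp add: conn_var gam_def sum_idx)
  \<comment> \<open>Only the order with \<open>Inr j\<close> outermost contributes, and the wedge
    sign -1 for moving the antiholomorphic factor to the right turns \<open>- rho\<close> into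
    \<open>rho\<close>.\<close>
  moreover have "conn (Inr j) (conn (Inl i) (var (Inl m))) = - rho i j m"
    by (simp add: conn_Inl_var conn.minus conn.sum conn.mult rho_def sum_negf) (simp add: conn_var gam_def sum_idx)
  ultimately have "(\<Sum>A\<in>UNIV \<inter> ?S. sgw {A} (?S - {A}) *
      conn A (\<Sum>B\<in>UNIV \<inter> (?S - {A}). sgw {B} (?S - {A} - {B}) * conn B (\<alpha> (?S - {A} - {B}) 0))) = rho i j m"
    by (simp add: \<alpha>_def insert_Diff_if sgw_insert)
  moreover have "coeff (rho i j m) (unit_exp (Inl k)) = gderiv (Inr j) (Gam i k m)"
  proof -
    have "unit_exp (Inl k) = unit_exp (Inl b :: 'n idx) \<longleftrightarrow> b = k" for b
      by (auto simp: unit_exp_def fun_eq_iff split: if_splits)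
    then show ?thesis
      by (simp add: rho_def coeff_var if_distrib[of "(*) _"] cong: if_cong)
  qed
  ultimately show ?thesis
    using repD[OF rep, of "{Inl i, Inr j}" "unit_exp (Inl k)" 0] by (simp only: curv_def)
qed

text \<open>The form type (0,1) and the absence of \<hbar> and of antiholomorphic tangent components
  are built in: only \<open>S = {Inr l}\<close>, \<open>N = 0\<close> and \<open>C = Inl j\<close>
  give nonzero entries.\<close>

definition \<sigma> :: "nat \<Rightarrow> 'n idx \<Rightarrow> 'n idx set \<Rightarrow> nat \<Rightarrow> 'n gmps" where
  "\<sigma> n C S N = (case C of Inl j \<Rightarrow> if N = 0 then (\<Sum>l\<in>UNIV. if S = {Inr l} then kap n l j else 0) else 0 | Inr _ \<Rightarrow> 0)"

lemma \<sigma>_Inr [simp]: "\<sigma> n (Inr m) S N = 0"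
  by (simp add: \<sigma>_def)

lemma \<sigma>_Inl_Inr: "\<sigma> n (Inl j) {Inr l} 0 = kap n l j"
  by (simp add: \<sigma>_def eq_commute)

lemma \<sigma>_eq_0: "(\<forall>l. S \<noteq> {Inr l}) \<or> N \<noteq> 0 \<Longrightarrow> \<sigma> n C S N = 0"
  by (auto simp: \<sigma>_def split: sum.split)

lemma rep_nabla_T:
  assumes "\<And>C. rep z (V C) (\<nu> C)"
  shows "rep z (nabla_T P G V C) (\<lambda>S N. \<Sum>A\<in>P \<inter> S. sgw {A} (S - {A}) *
     (conn A (\<nu> C (S - {A}) N) + (\<Sum>B\<in>UNIV. cst (chr C A B) * \<nu> B (S - {A}) N)))"
proof (rule rep_eq)
  let ?b = "\<lambda>S N. \<Sum>A\<in>P. \<Sum>B\<in>UNIV. cst (chr C A B) * (if A \<in> S then sgw {A} (S - {A}) * \<nu> B (S - {A}) N else 0)"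
  show "rep z (nabla_T P G V C) (\<lambda>S N. (\<Sum>A\<in>P \<inter> S. sgw {A} (S - {A}) * conn A (\<nu> C (S - {A}) N)) + ?b S N)"
    unfolding nabla_T_def[abs_def]
    by (intro rep_add rep_nabla rep_sum rep_scl is_germ_christoffel rep_dx_wmul assms)
  fix S N
  have "?b S N = (\<Sum>A\<in>P \<inter> S. sgw {A} (S - {A}) * (\<Sum>B\<in>UNIV. cst (chr C A B) * \<nu> B (S - {A}) N))"
    unfolding sum.inter_restrict[OF finite] by (intro sum.cong) (auto simp: sum_distrib_left mult.left_commute)
  then show "(\<Sum>A\<in>P \<inter> S. sgw {A} (S - {A}) * conn A (\<nu> C (S - {A}) N)) + ?b S N =
      (\<Sum>A\<in>P \<inter> S. sgw {A} (S - {A}) *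
     (conn A (\<nu> C (S - {A}) N) + (\<Sum>B\<in>UNIV. cst (chr C A B) * \<nu> B (S - {A}) N)))"
    by (simp add: distrib_left sum.distrib)
qed

lemma scale_deg_1: "scale_deg 1 = inv_euler"
  by (auto simp: scale_deg_def inv_euler_def fun_eq_iff)

lemma rep_R_star_2: "rep z (R_star G (Suc (Suc 0)) C) (\<sigma> (Suc (Suc 0)) C)"
proof (cases C)
  case (Inr m)
  then show ?thesis by (simp add: rep_def is_germ_0)
next
  case (Inl m)
  let ?R = "\<lambda>i j k. cst ((1 / 2) *\<^sub>R gderiv (Inr j) (Gam i k m)) :: 'n gmps"
  let ?x = "\<lambda>i j S N. if Inr j \<in> S then sgw {Inr j} (S - {Inr j}) * (if S - {Inr j} = {} \<and> N = 0 then var (Inl i) else 0) else 0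
    :: 'n gmps"
  let ?y = "\<lambda>i j S N. if S = {Inr j} \<and> N = 0 then var (Inl i) else 0 :: 'n gmps"
  have half: "is_germ z (\<lambda>x. curv G x i j k m / 2) ((1 / 2) *\<^sub>R gderiv (Inr j) (Gam i k m))" for i j k
    using is_germ_scaleR[OF is_germ_curv, of "1 / 2" i j k m] by simp
  have "rep z (R_star G (Suc (Suc 0)) C)
     (\<lambda>S N. \<Sum>i\<in>UNIV. \<Sum>j\<in>UNIV. \<Sum>k\<in>UNIV. ?R i j k * (?x i j S N * var (Inl k)))"
    unfolding R_star.simps Inl sum.case
    by (intro rep_sum rep_scl half rep_wmul_scalar rep_dx_wmul rep_yv)
  then show ?thesis
  proof (rule rep_eq)
    fix S :: "'n idx set" and N :: nat
    have x: "?x i j S N = ?y i j S N" for i j :: 'n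
    proof (cases "S = {Inr j}")
      case False
      then have "\<not> (Inr j \<in> S \<and> S - {Inr j} = {})" by blast
      with False show ?thesis by auto
    qed simp
    have "(\<Sum>i\<in>UNIV. \<Sum>j\<in>UNIV. \<Sum>k\<in>UNIV. ?R i j k * (?y i j S N * var (Inl k))) =
       (\<Sum>j\<in>UNIV. \<Sum>i\<in>UNIV. \<Sum>k\<in>UNIV. ?R i j k * (?y i j S N * var (Inl k)))"
      by (rule sum.swap)
    also have "\<dots> = (\<Sum>j\<in>UNIV. if S = {Inr j} \<and> N = 0 then kap (Suc (Suc 0)) j m else 0)"
    proof (rule sum.cong)
      show "(\<Sum>i\<in>UNIV. \<Sum>k\<in>UNIV. ?R i j k * (?y i j S N * var (Inl k))) =
         (if S = {Inr j} \<and> N = 0 then kap (Suc (Suc 0)) j m else 0)" for j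
        by (cases "S = {Inr j} \<and> N = 0") (simp, simp only: if_False, simp)
    qed simp
    also have "\<dots> = \<sigma> (Suc (Suc 0)) C S N"
      by (simp add: \<sigma>_def Inl)
    finally show "(\<Sum>i\<in>UNIV. \<Sum>j\<in>UNIV. \<Sum>k\<in>UNIV. ?R i j k * (?x i j S N * var (Inl k))) = \<sigma> (Suc (Suc 0)) C S N"
      unfolding x .
  qed
qed

text \<open>The contraction in \<open>delta10_inv\<close> has to remove a holomorphic differential
  just created by \<nabla>, so the form degree is that of type (1,1) and \<open>scale_deg 1\<close>
  is \<open>inv_euler\<close>.\<close>

lemma rep_R_star_Suc:
  assumes "\<And>C. rep z (R_star G (Suc (Suc n)) C) (\<sigma> (Suc (Suc n)) C)"
  shows "rep z (R_star G (Suc (Suc (Suc n))) C) (\<sigma> (Suc (Suc (Suc n))) C)"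
proof -
  define c where "c A S N = conn A (\<sigma> (Suc (Suc n)) C S N) + (\<Sum>B\<in>UNIV. cst (chr C A B) * \<sigma> (Suc (Suc n)) B S N)" for A S N
  have c_0: "c A S N = 0" if "(\<forall>l. S \<noteq> {Inr l}) \<or> N \<noteq> 0" for A S N
    using \<sigma>_eq_0[OF that] by (simp add: c_def)
  have c_Inr: "c (Inl i) S N = 0" if "C = Inr m" for i m S N
    by (simp add: c_def that sum_idx)
  have c_cov: "c (Inl i) {Inr l} 0 = cov i (kap (Suc (Suc n)) l) j" if "C = Inl j" for i j l
    by (simp add: c_def that sum_idx \<sigma>_Inl_Inr cov_def)
  have scale_0: "scale_deg p 0 = (0 :: 'n gmps)" for p
    by (rule mps_eqI) (simp add: scale_deg_def)
  have "rep z (R_star G (Suc (Suc (Suc n))) C) (\<lambda>S N. \<Sum>k\<in>UNIV. var (Inl k) *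
     (if Inl k \<in> S then 0 else sgw {Inl k} S * scale_deg (form_deg10 (insert (Inl k) S))
       (\<Sum>A\<in>range Inl \<inter> insert (Inl k) S. sgw {A} (insert (Inl k) S - {A}) * c A (insert (Inl k) S - {A}) N)))"
    unfolding R_star.simps c_def
    by (rule rep_delta10_inv[OF rep_nabla_T[where V = "R_star G (Suc (Suc n))" and \<nu> = "\<sigma> (Suc (Suc n))" and P = "range Inl"
        and C = C, OF assms]])
  then show ?thesis
  proof (rule rep_eq)
    fix S :: "'n idx set" and N :: nat
    let ?s = "\<lambda>k. \<Sum>A\<in>range Inl \<inter> insert (Inl k) S. sgw {A} (insert (Inl k) S - {A}) * c A (insert (Inl k) S - {A}) N"
    show "(\<Sum>k\<in>UNIV. var (Inl k) * (if Inl k \<in> S then 0 else sgw {Inl k} S * scale_deg (form_deg10 (insert (Inl k) S)) (?s k)))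
      = \<sigma> (Suc (Suc (Suc n))) C S N"
    proof (cases "\<exists>j l. C = Inl j \<and> S = {Inr l} \<and> N = 0")
      case True
      then obtain j l where C: "C = Inl j" and S: "S = {Inr l}" and N: "N = 0" by blast
      have "range Inl \<inter> {Inr l :: 'n idx} = {}" by auto
      moreover have "form_deg10 (insert (Inl k) S) = 1" for k by (simp add: form_deg10_def S)
      moreover have "sgw {Inl k} {Inr l} = (1 :: 'n gmps)" for k
        using sgw_insert[of "Inr l" "{}" "Inl k"] by simp
      ultimately show ?thesis
        by (simp add: S N C c_cov \<sigma>_Inl_Inr scale_deg_1 del: One_nat_def)
    next
      case False
      have "?s k = 0" if "Inl k \<notin> S" for k
      proof (rule sum.neutral, rule ballI)
        fix A :: "'n idx" assume "A \<in> range Inl \<inter> insert (Inl k) S"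
        then obtain i where A: "A = Inl i" by auto
        show "sgw {A} (insert (Inl k) S - {A}) * c A (insert (Inl k) S - {A}) N = 0"
        proof (cases C)
          case (Inr m)
          then show ?thesis by (simp add: A c_Inr)
        next
          case (Inl j)
          with False have S: "(\<forall>l. S \<noteq> {Inr l}) \<or> N \<noteq> 0" by auto
          \<comment> \<open>Removing the added \<open>Inl k\<close> restores \<open>S\<close>;
            removing any other index leaves \<open>Inl k\<close> in the set, which is then no
            antiholomorphic singleton.\<close>
          have "(\<forall>l. insert (Inl k) S - {Inl i} \<noteq> {Inr l}) \<or> N \<noteq> 0"
          proof (cases "i = k")
            case True
            then have "insert (Inl k) S - {Inl i} = S" using \<open>Inl k \<notin> S\<close> by auto
            with S show ?thesis by simp
          qed auto
          then show ?thesis by (simp add: A c_0)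
        qed
      qed
      then have "(\<Sum>k\<in>UNIV. var (Inl k) * (if Inl k \<in> S then 0 else sgw {Inl k} S * scale_deg (form_deg10 (insert (Inl k) S)) (?s k))) = 0"
        by (intro sum.neutral) (auto simp: scale_0)
      moreover have "\<sigma> (Suc (Suc (Suc n))) C S N = 0"
        using False by (cases C) (auto simp: \<sigma>_def)
      ultimately show ?thesis by simp
    qed
  qed
qed

lemma rep_R_star: "rep z (R_star G n C) (\<sigma> n C)"
proof (induction n arbitrary: C)
  case (Suc n)
  show ?case
  proof (cases n)
    case 0
    then show ?thesis by (auto simp: rep_def \<sigma>_def is_germ_0 split: sum.split cong: if_cong)
  next
    case (Suc n')
    then show ?thesis
      using rep_R_star_2 rep_R_star_Suc Suc.IH by (cases n') auto
  qed
qed (auto simp: rep_def \<sigma>_def is_germ_0 split: sum.split cong: if_cong)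

lemma rep_I_part:
  "rep z (I_part G n) (\<lambda>S N. \<Sum>j\<in>UNIV. \<sigma> n (Inl j) S N * pp j)"
proof (rule rep_eq)
  show "rep z (I_part G n) (\<lambda>S N. \<Sum>j\<in>UNIV. \<Sum>k\<in>UNIV. cst (om j k) * (\<sigma> n (Inl j) S N * var (Inr k)))"
    unfolding I_part_def[abs_def] by (intro rep_sum rep_scl is_germ_om rep_wmul_scalar rep_R_star rep_yv)
qed (simp add: pp_def sum_distrib_left mult.left_commute)

definition JJ :: "'n \<Rightarrow> 'n gmps" where
  "JJ l = (\<Sum>j\<in>UNIV. pp j * kapranov l j)"

definition \<iota> :: "'n idx set \<Rightarrow> nat \<Rightarrow> 'n gmps" where
  "\<iota> S N = (if N = 0 then (\<Sum>l\<in>UNIV. if S = {Inr l} then JJ l else 0) else 0)"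

text \<open>Multiplication by \<open>pp j\<close> changes only barred exponents, so the truncation
  at \<open>y_deg m\<close> in \<open>I_sec\<close> still contains the one degree that
  \<open>kapranov\<close> picks.\<close>

lemma coeff_kap_pp: "(\<Sum>n = 2..y_deg m. coeff (kap n l j * pp j) m) = coeff (pp j * kapranov l j) m"
proof -
  have *: "coeff (u * pp j) m = (\<Sum>k\<in>UNIV. om j k * (if m (Inr k) = 0 then 0 else coeff u (m(Inr k := m (Inr k) - 1))))" for u
    by (subst mult.commute) (simp add: pp_def sum_distrib_right mult.assoc coeff_var_mult)
  have "(\<Sum>n = 2..y_deg m. coeff (kap n l j) m') = coeff (kapranov l j) m'" if "y_deg m' = y_deg m" for m'
  proof (cases "2 \<le> y_deg m")
    case True
    have "(\<Sum>n = 2..y_deg m. coeff (kap n l j) m') = (\<Sum>n = 2..y_deg m. if n = y_deg m then coeff (kap n l j) m' else 0)"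
      by (intro sum.cong) (auto simp: coeff_kap that)
    then show ?thesis using True that by (simp add: kapranov_def)
  next
    case False
    then have "y_deg m = 0 \<or> y_deg m = 1" by auto
    then show ?thesis using that by (auto simp: kapranov_def)
  qed
  then have "(\<Sum>n = 2..y_deg m. if m (Inr k) = 0 then 0 else coeff (kap n l j) (m(Inr k := m (Inr k) - 1))) =
      (if m (Inr k) = 0 then 0 else coeff (kapranov l j) (m(Inr k := m (Inr k) - 1)))" for k
    by simp
  then show ?thesis
    unfolding mult.commute[of "pp j"] * by (subst sum.swap) (simp only: sum_distrib_left[symmetric])
qed

lemma rep_I_sec: "rep z (I_sec G) \<iota>"
proof (rule repI)
  fix S m N
  have "is_germ z (\<lambda>x. \<Sum>n = 2..y_deg m. fps_nth (I_part G n x S m) N)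
     (\<Sum>n = 2..y_deg m. coeff (\<Sum>j\<in>UNIV. \<sigma> n (Inl j) S N * pp j) m)"
    by (intro is_germ_sum repD rep_I_part)
  moreover have "(\<Sum>n = 2..y_deg m. coeff (\<Sum>j\<in>UNIV. \<sigma> n (Inl j) S N * pp j) m) = coeff (\<iota> S N) m"
  proof (cases "\<exists>l. S = {Inr l} \<and> N = 0")
    case True
    then obtain l where "S = {Inr l}" "N = 0" by blast
    then show ?thesis
      by (simp add: \<sigma>_Inl_Inr \<iota>_def JJ_def coeff_kap_pp sum.swap[of _ UNIV] eq_commute[of l])
  next
    case False
    then have "\<sigma> n (Inl j) S N = 0" for n j by (intro \<sigma>_eq_0) auto
    with False show ?thesis by (auto simp: \<iota>_def)
  qed
  ultimately show "is_germ z (\<lambda>x. fps_nth (I_sec G x S m) N) (coeff (\<iota> S N) m)"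
    by (simp add: I_sec_def fps_sum_nth)
qed

end

section \<open>Rearrangement of sums over lists, subsets and pairs\<close>

lemma sum_lists_Suc:
  "(\<Sum>I\<in>{I. length I = Suc k}. h I) = (\<Sum>i\<in>UNIV. \<Sum>I\<in>{I. length I = k}. h (i # I))"
  for h :: "'n::finite list \<Rightarrow> 'a::comm_monoid_add"
proof -
  have "(\<Sum>I\<in>{I. length I = Suc k}. h I) = (\<Sum>(i, I)\<in>UNIV \<times> {I. length I = k}. h (i # I))"
    by (rule sum.reindex_bij_witness[where i = "\<lambda>(i, I). i # I" and j = "\<lambda>I. (hd I, tl I)"])
      (auto simp: length_Suc_conv)
  then show ?thesis by (simp add: sum.cartesian_product)
qed

lemma foldr_pdy_pdy: "foldr pdy As (pdy A u) = pdy A (foldr pdy As u)"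
  for u :: "('i, 'r::{comm_ring_1, real_algebra_1}) mps"
  by (induction As) (simp_all add: pdy_commute[of A])

lemma sum_Pow_singletons:
  assumes "finite S" "\<And>X. (\<forall>A. X \<noteq> {A}) \<Longrightarrow> F X = (0 :: 'a::comm_monoid_add)"
  shows "(\<Sum>X\<in>Pow S. F X) = (\<Sum>A\<in>S. F {A})"
proof -
  have "(\<Sum>X\<in>Pow S. F X) = (\<Sum>X\<in>(\<lambda>A. {A}) ` S. F X)"
    using assms by (intro sum.mono_neutral_right) auto
  then show ?thesis by (simp add: sum.reindex)
qed

lemma sum_wick_singletons:
  assumes "finite S" and "\<And>k Q i. (\<forall>A. Q \<noteq> {A}) \<or> i \<noteq> 0 \<Longrightarrow> H k Q i = (0 :: 'a::comm_monoid_add)"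
  shows "(\<Sum>k\<le>N :: nat. \<Sum>Q\<in>Pow S. \<Sum>i\<le>N - k. H k Q i) = (\<Sum>A\<in>S. \<Sum>k\<le>N. H k {A} 0)"
proof -
  have "(\<Sum>i\<le>N - k. H k Q i) = (\<Sum>i\<in>{0}. H k Q i)" for k Q
    by (rule sum.mono_neutral_right) (auto simp: assms)
  then show ?thesis
    using assms by (simp add: sum_Pow_singletons sum.swap[of _ S])
qed

lemma sum_Pow_complement: "(\<Sum>X\<in>Pow S. F X) = (\<Sum>X\<in>Pow S. F (S - X))"
  by (rule sum.reindex_bij_witness[where i = "\<lambda>X. S - X" and j = "\<lambda>X. S - X"]) (auto simp: double_diff)

lemma sum_antisymmetric_eq_0:
  fixes h :: "'i \<Rightarrow> 'i \<Rightarrow> 'a::real_vector"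
  assumes "finite S" "\<And>A B. A \<in> S \<Longrightarrow> B \<in> S \<Longrightarrow> A \<noteq> B \<Longrightarrow> h A B = - h B A"
  shows "(\<Sum>A\<in>S. \<Sum>B\<in>S - {A}. h A B) = 0"
proof -
  let ?x = "\<Sum>A\<in>S. \<Sum>B\<in>S - {A}. h A B"
  have "?x = (\<Sum>B\<in>S. \<Sum>A\<in>S - {B}. h A B)"
    using assms(1) by (simp add: sum.Sigma, intro sum.reindex_bij_witness[where i = "\<lambda>(A, B). (B, A)" and j = "\<lambda>(A, B). (B, A)"]) auto
  also have "\<dots> = - ?x"
    using assms(2) by (simp add: sum_negf[symmetric])
  finally have "?x + ?x = 0" by (simp add: eq_neg_iff_add_eq_0)
  then show ?thesis using scaleR_half_double[of ?x] by simp
qed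

section \<open>The Wick product and the connection on germs\<close>

context kaehler_point
begin

text \<open>Peeling off the heads of both lists is one step of the recursion for
  \<open>beta\<close>: the weight \<open>W i j\<close> and the barred derivative form
  \<open>- EE i\<close>, and the denominators of \<open>beta\<close> accumulate to
  \<open>fact k\<close>.\<close>

lemma beta_lists:
  "(\<Sum>I\<in>{I. length I = k}. \<Sum>J\<in>{J. length J = k}. cst (\<Prod>r<k. W (I ! r) (J ! r)) *
     (foldr pdy (map Inl I) u * foldr pdy (map Inr J) v)) = fact k *\<^sub>R beta k u v"
proof (induction k arbitrary: u v)
  case (Suc k)
  have "(\<Sum>I\<in>{I. length I = Suc k}. \<Sum>J\<in>{J. length J = Suc k}. cst (\<Prod>r<Suc k. W (I ! r) (J ! r)) *
     (foldr pdy (map Inl I) u * foldr pdy (map Inr J) v)) =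
     (\<Sum>i\<in>UNIV. \<Sum>I\<in>{I. length I = k}. \<Sum>j\<in>UNIV. \<Sum>J\<in>{J. length J = k}. cst (W i j) * (cst (\<Prod>r<k. W (I ! r) (J ! r)) *
     (foldr pdy (map Inl I) (pdy (Inl i) u) * foldr pdy (map Inr J) (pdy (Inr j) v))))"
    unfolding sum_lists_Suc by (simp add: prod.lessThan_Suc_shift foldr_pdy_pdy cst_mult mult.assoc del: prod.lessThan_Suc)
  also have "\<dots> = (\<Sum>i\<in>UNIV. \<Sum>j\<in>UNIV. cst (W i j) * (fact k *\<^sub>R beta k (pdy (Inl i) u) (pdy (Inr j) v)))"
    unfolding Suc.IH[symmetric] sum_distrib_left by (rule sum.cong[OF refl]) (rule sum.swap)
  also have "\<dots> = fact k *\<^sub>R (- (\<Sum>i\<in>UNIV. beta k (DD i u) (EE i v)))"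
    by (simp add: DD_def EE_def beta_minus_right beta_sum_right beta_scalar_right[OF EE_cst] sum_negf scaleR_sum_right)
  also have "\<dots> = fact (Suc k) *\<^sub>R beta (Suc k) u v"
    by (simp only: beta_Suc[symmetric] fact_Suc scaleR_scaleR mult.commute)
  finally show ?case .
qed simp

lemma rep_wick:
  assumes "rep z a \<alpha>" "rep z b \<beta>"
  shows "rep z (\<lambda>x. wick (omega_inv G x) (a x) (b x)) (\<lambda>S N. \<Sum>k\<le>N. \<Sum>Q\<in>Pow S. \<Sum>i\<le>N - k.
    sgw Q (S - Q) * beta k (\<alpha> Q i) (\<beta> (S - Q) (N - k - i)))"
proof (rule rep_eq[OF rep_wick_raw[OF rep_wick_term[OF is_germ_W assms]]], rule sum.cong[OF refl])
  fix S :: "'n idx set" and N k :: nat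
  let ?w = "\<lambda>I J. cst (\<Prod>r<k. W (I ! r) (J ! r)) :: 'n gmps"
  let ?b = "\<lambda>I J Q i. foldr pdy (map Inl I) (\<alpha> Q i) * foldr pdy (map Inr J) (\<beta> (S - Q) (N - k - i))"
  let ?lhs = "\<Sum>I\<in>{I. length I = k}. \<Sum>J\<in>{J. length J = k}. ?w I J *
      (\<Sum>Q\<in>Pow S. \<Sum>i\<le>N - k. sgw Q (S - Q) * ?b I J Q i)"
  have "?lhs = (\<Sum>Q\<in>Pow S. \<Sum>i\<le>N - k. sgw Q (S - Q) *
      (\<Sum>I\<in>{I. length I = k}. \<Sum>J\<in>{J. length J = k}. ?w I J * ?b I J Q i))"
    unfolding sum_distrib_left mult.left_commute[of "?w _ _"] by (rule sum_swap4)
  then show "(1 / fact k) *\<^sub>R ?lhs =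
     (\<Sum>Q\<in>Pow S. \<Sum>i\<le>N - k. sgw Q (S - Q) * beta k (\<alpha> Q i) (\<beta> (S - Q) (N - k - i)))"
    unfolding beta_lists by (simp add: scaleR_sum_right)
qed

definition JI :: "'n idx \<Rightarrow> 'n gmps" where
  "JI A = (case A of Inl _ \<Rightarrow> 0 | Inr l \<Rightarrow> JJ l)"

lemma \<iota>_singleton: "\<iota> {A} 0 = JI A"
  by (cases A) (auto simp: \<iota>_def JI_def)

lemma \<iota>_eq_0: "(\<forall>A. Q \<noteq> {A}) \<or> N \<noteq> 0 \<Longrightarrow> \<iota> Q N = 0"
  by (auto simp: \<iota>_def intro!: sum.neutral)

lemma wick_I_left:
  "(\<Sum>k\<le>N. \<Sum>Q\<in>Pow S. \<Sum>i\<le>N - k. sgw Q (S - Q) * beta k (if card Q = p then \<iota> Q i else 0)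
      (if card (S - Q) = q then \<alpha> (S - Q) (N - k - i) else 0)) =
   (if p = 1 \<and> q = card S - 1 then \<Sum>A\<in>S. sgw {A} (S - {A}) * (\<Sum>k\<le>N. beta k (JI A) (\<alpha> (S - {A}) (N - k))) else 0)"
  by (subst sum_wick_singletons) (auto simp: \<iota>_eq_0 \<iota>_singleton sum_distrib_left intro!: sum.neutral)

lemma wick_I_right:
  "(\<Sum>k\<le>N. \<Sum>Q\<in>Pow S. \<Sum>i\<le>N - k. sgw Q (S - Q) * beta k (if card Q = q then \<alpha> Q i else 0)
      (if card (S - Q) = p then \<iota> (S - Q) (N - k - i) else 0)) =
   (if p = 1 \<and> q = card S - 1 then \<Sum>A\<in>S. sgw (S - {A}) {A} * (\<Sum>k\<le>N. beta k (\<alpha> (S - {A}) (N - k)) (JI A)) else 0)"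
  (is "?lhs = ?rhs")
proof -
  have "?lhs = (\<Sum>k\<le>N. \<Sum>Q\<in>Pow S. \<Sum>i\<le>N - k. sgw (S - Q) Q *
      beta k (if card (S - Q) = q then \<alpha> (S - Q) (N - k - i) else 0) (if card Q = p then \<iota> Q i else 0))"
  proof (rule sum.cong[OF refl], subst sum_Pow_complement, rule sum.cong[OF refl])
    fix k Q assume "Q \<in> Pow S"
    then have "S - (S - Q) = Q" by auto
    then show "(\<Sum>i\<le>N - k. sgw (S - Q) (S - (S - Q)) * beta k (if card (S - Q) = q then \<alpha> (S - Q) i else 0)
        (if card (S - (S - Q)) = p then \<iota> (S - (S - Q)) (N - k - i) else 0)) =
      (\<Sum>i\<le>N - k. sgw (S - Q) Q *
        beta k (if card (S - Q) = q then \<alpha> (S - Q) (N - k - i) else 0) (if card Q = p then \<iota> Q i else 0))"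
      by (intro sum.reindex_bij_witness[where i = "\<lambda>i. N - k - i" and j = "\<lambda>i. N - k - i"])
        (auto simp del: diff_diff_left)
  qed
  also have "\<dots> = ?rhs"
    by (subst sum_wick_singletons) (auto simp: \<iota>_eq_0 \<iota>_singleton sum_distrib_left intro!: sum.neutral)
  finally show ?thesis .
qed

text \<open>Order 0 cancels by commutativity. From the right, \<open>JJ l\<close> is linear in the
  barred variables, so beyond order 0 only order 1 survives, namely \<open>- X\<close>; from the
  left every order gives a \<open>K\<close>. The shift from \<open>Suc N\<close> to \<open>N\<close>
  is the division by \<hbar>.\<close>

lemma commutator_ad:
  "(\<Sum>k\<le>Suc N. beta k (JJ l) (a (Suc N - k))) - (\<Sum>k\<le>Suc N. beta k (a (Suc N - k)) (JJ l)) = ad (kapranov l) a N"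
proof -
  have J1: "beta k (JJ l) b = K k (kapranov l) b" for k b
    by (simp add: JJ_def K_def beta_sum_left beta_scalar_left)
  have EJ: "EE i (JJ l) = kapranov l i" for i
  proof -
    have "EE i (JJ l) = (\<Sum>j\<in>UNIV. if i = j then kapranov l j else 0)"
      unfolding JJ_def E.sum by (rule sum.cong) (auto simp: E.mult EE_pp hol_E[OF hol_kapranov])
    then show ?thesis by simp
  qed
  have "beta (Suc 0) b (JJ l) = - X (kapranov l) b" for b
    by (simp add: beta.simps EJ X_def mult.commute)
  moreover have "beta (Suc (Suc k)) b (JJ l) = 0" for k b
    by (simp add: beta.simps(2) EJ hol_E[OF hol_kapranov])
  ultimately have "(\<Sum>k\<le>Suc N. beta k (a (Suc N - k)) (JJ l)) = a (Suc N) * JJ l - X (kapranov l) (a N)"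
    by (subst sum.atMost_Suc_shift) (cases N; simp add: sum.atMost_Suc_shift del: sum.atMost_Suc)
  moreover have "(\<Sum>k\<le>Suc N. beta k (JJ l) (a (Suc N - k))) = JJ l * a (Suc N) + (\<Sum>k\<le>N. K (Suc k) (kapranov l) (a (N - k)))"
    by (subst sum.atMost_Suc_shift) (simp add: J1[of "Suc _"])
  ultimately show ?thesis
    by (simp add: ad_def mult.commute)
qed

lemma rep_wick_comm:
  assumes "rep z a \<alpha>"
  shows "rep z (\<lambda>x. hbar_div (wick_comm (omega_inv G x) (I_sec G x) (a x)))
    (\<lambda>S N. \<Sum>A\<in>S. sgw {A} (S - {A}) * (case A of Inl _ \<Rightarrow> 0 | Inr l \<Rightarrow> ad (kapranov l) (\<alpha> (S - {A})) N))"
proof (rule rep_eq)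
  let ?n = "2 * CARD('n)"
  let ?L = "\<lambda>S N A. sgw {A} (S - {A}) * (\<Sum>k\<le>N. beta k (JI A) (\<alpha> (S - {A}) (N - k)))"
  let ?R = "\<lambda>S N A. sgw (S - {A}) {A} * (\<Sum>k\<le>N. beta k (\<alpha> (S - {A}) (N - k)) (JI A))"
  let ?C = "\<lambda>S N. \<Sum>p\<le>?n. \<Sum>q\<le>?n. (if p = 1 \<and> q = card S - 1 then sum (?L S (N + 1)) S else 0)
      - cst ((- 1) ^ (p * q)) * (if p = 1 \<and> q = card S - 1 then sum (?R S (N + 1)) S else 0)"
  show "rep z (\<lambda>x. hbar_div (wick_comm (omega_inv G x) (I_sec G x) (a x))) ?C"
    unfolding wick_comm_def wick_I_left[symmetric] wick_I_right[symmetric]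
    by (intro rep_hbar_div rep_sum rep_diff rep_scl is_germ_neg1_power rep_wick rep_form_part rep_I_sec assms)
  fix S :: "'n idx set" and N :: nat
  \<comment> \<open>This guarantees that the complementary form degree \<open>card S - 1\<close>
    occurs in the range of summation of \<open>wick_comm\<close>.\<close>
  have card: "card S - 1 \<le> ?n"
  proof -
    have "card S \<le> CARD('n idx)" by (rule card_mono) auto
    then show ?thesis by simp
  qed
  have pick: "(\<Sum>p\<le>?n. \<Sum>q\<le>?n. (if p = 1 \<and> q = card S - 1 then x else 0)
      - cst ((- 1) ^ (p * q)) * (if p = 1 \<and> q = card S - 1 then y else 0)) = x - cst ((- 1) ^ (card S - 1)) * y"
    (is "?sum = _") for x y :: "'n gmps"
  proof -
    have "?sum = (\<Sum>p\<le>?n. \<Sum>q\<le>?n. if q = card S - 1 then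
        if p = 1 then x - cst ((- 1) ^ (card S - 1)) * y else 0 else 0)"
      by (intro sum.cong refl) auto
    then show ?thesis
      using card by simp
  qed
  \<comment> \<open>The graded sign with \<open>p = 1\<close> and \<open>q = card S - 1\<close>
    undoes the sign of moving \<open>dx A\<close> past the remaining differentials, so both halves
    of the commutator carry the same wedge sign.\<close>
  have sign: "cst ((- 1) ^ (card S - 1)) * ?R S M A = sgw {A} (S - {A}) * (\<Sum>k\<le>M. beta k (\<alpha> (S - {A}) (M - k)) (JI A))"
    if "A \<in> S" for A M
  proof -
    have "cst ((- 1) ^ k) = ((- 1) ^ k :: 'n gmps)" for k
      by (cases "even k") (simp_all add: cst_uminus)
    moreover have "(- 1) ^ k * ((- 1) ^ k * x) = (x :: 'n gmps)" for k x
      by (cases "even k") simp_all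
    ultimately show ?thesis
      using that sgw_right_singleton[of A "S - {A}", where 'r = "'n gmps"]
      by (simp add: mult.assoc)
  qed
  have "?C S N =
     (\<Sum>A\<in>S. ?L S (Suc N) A - cst ((- 1) ^ (card S - 1)) * ?R S (Suc N) A)"
    unfolding pick by (simp add: sum_subtractf sum_distrib_left)
  also have "\<dots> = (\<Sum>A\<in>S. sgw {A} (S - {A}) * (case A of Inl _ \<Rightarrow> 0 | Inr l \<Rightarrow> ad (kapranov l) (\<alpha> (S - {A})) N))"
  proof (rule sum.cong[OF refl])
    fix A assume A: "A \<in> S"
    have "(\<Sum>k\<le>Suc N. beta k (JI A) (\<alpha> (S - {A}) (Suc N - k))) - (\<Sum>k\<le>Suc N. beta k (\<alpha> (S - {A}) (Suc N - k)) (JI A)) =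
       (case A of Inl _ \<Rightarrow> 0 | Inr l \<Rightarrow> ad (kapranov l) (\<alpha> (S - {A})) N)"
      by (cases A) (simp_all only: JI_def sum.case commutator_ad beta_0_left beta_0_right sum.neutral_const diff_self)
    then show "?L S (Suc N) A - cst ((- 1) ^ (card S - 1)) * ?R S (Suc N) A =
       sgw {A} (S - {A}) * (case A of Inl _ \<Rightarrow> 0 | Inr l \<Rightarrow> ad (kapranov l) (\<alpha> (S - {A})) N)"
      unfolding sign[OF A] right_diff_distrib[symmetric] by simp
  qed
  finally show "?C S N =
     (\<Sum>A\<in>S. sgw {A} (S - {A}) * (case A of Inl _ \<Rightarrow> 0 | Inr l \<Rightarrow> ad (kapranov l) (\<alpha> (S - {A})) N))" .
qed

lemma rep_D_F:
  assumes "rep z a \<alpha>"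
  shows "rep z (D_F_chart G a) (\<lambda>S N. \<Sum>A\<in>S. sgw {A} (S - {A}) * T kapranov A (\<alpha> (S - {A})) N)"
proof (rule rep_eq)
  show "rep z (D_F_chart G a) (\<lambda>S N. (\<Sum>A\<in>UNIV \<inter> S. sgw {A} (S - {A}) * conn A (\<alpha> (S - {A}) N))
     - (\<Sum>A\<in>UNIV \<inter> S. sgw {A} (S - {A}) * pdy A (\<alpha> (S - {A}) N))
     + (\<Sum>A\<in>S. sgw {A} (S - {A}) * (case A of Inl _ \<Rightarrow> 0 | Inr l \<Rightarrow> ad (kapranov l) (\<alpha> (S - {A})) N)))"
    unfolding D_F_chart_def delta_def
    by (intro rep_add rep_diff rep_nabla rep_dx_sum rep_dy rep_wick_comm assms)
qed (simp add: T_def sum_subtractf sum.distrib distrib_left right_diff_distrib)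

lemma T_add: "T f A (\<lambda>N. a N + b N) N = T f A a N + T f A b N"
  by (cases A) (simp_all add: T_def conn.add V.D.add ad_add_right)

lemma T_0: "T f A (\<lambda>_. 0) N = 0"
  using T_add[of f A "\<lambda>_. 0" "\<lambda>_. 0" N] by simp

lemma T_uminus: "T f A (\<lambda>N. - a N) N = - T f A a N"
  using T_add[of f A a "\<lambda>N. - a N" N] by (simp add: T_0 eq_neg_iff_add_eq_0 add.commute)

lemma T_sgw_mult: "T f A (\<lambda>N. sgw Q Y * a N) N = sgw Q Y * T f A a N"
  by (cases "even (card {(s, t). s \<in> Q \<and> t \<in> Y \<and> idx_less t s})") (simp_all add: sgw_def T_uminus)

lemma T_sum: "T f A (\<lambda>N. \<Sum>i\<in>P. a i N) N = (\<Sum>i\<in>P. T f A (a i) N)"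
  by (induction P rule: infinite_finite_induct) (simp_all add: T_0 T_add)

text \<open>In the square, each pair of distinct directions occurs in both orders: the wedge signs
  are antisymmetric and the products of the operators \<open>T\<close> symmetric. The vanishing germ
  is then evaluated at \<open>z\<close>.\<close>

theorem D_F_chart_flat:
  assumes "rep z a \<alpha>"
  shows "D_F_chart G (D_F_chart G a) z = 0"
proof (intro ext)
  fix S m
  let ?\<phi> = "\<lambda>S N. \<Sum>A\<in>S. sgw {A} (S - {A}) *
     T kapranov A (\<lambda>N. \<Sum>B\<in>S - {A}. sgw {B} (S - {A} - {B}) * T kapranov B (\<alpha> (S - {A} - {B})) N) N"
  have "rep z (D_F_chart G (D_F_chart G a)) ?\<phi>"
    by (intro rep_D_F assms)
  moreover have "?\<phi> S N = 0" for S N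
  proof -
    have "(\<Sum>A\<in>S. \<Sum>B\<in>S - {A}. sgw {A} (S - {A}) * sgw {B} (S - {A} - {B}) *
        T kapranov A (T kapranov B (\<alpha> (S - {A} - {B}))) N) = 0"
    proof (rule sum_antisymmetric_eq_0)
      fix A B assume AB: "A \<in> S" "B \<in> S" "A \<noteq> B"
      have "S - {A} - {B} = S - {B} - {A}" by auto
      then show "sgw {A} (S - {A}) * sgw {B} (S - {A} - {B}) * T kapranov A (T kapranov B (\<alpha> (S - {A} - {B}))) N =
        - (sgw {B} (S - {B}) * sgw {A} (S - {B} - {A}) * T kapranov B (T kapranov A (\<alpha> (S - {B} - {A}))) N)"
        using sgw_antisym[OF AB, where 'r = "'n gmps"] T_commute[of A B] by simp
    qed simp
    then show ?thesis
      by (simp add: T_sum T_sgw_mult[of _ _ _ _ "T _ _ _"] sum_distrib_left mult.assoc)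
  qed
  ultimately have germ: "is_germ z (\<lambda>x. fps_nth (D_F_chart G (D_F_chart G a) x S m) N) 0" for N
    by (auto dest: repD[of _ _ _ S m N])
  have "fps_nth (D_F_chart G (D_F_chart G a) z S m) N = geval (0 :: 'n germ)" for N
    using is_germ_eval[OF germ[of N]] .
  moreover have "geval (0 :: 'n germ) = 0"
    using is_germ_eval[OF is_germ_0[of z]] by simp
  ultimately show "D_F_chart G (D_F_chart G a) z S m = 0 S m"
    by (simp add: fps_eq_iff)
qed

end

section \<open>From germs to sections over the manifold\<close>

lemma det_nonzero_if_positive:
  fixes A :: "((complex, 'n::finite) vec, 'n) vec"
  assumes "\<And>v. v \<noteq> 0 \<Longrightarrow> 0 < Re (\<Sum>\<alpha>\<in>UNIV. \<Sum>\<beta>\<in>UNIV. A $ \<alpha> $ \<beta> * v $ \<alpha> * cnj (v $ \<beta>))"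
  shows "det A \<noteq> 0"
proof
  assume "det A = 0"
  then obtain w where w: "A *v w = 0" "w \<noteq> 0"
    using invertible_det_nz[of A] invertible_left_inverse[of A] matrix_left_invertible_ker[of A] by blast
  \<comment> \<open>The form conjugates its second argument, so the conjugate of the kernel vector
    makes the inner sum the product of \<open>A\<close> with \<open>w\<close>.\<close>
  define v where "v = (\<chi> i. cnj (w $ i))"
  have "(\<Sum>\<beta>\<in>UNIV. A $ \<alpha> $ \<beta> * v $ \<alpha> * cnj (v $ \<beta>)) = v $ \<alpha> * (A *v w) $ \<alpha>" for \<alpha>
    by (simp add: v_def matrix_vector_mult_def sum_distrib_left mult_ac)
  then have "(\<Sum>\<alpha>\<in>UNIV. \<Sum>\<beta>\<in>UNIV. A $ \<alpha> $ \<beta> * v $ \<alpha> * cnj (v $ \<beta>)) = 0"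
    by (simp add: w)
  moreover have "v \<noteq> 0"
    using w(2) by (auto simp: v_def vec_eq_iff)
  ultimately show False
    using assms[of v] by simp
qed

lemma (in complex_manifold) open_chart_image:
  assumes "c \<in> atlas" "open V"
  shows "open (chart_image c V)"
proof -
  obtain \<psi> where "homeomorphism (fst c) (snd c ` fst c) (snd c) \<psi>"
    using chart_homeomorphism[OF assms(1)] by blast
  then have "openin (top_of_set (snd c ` fst c)) (snd c ` (fst c \<inter> V))"
    using assms(2) by (intro homeomorphism_imp_open_map) auto
  then show ?thesis
    using chart_open[OF assms(1)] openin_open_trans unfolding chart_image_def by blast
qed

theorem theorem2p17:
  fixes atlas :: "('a::{t2_space, second_countable_topology}, 'n::{finite, linorder}) chart set"
    and g :: "('a, 'n) chart \<Rightarrow> 'n hmetric"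
  assumes "kaehler_manifold atlas g"
  shows "flat_connection atlas (D_F g)"
  unfolding flat_connection_def
proof (intro allI impI ballI)
  interpret kaehler_manifold atlas g by fact
  fix V a c z
  assume V: "open V" and a: "a \<in> weyl_forms atlas V" and c: "c \<in> atlas" and z: "z \<in> chart_image c V"
  interpret kaehler_point "g c" "chart_image c UNIV" z
  proof
    show "open (chart_image c UNIV)"
      using c by (intro open_chart_image) auto
    show "z \<in> chart_image c UNIV"
      using z by (auto simp: chart_image_def)
    show "det (g c x) \<noteq> 0" if "x \<in> chart_image c UNIV" for x
      using metric_positive[OF c that] by (intro det_nonzero_if_positive) auto
  qed (use metric_smooth[OF c] kaehler_form_closed[OF c] in auto)
  \<comment> \<open>Smoothness of the section over \<open>V\<close> provides a germ for every
    coefficient, which is all that the pointwise statement \<open>D_F_chart_flat\<close>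
    requires.\<close>
  have "\<exists>\<phi>. is_germ z (\<lambda>x. fps_nth (a c x S m) k) \<phi>" for S m k
    using a c open_chart_image[OF c V] z by (intro is_germ_exists[of "chart_image c V"]) (auto simp: weyl_forms_def)
  then obtain \<phi> where "is_germ z (\<lambda>x. fps_nth (a c x S m) k) (\<phi> S m k)" for S m k
    by metis
  then have "rep z (a c) (\<lambda>S k. Mps (\<lambda>m. \<phi> S m k))"
    by (simp add: rep_def)
  then show "D_F g (D_F g a) c z = 0"
    unfolding D_F_def by (rule D_F_chart_flat)
qed

end
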